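(* There exists a compact smooth manifold $M$ admitting two almost complex structures $J_1$ and $J_2$ such that $h^1_{d+d^c}(J_1)\ne h^1_{d+d^c}(J_2)$. Moreover, one can take $J_1$ and $J_2$ in such a way that $$\operatorname{rk}N_{J_1}|_x=\operatorname{rk}N_{J_2}|_x$$ at every point $x\in M$ and $h^1_{d+d^c}(J_1)\ne h^1_{d+d^c}(J_2)$.
   Context: $A^k$ is the space of smooth complex $k$-forms on $M$, bigraded by an almost complex structure $J$; $J$ acts on forms by $J\alpha=i^{p-q}\alpha$ for $\alpha\in A^{p,q}$, and $d^c:=J^{-1}dJ$. On a compact almost complex manifold $(M,J)$, $h^1_{d+d^c}(J):=\dim_{\mathbb C}\{\alpha\in A^1:d\alpha=0,\ d^c\alpha=0\}$. $N_J(X,Y)=[JX,JY]-J[JX,Y]-J[X,JY]-[X,Y]$ is the Nijenhuis tensor. Its rank at $x$ is the complex rank of the linear map $\bar\mu_x\colon A^{1,0}_x\to A^{0,2}_x$, where $\bar\mu$ is the component of $d$ of bidegree $(-1,2)$ (tensorial, and equal to the dual of $N_J$ up to a constant). *)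

theory Defs
  imports "HOL-Analysis.Analysis" "HOL-Library.Function_Algebras"
begin

subsection \<open>Smooth manifolds\<close>

text \<open>
  \<open>\<real>\<^sup>n\<close> for a natural number \<open>n\<close> is the library's \<^const>\<open>Euclidean_space\<close>: the functions
  \<open>nat \<Rightarrow> real\<close> vanishing at all \<open>i \<ge> n\<close>. Coordinates are numbered \<open>0, \<dots>, n - 1\<close>.
\<close>

definition partial :: "nat \<Rightarrow> ((nat \<Rightarrow> real) \<Rightarrow> 'b::real_normed_vector) \<Rightarrow> (nat \<Rightarrow> real) \<Rightarrow> 'b"
  where "partial j f p = vector_derivative (\<lambda>t. f (p(j := t))) (at (p j))"

text \<open>
  \<open>C\<^sup>\<infinity>\<close> on an open subset \<open>V\<close> of \<open>\<real>\<^sup>n\<close>: all iterated partial derivatives exist and are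
  continuous on \<open>V\<close>.
\<close>

definition smooth_on :: "nat \<Rightarrow> (nat \<Rightarrow> real) set \<Rightarrow> ((nat \<Rightarrow> real) \<Rightarrow> 'b::real_normed_vector) \<Rightarrow> bool"
  where "smooth_on n V f \<longleftrightarrow>
    (\<forall>js. set js \<subseteq> {..<n} \<longrightarrow>
      continuous_map (subtopology (Euclidean_space n) V) euclidean (foldr partial js f) \<and>
      (\<forall>j<n. \<forall>p\<in>V. (\<lambda>t. foldr partial js f (p(j := t))) differentiable (at (p j))))"

type_synonym 'p chart = "'p set \<times> ('p \<Rightarrow> nat \<Rightarrow> real)"

record 'p mfd =
  mdim :: nat
  mtop :: "'p topology"
  charts :: "'p chart set"

abbreviation points :: "'p mfd \<Rightarrow> 'p set"
  where "points M \<equiv> topspace (mtop M)"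

definition in_chart :: "'p chart \<Rightarrow> ('p \<Rightarrow> 'b) \<Rightarrow> (nat \<Rightarrow> real) \<Rightarrow> 'b"
  where "in_chart c f p = f (inv_into (fst c) (snd c) p)"

text \<open>\<open>\<partial>f/\<partial>x\<^sup>j\<close> at \<open>x\<close>, in the coordinates of the chart \<open>c\<close>.\<close>

definition chart_partial :: "'p chart \<Rightarrow> nat \<Rightarrow> ('p \<Rightarrow> 'b::real_normed_vector) \<Rightarrow> 'p \<Rightarrow> 'b"
  where "chart_partial c j f x = partial j (in_chart c f) (snd c x)"

definition smooth_in_chart :: "'p mfd \<Rightarrow> 'p chart \<Rightarrow> 'p set \<Rightarrow> ('p \<Rightarrow> 'b::real_normed_vector) \<Rightarrow> bool"
  where "smooth_in_chart M c U f \<longleftrightarrow> smooth_on (mdim M) (snd c ` U) (in_chart c f)"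

text \<open>
  The smooth structure is given by an atlas, not required to be maximal; every notion below is
  invariant under passing to the maximal atlas. The points come from an arbitrary type with its
  own topology \<open>mtop\<close>; as a manifold has at most continuum many points, fixing a point type of
  that cardinality, such as \<open>nat \<Rightarrow> real\<close>, is no restriction.
\<close>

definition smooth_manifold :: "'p mfd \<Rightarrow> bool"
  where "smooth_manifold M \<longleftrightarrow>
    Hausdorff_space (mtop M) \<and> second_countable (mtop M) \<and>
    (\<forall>c\<in>charts M. openin (mtop M) (fst c) \<and>
       openin (Euclidean_space (mdim M)) (snd c ` fst c) \<and>
       homeomorphic_map (subtopology (mtop M) (fst c))
         (subtopology (Euclidean_space (mdim M)) (snd c ` fst c)) (snd c)) \<and>
    (\<Union>c\<in>charts M. fst c) = points M \<and>
    (\<forall>c\<in>charts M. \<forall>e\<in>charts M. \<forall>i<mdim M.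
       smooth_in_chart M c (fst c \<inter> fst e) (\<lambda>x. snd e x i))"

definition compact_smooth_manifold :: "'p mfd \<Rightarrow> bool"
  where "compact_smooth_manifold M \<longleftrightarrow> smooth_manifold M \<and> compact_space (mtop M)"

subsection \<open>Tangent spaces\<close>

text \<open>
  A tangent vector at \<open>x\<close> is the family of its component vectors in all charts around \<open>x\<close>,
  related by the Jacobians of the coordinate changes (and set to zero at irrelevant arguments,
  so that equality of tangent vectors is equality of functions).
\<close>

type_synonym 'p tvec = "'p chart \<Rightarrow> nat \<Rightarrow> real"
type_synonym 'p cvec = "'p chart \<Rightarrow> nat \<Rightarrow> complex"

definition tangent_space :: "'p mfd \<Rightarrow> 'p \<Rightarrow> 'p tvec set"
  where "tangent_space M x = {v.
    (\<forall>c\<in>charts M. \<forall>e\<in>charts M. x \<in> fst c \<and> x \<in> fst e \<longrightarrow>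
       (\<forall>i<mdim M. v e i = (\<Sum>j<mdim M. v c j * chart_partial c j (\<lambda>y. snd e y i) x))) \<and>
    (\<forall>c i. c \<notin> charts M \<or> x \<notin> fst c \<or> i \<ge> mdim M \<longrightarrow> v c i = 0)}"

text \<open>The coordinate vector field \<open>\<partial>/\<partial>x\<^sup>j\<close> of the chart \<open>c\<close>, evaluated at \<open>x\<close>.\<close>

definition coord_vec :: "'p mfd \<Rightarrow> 'p chart \<Rightarrow> nat \<Rightarrow> 'p \<Rightarrow> 'p tvec"
  where "coord_vec M c j x = (\<lambda>e i.
    if e \<in> charts M \<and> x \<in> fst e \<and> i < mdim M then chart_partial c j (\<lambda>y. snd e y i) x else 0)"

definition re_vec :: "'p cvec \<Rightarrow> 'p tvec"
  where "re_vec v = (\<lambda>c i. Re (v c i))"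

definition im_vec :: "'p cvec \<Rightarrow> 'p tvec"
  where "im_vec v = (\<lambda>c i. Im (v c i))"

definition complex_vec :: "'p tvec \<Rightarrow> 'p tvec \<Rightarrow> 'p cvec"
  where "complex_vec u w = (\<lambda>c i. Complex (u c i) (w c i))"

text \<open>The complexification \<open>T\<^sub>x M \<otimes> \<complex>\<close>.\<close>

definition ctangent_space :: "'p mfd \<Rightarrow> 'p \<Rightarrow> 'p cvec set"
  where "ctangent_space M x = {v. re_vec v \<in> tangent_space M x \<and> im_vec v \<in> tangent_space M x}"

text \<open>The field with constant components \<open>w\<close> in the chart \<open>c\<close>.\<close>

definition const_field :: "'p mfd \<Rightarrow> 'p chart \<Rightarrow> (nat \<Rightarrow> complex) \<Rightarrow> 'p \<Rightarrow> 'p cvec"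
  where "const_field M c w x = (\<lambda>e i. \<Sum>l<mdim M. w l * of_real (coord_vec M c l x e i))"

definition vec_comb :: "'a::ring_1 \<Rightarrow> ('c \<Rightarrow> nat \<Rightarrow> 'a) \<Rightarrow> 'a \<Rightarrow> ('c \<Rightarrow> nat \<Rightarrow> 'a) \<Rightarrow> 'c \<Rightarrow> nat \<Rightarrow> 'a"
  where "vec_comb a u b v = (\<lambda>c i. a * u c i + b * v c i)"

subsection \<open>Complex differential forms\<close>

text \<open>
  \<open>\<Lambda>\<^sup>k(T\<^sub>x M)\<^sup>* \<otimes> \<complex>\<close>, as alternating \<open>\<complex>\<close>-multilinear functions of \<open>k\<close> complexified tangent vectors;
  the argument tuple is a list, and the value is 0 on lists that are not such a tuple.
\<close>

type_synonym 'p covec = "'p cvec list \<Rightarrow> complex"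
type_synonym 'p form = "'p \<Rightarrow> 'p covec"

definition alt_forms :: "'p mfd \<Rightarrow> nat \<Rightarrow> 'p \<Rightarrow> 'p covec set"
  where "alt_forms M k x = {a.
    (\<forall>vs. \<not> (length vs = k \<and> set vs \<subseteq> ctangent_space M x) \<longrightarrow> a vs = 0) \<and>
    (\<forall>vs m u w s t. length vs = k \<and> set vs \<subseteq> ctangent_space M x \<and> m < k \<and>
       u \<in> ctangent_space M x \<and> w \<in> ctangent_space M x \<longrightarrow>
       a (vs[m := vec_comb s u t w]) = s * a (vs[m := u]) + t * a (vs[m := w])) \<and>
    (\<forall>vs l m. length vs = k \<and> set vs \<subseteq> ctangent_space M x \<and> l < m \<and> m < k \<and> vs ! l = vs ! m
       \<longrightarrow> a vs = 0)}"

text \<open>\<open>A\<^sup>k\<close>: smooth complex \<open>k\<close>-forms; smoothness means smooth coefficients in every chart.\<close>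

definition forms :: "'p mfd \<Rightarrow> nat \<Rightarrow> 'p form set"
  where "forms M k = {\<alpha>.
    (\<forall>x\<in>points M. \<alpha> x \<in> alt_forms M k x) \<and> (\<forall>x. x \<notin> points M \<longrightarrow> \<alpha> x = 0) \<and>
    (\<forall>c\<in>charts M. \<forall>js. length js = k \<and> set js \<subseteq> {..<mdim M} \<longrightarrow>
       smooth_in_chart M c (fst c) (\<lambda>y. \<alpha> y (map (\<lambda>j. complex_vec (coord_vec M c j y) 0) js)))}"

text \<open>
  Exterior derivative: with \<open>c\<close> any chart around \<open>x\<close> (the result does not depend on the choice),
  \<open>d\<alpha>(v\<^sub>0,\<dots>,v\<^sub>k) = \<Sum>\<^sub>m (-1)\<^sup>m v\<^sub>m(\<alpha>(v\<^sub>0,\<dots>,v\<^sub>m omitted,\<dots>,v\<^sub>k))\<close>, where the \<open>v\<^sub>i\<close> are extended to vector fields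
  with constant components in \<open>c\<close>, so that the bracket terms of the invariant formula vanish.
\<close>

definition ext_d :: "'p mfd \<Rightarrow> 'p form \<Rightarrow> 'p form"
  where "ext_d M \<alpha> x vs =
    (if x \<in> points M \<and> set vs \<subseteq> ctangent_space M x then
       (let c = (SOME c. c \<in> charts M \<and> x \<in> fst c) in
        \<Sum>m<length vs. (-1) ^ m * (\<Sum>j<mdim M. (vs ! m) c j *
          chart_partial c j
            (\<lambda>y. \<alpha> y (map (\<lambda>v. const_field M c (v c) y) (take m vs @ drop (Suc m) vs))) x))
     else 0)"

subsection \<open>Almost complex structures and the bigrading\<close>

type_synonym 'p endo = "'p \<Rightarrow> 'p tvec \<Rightarrow> 'p tvec"

definition almost_complex_structure :: "'p mfd \<Rightarrow> 'p endo \<Rightarrow> bool"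
  where "almost_complex_structure M J \<longleftrightarrow>
    (\<forall>x\<in>points M.
       (\<forall>v\<in>tangent_space M x. J x v \<in> tangent_space M x) \<and>
       (\<forall>u\<in>tangent_space M x. \<forall>v\<in>tangent_space M x. \<forall>s t.
          J x (vec_comb s u t v) = vec_comb s (J x u) t (J x v)) \<and>
       (\<forall>v\<in>tangent_space M x. J x (J x v) = - v)) \<and>
    (\<forall>c\<in>charts M. \<forall>i<mdim M. \<forall>j<mdim M.
       smooth_in_chart M c (fst c) (\<lambda>y. J y (coord_vec M c j y) c i))"

definition J_complex :: "'p endo \<Rightarrow> 'p \<Rightarrow> 'p cvec \<Rightarrow> 'p cvec"
  where "J_complex J x v = complex_vec (J x (re_vec v)) (J x (im_vec v))"

text \<open>The projections \<open>(1 - \<i>J)/2\<close> and \<open>(1 + \<i>J)/2\<close> onto \<open>T\<^sup>1\<^sup>,\<^sup>0\<close> and \<open>T\<^sup>0\<^sup>,\<^sup>1\<close>.\<close>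

definition proj_10 :: "'p endo \<Rightarrow> 'p \<Rightarrow> 'p cvec \<Rightarrow> 'p cvec"
  where "proj_10 J x v = vec_comb (1/2) v (- \<i>/2) (J_complex J x v)"

definition proj_01 :: "'p endo \<Rightarrow> 'p \<Rightarrow> 'p cvec \<Rightarrow> 'p cvec"
  where "proj_01 J x v = vec_comb (1/2) v (\<i>/2) (J_complex J x v)"

text \<open>
  The component of bidegree \<open>(p,q)\<close> of a \<open>(p+q)\<close>-covector: split every argument as
  \<open>v = v\<^sup>1\<^sup>,\<^sup>0 + v\<^sup>0\<^sup>,\<^sup>1\<close>, expand, and keep the terms having exactly \<open>p\<close> arguments in \<open>T\<^sup>1\<^sup>,\<^sup>0\<close>.
\<close>

definition bidegree_part :: "'p mfd \<Rightarrow> 'p endo \<Rightarrow> nat \<Rightarrow> nat \<Rightarrow> 'p \<Rightarrow> 'p covec \<Rightarrow> 'p covec"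
  where "bidegree_part M J p q x a vs =
    (if length vs = p + q \<and> set vs \<subseteq> ctangent_space M x then
       (\<Sum>S | S \<subseteq> {..<p+q} \<and> card S = p.
          a (map (\<lambda>m. if m \<in> S then proj_10 J x (vs ! m) else proj_01 J x (vs ! m)) [0..<p+q]))
     else 0)"

definition alt_forms_pq :: "'p mfd \<Rightarrow> 'p endo \<Rightarrow> nat \<Rightarrow> nat \<Rightarrow> 'p \<Rightarrow> 'p covec set"
  where "alt_forms_pq M J p q x = {a \<in> alt_forms M (p + q) x. bidegree_part M J p q x a = a}"

definition forms_pq :: "'p mfd \<Rightarrow> 'p endo \<Rightarrow> nat \<Rightarrow> nat \<Rightarrow> 'p form set"
  where "forms_pq M J p q = {\<alpha> \<in> forms M (p + q). \<forall>x\<in>points M. \<alpha> x \<in> alt_forms_pq M J p q x}"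

text \<open>\<open>J\<close> and \<open>J\<^sup>-\<^sup>1\<close> on \<open>k\<close>-forms: multiplication by \<open>\<i>\<^sup>p\<^sup>-\<^sup>q\<close>, respectively \<open>\<i>\<^sup>q\<^sup>-\<^sup>p\<close>, on \<open>A\<^sup>p\<^sup>,\<^sup>q\<close>.\<close>

definition J_form :: "'p mfd \<Rightarrow> 'p endo \<Rightarrow> nat \<Rightarrow> 'p form \<Rightarrow> 'p form"
  where "J_form M J k \<alpha> x vs =
    (\<Sum>p\<le>k. \<i> powi (int p - int (k - p)) * bidegree_part M J p (k - p) x (\<alpha> x) vs)"

definition J_inv_form :: "'p mfd \<Rightarrow> 'p endo \<Rightarrow> nat \<Rightarrow> 'p form \<Rightarrow> 'p form"
  where "J_inv_form M J k \<alpha> x vs =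
    (\<Sum>p\<le>k. \<i> powi (int (k - p) - int p) * bidegree_part M J p (k - p) x (\<alpha> x) vs)"

text \<open>\<open>d\<^sup>c = J\<^sup>-\<^sup>1 d J\<close> on \<open>k\<close>-forms.\<close>

definition d_c :: "'p mfd \<Rightarrow> 'p endo \<Rightarrow> nat \<Rightarrow> 'p form \<Rightarrow> 'p form"
  where "d_c M J k \<alpha> = J_inv_form M J (Suc k) (ext_d M (J_form M J k \<alpha>))"

subsection \<open>The invariants\<close>

definition form_scale :: "complex \<Rightarrow> 'p form \<Rightarrow> 'p form"
  where "form_scale s \<alpha> = (\<lambda>x vs. s * \<alpha> x vs)"

definition covec_scale :: "complex \<Rightarrow> 'p covec \<Rightarrow> 'p covec"
  where "covec_scale s a = (\<lambda>vs. s * a vs)"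

lemma vector_space_form_scale: "vector_space form_scale"
  by unfold_locales (auto simp: form_scale_def fun_eq_iff algebra_simps)

lemma vector_space_covec_scale: "vector_space covec_scale"
  by unfold_locales (auto simp: covec_scale_def fun_eq_iff algebra_simps)

text \<open>
  On a compact manifold this space is finite-dimensional, so the library convention that \<open>dim\<close> is
  0 in the infinite-dimensional case is not used.
\<close>

definition h1_d_dc :: "'p mfd \<Rightarrow> 'p endo \<Rightarrow> nat"
  where "h1_d_dc M J =
    vector_space.dim form_scale {\<alpha> \<in> forms M 1. ext_d M \<alpha> = 0 \<and> d_c M J 1 \<alpha> = 0}"

text \<open>\<open>\<mu>\<close>-bar on \<open>A\<^sup>1\<^sup>,\<^sup>0\<close>: there the component of \<open>d\<close> of bidegree \<open>(-1,2)\<close> takes values in \<open>A\<^sup>0\<^sup>,\<^sup>2\<close>.\<close>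

definition mu_bar :: "'p mfd \<Rightarrow> 'p endo \<Rightarrow> 'p form \<Rightarrow> 'p form"
  where "mu_bar M J \<alpha> x = bidegree_part M J 0 2 x (ext_d M \<alpha> x)"

text \<open>
  Since \<open>\<mu>\<close>-bar is tensorial, it induces \<open>A\<^sup>1\<^sup>,\<^sup>0\<^sub>x \<rightarrow> A\<^sup>0\<^sup>,\<^sup>2\<^sub>x\<close>: extend the covector to any form in
  \<open>A\<^sup>1\<^sup>,\<^sup>0\<close> and evaluate at \<open>x\<close>.
\<close>

definition mu_bar_at :: "'p mfd \<Rightarrow> 'p endo \<Rightarrow> 'p \<Rightarrow> 'p covec \<Rightarrow> 'p covec"
  where "mu_bar_at M J x a = mu_bar M J (SOME \<alpha>. \<alpha> \<in> forms_pq M J 1 0 \<and> \<alpha> x = a) x"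

text \<open>The rank of the Nijenhuis tensor of \<open>J\<close> at \<open>x\<close> is by definition the complex rank of \<open>\<mu>\<close>-bar at \<open>x\<close>.\<close>

definition nijenhuis_rank :: "'p mfd \<Rightarrow> 'p endo \<Rightarrow> 'p \<Rightarrow> nat"
  where "nijenhuis_rank M J x =
    vector_space.dim covec_scale (mu_bar_at M J x ` alt_forms_pq M J 1 0 x)"

end

theory Submission
  imports Defs "HOL-Complex_Analysis.Complex_Analysis"
begin

text \<open>
  On the torus \<open>\<real>\<^sup>4/\<int>\<^sup>4\<close> let \<open>c\<close> and \<open>s\<close> be the cosine and sine of \<open>2\<pi>x\<^sub>0\<close>, and consider the frame \<open>X\<^sub>1 = \<partial>\<^sub>0\<close>,
  \<open>X\<^sub>2 = c \<partial>\<^sub>1 + s \<partial>\<^sub>2\<close>, \<open>X\<^sub>3 = - s \<partial>\<^sub>1 + c \<partial>\<^sub>2\<close>, \<open>X\<^sub>4 = \<partial>\<^sub>3\<close>. A one-form lies in the space defining \<open>h\<^sup>1\<close> iff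
  \<open>\<alpha>\<close> and \<open>J\<alpha> = \<alpha> \<circ> J\<close> are both closed; such forms annihilate the values of the Nijenhuis tensor.

  For the structure \<open>X\<^sub>1 \<mapsto> X\<^sub>2\<close>, \<open>X\<^sub>3 \<mapsto> X\<^sub>4\<close> the values of the Nijenhuis tensor span \<open>X\<^sub>1\<close> and \<open>X\<^sub>2\<close> everywhere. As
  \<open>[X\<^sub>1, X\<^sub>2] = 2\<pi> X\<^sub>3\<close>, a closed form vanishing on \<open>X\<^sub>1\<close> and \<open>X\<^sub>2\<close> vanishes on \<open>X\<^sub>3\<close>; applied to \<open>\<alpha>\<close> and to
  \<open>J\<alpha>\<close> this gives \<open>\<alpha> = 0\<close>. For the structure with \<open>\<partial>\<^sub>0 \<mapsto> \<partial>\<^sub>3\<close> that acts on the span of \<open>\<partial>\<^sub>1\<close> and \<open>\<partial>\<^sub>2\<close> by a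
  nonconstant loop in the upper half plane, the values span \<open>\<partial>\<^sub>1\<close> and \<open>\<partial>\<^sub>2\<close>, and \<open>\<alpha>\<close> is a combination of \<open>dx\<^sub>0\<close> and
  \<open>dx\<^sub>3\<close>; by Liouville's theorem its coefficients are constant, so that the invariant is 2. In real dimension four
  a nonvanishing \<open>\<mu>\<close>-bar has rank one, so that both ranks are one at every point.
\<close>

section \<open>Smoothness on open subsets of Euclidean space\<close>

text \<open>Moving a coordinate below \<open>n\<close> stays inside the subspace of functions
  vanishing from \<open>n\<close> on, and the move is continuous in \<open>t\<close>. Hence a
  partial derivative at a point of an open set depends only on the values on that set.\<close>

lemma eventually_fun_upd_mem:
  assumes "openin (Euclidean_space n) V" "p \<in> V" "j < n"
  shows "\<forall>\<^sub>F t in nhds (p j). p(j := t) \<in> V"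
proof -
  obtain T where T: "open T" "V = T \<inter> {x. \<forall>i\<ge>n. x i = 0}"
    using assms(1) by (auto simp: Euclidean_space_def euclidean_product_topology openin_subtopology)
  have "continuous_on UNIV (\<lambda>t. p(j := t))"
  proof (rule continuous_on_coordinatewise_then_product)
    show "continuous_on UNIV (\<lambda>t. (p(j := t)) i)" for i
      by (cases "i = j") auto
  qed
  then have "open ((\<lambda>t. p(j := t)) -` T)"
    using T(1) by (metis continuous_on_open_vimage open_UNIV Int_UNIV_right)
  moreover have "p j \<in> (\<lambda>t. p(j := t)) -` T"
    using assms(2) T by simp
  ultimately have "\<forall>\<^sub>F t in nhds (p j). t \<in> (\<lambda>t. p(j := t)) -` T"
    by (rule eventually_nhds_in_open)
  then show ?thesis
    by eventually_elim (use assms T in auto)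
qed

lemma partial_cong:
  assumes "openin (Euclidean_space n) V" "p \<in> V" "j < n" "\<And>q. q \<in> V \<Longrightarrow> f q = g q"
  shows "partial j f p = partial j g p"
  unfolding partial_def
proof (rule vector_derivative_cong_eq)
  show "\<forall>\<^sub>F t in nhds (p j). t \<in> UNIV \<longrightarrow> f (p(j := t)) = g (p(j := t))"
    using eventually_fun_upd_mem[OF assms(1-3)] by eventually_elim (use assms(4) in auto)
qed auto

lemma differentiable_fun_upd_cong:
  assumes "openin (Euclidean_space n) V" "p \<in> V" "j < n" "\<And>q. q \<in> V \<Longrightarrow> f q = g q"
    and "(\<lambda>t. f (p(j := t))) differentiable (at (p j))"
  shows "(\<lambda>t. g (p(j := t))) differentiable (at (p j))"
proof -
  have ev: "\<forall>\<^sub>F t in nhds (p j). f (p(j := t)) = g (p(j := t))"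
    using eventually_fun_upd_mem[OF assms(1-3)] by eventually_elim (use assms(4) in auto)
  obtain D where D: "((\<lambda>t. f (p(j := t))) has_derivative D) (at (p j))"
    using assms(5) unfolding differentiable_def by blast
  have "((\<lambda>t. g (p(j := t))) has_derivative D) (at (p j))"
  proof (rule has_derivative_transform_eventually[OF D])
    show "\<forall>\<^sub>F t in at (p j). f (p(j := t)) = g (p(j := t))"
      using ev unfolding eventually_at_filter by eventually_elim simp
    show "f (p(j := p j)) = g (p(j := p j))"
      using ev by (rule eventually_nhds_x_imp_x)
  qed simp
  then show ?thesis unfolding differentiable_def by blast
qed

lemma foldr_partial_cong:
  assumes "openin (Euclidean_space n) V" "set js \<subseteq> {..<n}" "\<And>q. q \<in> V \<Longrightarrow> f q = g q" "p \<in> V"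
  shows "foldr partial js f p = foldr partial js g p"
  using assms(2,4)
proof (induction js arbitrary: p)
  case (Cons j js)
  then show ?case
    by (auto intro!: partial_cong[OF assms(1)])
qed (simp add: assms(3))

lemma smooth_on_cong:
  assumes "openin (Euclidean_space n) V" "\<And>q. q \<in> V \<Longrightarrow> f q = g q" "smooth_on n V f"
  shows "smooth_on n V g"
  unfolding smooth_on_def
proof (intro allI impI conjI ballI)
  fix js assume js: "set js \<subseteq> {..<n}"
  note eq = foldr_partial_cong[OF assms(1) js assms(2)]
  have "continuous_map (subtopology (Euclidean_space n) V) euclidean (foldr partial js f)"
    using assms(3) js unfolding smooth_on_def by blast
  then show "continuous_map (subtopology (Euclidean_space n) V) euclidean (foldr partial js g)"
    by (rule continuous_map_eq) (simp add: eq)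
  fix j p assume jp: "j < n" "p \<in> V"
  then have D: "(\<lambda>t. foldr partial js f (p(j := t))) differentiable at (p j)"
    using assms(3) js unfolding smooth_on_def by blast
  show "(\<lambda>t. foldr partial js g (p(j := t))) differentiable at (p j)"
    by (rule differentiable_fun_upd_cong[OF assms(1) jp(2,1) _ D]) (simp add: eq)
qed

lemma smooth_on_subset:
  assumes "smooth_on n V f" "W \<subseteq> V"
  shows "smooth_on n W f"
  using assms unfolding smooth_on_def by (meson continuous_map_from_subtopology_mono subsetD)

lemma smooth_on_local:
  assumes "\<And>p. p \<in> V \<Longrightarrow> \<exists>W. openin (Euclidean_space n) W \<and> p \<in> W \<and> smooth_on n W f"
  shows "smooth_on n V f"
  unfolding smooth_on_def
proof (intro allI impI conjI ballI)
  fix js assume js: "set js \<subseteq> {..<n}"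
  obtain W where W: "\<And>p. p \<in> V \<Longrightarrow> openin (Euclidean_space n) (W p) \<and> p \<in> W p \<and> smooth_on n (W p) f"
    using assms by metis
  show "continuous_map (subtopology (Euclidean_space n) V) euclidean (foldr partial js f)"
  proof (rule pasting_lemma[where I=V and T="\<lambda>p. V \<inter> W p" and f="\<lambda>_. foldr partial js f"])
    fix p assume p: "p \<in> V"
    show "openin (subtopology (Euclidean_space n) V) (V \<inter> W p)"
      using W[OF p] by (metis Int_commute openin_subtopology)
    have "continuous_map (subtopology (Euclidean_space n) (W p)) euclidean (foldr partial js f)"
      using W[OF p] js unfolding smooth_on_def by blast
    then show "continuous_map (subtopology (subtopology (Euclidean_space n) V) (V \<inter> W p)) euclidean (foldr partial js f)"
      unfolding subtopology_subtopology by (rule continuous_map_from_subtopology_mono) auto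
  qed (use W in auto)
  fix j p assume "j < n" "p \<in> V"
  then show "(\<lambda>t. foldr partial js f (p(j := t))) differentiable at (p j)"
    using W js unfolding smooth_on_def by blast
qed

text \<open>By induction on \<open>js\<close>, every iterated partial derivative of \<open>f\<close>
  agrees on \<open>V\<close> with a member of \<open>S\<close>, so it inherits continuity and
  differentiability. Closure of \<open>S\<close> is asked only up to agreement on \<open>V\<close>,
  because nothing is known about \<open>partial\<close> elsewhere.\<close>

lemma smooth_on_coinduct:
  assumes V: "openin (Euclidean_space n) V" and f: "f \<in> S"
    and cont: "\<And>g. g \<in> S \<Longrightarrow> continuous_map (subtopology (Euclidean_space n) V) euclidean g"
    and diff: "\<And>g j p. g \<in> S \<Longrightarrow> j < n \<Longrightarrow> p \<in> V \<Longrightarrow> (\<lambda>t. g (p(j := t))) differentiable (at (p j))"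
    and step: "\<And>g j. g \<in> S \<Longrightarrow> j < n \<Longrightarrow> \<exists>h\<in>S. \<forall>p\<in>V. partial j g p = h p"
  shows "smooth_on n V f"
proof -
  have *: "\<exists>h\<in>S. \<forall>p\<in>V. foldr partial js f p = h p" if "set js \<subseteq> {..<n}" for js
    using that
  proof (induction js)
    case (Cons j js)
    then obtain h where h: "h \<in> S" "\<forall>p\<in>V. foldr partial js f p = h p" by auto
    have "j < n" using Cons.prems by simp
    with step[OF h(1)] obtain k where k: "k \<in> S" "\<forall>p\<in>V. partial j h p = k p" by blast
    have "foldr partial (j # js) f p = k p" if "p \<in> V" for p
      using partial_cong[OF V that \<open>j < n\<close>, of "foldr partial js f" h] h(2) k(2) that by auto
    then show ?case using k(1) by blast
  qed (use f in auto)
  show ?thesis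
    unfolding smooth_on_def
  proof (intro allI impI conjI ballI)
    fix js assume "set js \<subseteq> {..<n}"
    then obtain h where h: "h \<in> S" "\<And>p. p \<in> V \<Longrightarrow> foldr partial js f p = h p" using * by blast
    show "continuous_map (subtopology (Euclidean_space n) V) euclidean (foldr partial js f)"
      using cont[OF h(1)] by (rule continuous_map_eq) (simp add: h(2))
    fix j p assume jp: "j < n" "p \<in> V"
    show "(\<lambda>t. foldr partial js f (p(j := t))) differentiable at (p j)"
      by (rule differentiable_fun_upd_cong[OF V jp(2,1) _ diff[OF h(1) jp]]) (simp add: h(2))
  qed
qed

lemma partial_fun_upd_eq:
  "((\<lambda>t. f (p(j := t))) has_vector_derivative D) (at (p j)) \<Longrightarrow> partial j f p = D"
  unfolding partial_def by (rule vector_derivative_at)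

lemma smooth_on_partial:
  assumes "smooth_on n V f" "j < n"
  shows "smooth_on n V (partial j f)"
  unfolding smooth_on_def
proof (intro allI impI)
  fix js assume "set js \<subseteq> {..<n}"
  then have "set (js @ [j]) \<subseteq> {..<n}" using assms(2) by auto
  moreover have "foldr partial (js @ [j]) f = foldr partial js (partial j f)" by simp
  ultimately show "continuous_map (subtopology (Euclidean_space n) V) euclidean (foldr partial js (partial j f)) \<and>
      (\<forall>i<n. \<forall>p\<in>V. (\<lambda>t. foldr partial js (partial j f) (p(i := t))) differentiable (at (p i)))"
    using assms(1) unfolding smooth_on_def by metis
qed

lemma smooth_on_continuous: "smooth_on n V f \<Longrightarrow> continuous_map (subtopology (Euclidean_space n) V) euclidean f"
  unfolding smooth_on_def by (drule spec[of _ "[]"]) simp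

lemma smooth_on_has_partial:
  assumes "smooth_on n V f" "j < n" "p \<in> V"
  shows "((\<lambda>t. f (p(j := t))) has_vector_derivative partial j f p) (at (p j))"
proof -
  have "\<forall>j<n. \<forall>p\<in>V. (\<lambda>t. f (p(j := t))) differentiable (at (p j))"
    using assms(1) unfolding smooth_on_def by (drule_tac spec[of _ "[]"]) simp
  then show ?thesis using assms by (simp add: partial_def vector_derivative_works)
qed

section \<open>Closure of smoothness under constants, linear maps and sums\<close>

lemma smooth_on_const:
  assumes "openin (Euclidean_space n) V"
  shows "smooth_on n V (\<lambda>_. c)"
proof (rule smooth_on_coinduct[OF assms, where S="range (\<lambda>c _. c)"])
  fix g :: "(nat \<Rightarrow> real) \<Rightarrow> 'a" and j assume "g \<in> range (\<lambda>c _. c)"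
  then show "\<exists>h\<in>range (\<lambda>c _. c). \<forall>p\<in>V. partial j g p = h p"
    by (auto simp: partial_def)
qed auto

text \<open>Partial differentiation commutes with \<open>L\<close>, so the images under
  \<open>L\<close> of smooth functions are closed under it. Multiplication by a complex constant and
  the inclusion of the reals in the complex numbers are the instances used later.\<close>

lemma smooth_on_bounded_linear:
  assumes V: "openin (Euclidean_space n) V" and L: "bounded_linear L" and f: "smooth_on n V f"
  shows "smooth_on n V (\<lambda>p. L (f p))"
proof (rule smooth_on_coinduct[OF V, where S="{\<lambda>p. L (g p) | g. smooth_on n V g}"])
  fix h assume "h \<in> {\<lambda>p. L (g p) | g. smooth_on n V g}"
  then obtain g where h: "h = (\<lambda>p. L (g p))" and g: "smooth_on n V g" by blast
  have "continuous_map (subtopology (Euclidean_space n) V) euclidean (L \<circ> g)"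
    using smooth_on_continuous[OF g] linear_continuous_on[OF L]
    by (intro continuous_map_compose[of _ euclidean]) simp_all
  then show "continuous_map (subtopology (Euclidean_space n) V) euclidean h"
    by (simp add: h o_def)
  have D: "((\<lambda>t. h (p(j := t))) has_vector_derivative L (partial j g p)) (at (p j))" if "j < n" "p \<in> V" for j p
    unfolding h by (rule bounded_linear.has_vector_derivative[OF L smooth_on_has_partial[OF g that]])
  have P: "partial j h p = L (partial j g p)" if "j < n" "p \<in> V" for j p
    by (rule partial_fun_upd_eq) (rule D[OF that])
  show "(\<lambda>t. h (p(j := t))) differentiable (at (p j))" if "j < n" "p \<in> V" for j p
    using D[OF that] by (rule differentiableI_vector)
  show "\<exists>k\<in>{\<lambda>p. L (g p) | g. smooth_on n V g}. \<forall>p\<in>V. partial j h p = k p" if "j < n" for j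
    using smooth_on_partial[OF g that] P[OF that]
    by (intro bexI[of _ "\<lambda>p. L (partial j g p)"]) auto
qed (use f in auto)

lemma smooth_on_add:
  assumes V: "openin (Euclidean_space n) V" and f: "smooth_on n V f" and g: "smooth_on n V g"
  shows "smooth_on n V (\<lambda>p. f p + g p)"
proof (rule smooth_on_coinduct[OF V, where S="{\<lambda>p. u p + v p | u v. smooth_on n V u \<and> smooth_on n V v}"])
  fix h assume "h \<in> {\<lambda>p. u p + v p | u v. smooth_on n V u \<and> smooth_on n V v}"
  then obtain u v where h: "h = (\<lambda>p. u p + v p)" and u: "smooth_on n V u" and v: "smooth_on n V v" by blast
  have "subtopology (Euclidean_space n) V = top_of_set ({x. \<forall>i\<ge>n. x i = 0} \<inter> V)"
    by (simp add: Euclidean_space_def euclidean_product_topology subtopology_subtopology)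
  then show "continuous_map (subtopology (Euclidean_space n) V) euclidean h"
    using smooth_on_continuous[OF u] smooth_on_continuous[OF v]
    unfolding h by (simp add: continuous_on_add)
  have D: "((\<lambda>t. h (p(j := t))) has_vector_derivative partial j u p + partial j v p) (at (p j))" if "j < n" "p \<in> V" for j p
    unfolding h by (intro has_vector_derivative_add smooth_on_has_partial[OF u that] smooth_on_has_partial[OF v that])
  have P: "partial j h p = partial j u p + partial j v p" if "j < n" "p \<in> V" for j p
    by (rule partial_fun_upd_eq) (rule D[OF that])
  show "(\<lambda>t. h (p(j := t))) differentiable (at (p j))" if "j < n" "p \<in> V" for j p
    using D[OF that] by (rule differentiableI_vector)
  show "\<exists>k\<in>{\<lambda>p. u p + v p | u v. smooth_on n V u \<and> smooth_on n V v}. \<forall>p\<in>V. partial j h p = k p" if "j < n" for j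
    using smooth_on_partial[OF u that] smooth_on_partial[OF v that] P[OF that]
    by (intro bexI[of _ "\<lambda>p. partial j u p + partial j v p"]) auto
qed (use f g in auto)

section \<open>The torus\<close>

text \<open>The quotient map from R^n to R^n/Z^n, with the classes represented by the points of the
  half-open unit cube.\<close>

definition wrap :: "(nat \<Rightarrow> real) \<Rightarrow> nat \<Rightarrow> real"
  where "wrap p = (\<lambda>i. frac (p i))"

definition torus_points :: "nat \<Rightarrow> (nat \<Rightarrow> real) set"
  where "torus_points n = {x. (\<forall>i<n. 0 \<le> x i \<and> x i < 1) \<and> (\<forall>i\<ge>n. x i = 0)}"

text \<open>The inclusion of the torus in a product of circles. Pulling back the topology along it
  glues opposite faces of the unit cube; the coordinates from \<open>n\<close> on, which are 0 on
  the torus, all go to 1.\<close>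

definition circle_emb :: "(nat \<Rightarrow> real) \<Rightarrow> nat \<Rightarrow> complex"
  where "circle_emb x = (\<lambda>i. cis (2 * pi * x i))"

definition open_cube :: "nat \<Rightarrow> (nat \<Rightarrow> real) \<Rightarrow> (nat \<Rightarrow> real) set"
  where "open_cube n a = {p. (\<forall>i<n. a i < p i \<and> p i < a i + 1) \<and> (\<forall>i\<ge>n. p i = 0)}"

definition torus_chart :: "nat \<Rightarrow> (nat \<Rightarrow> real) \<Rightarrow> (nat \<Rightarrow> real) chart"
  where "torus_chart n a =
    ({x \<in> torus_points n. \<forall>i<n. frac (x i - a i) \<noteq> 0},
     \<lambda>x i. if i < n then a i + frac (x i - a i) else 0)"

definition torus :: "nat \<Rightarrow> (nat \<Rightarrow> real) mfd"
  where "torus n = \<lparr>mdim = n, mtop = pullback_topology (torus_points n) circle_emb euclidean,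
    charts = range (torus_chart n)\<rparr>"

lemma mdim_torus [simp]: "mdim (torus n) = n"
  and charts_torus: "charts (torus n) = range (torus_chart n)"
  and points_torus [simp]: "points (torus n) = torus_points n"
  by (simp_all add: torus_def topspace_pullback_topology)

lemma circle_emb_wrap: "circle_emb (wrap p) = circle_emb p"
proof
  fix i
  have "cis (2 * pi * frac (p i)) = cis (2 * pi * p i - 2 * pi * of_int \<lfloor>p i\<rfloor>)"
    by (simp add: frac_def algebra_simps)
  also have "\<dots> = cis (2 * pi * p i)"
    by (metis cis_divide cis_multiple_2pi Ints_of_int div_by_1)
  finally show "circle_emb (wrap p) i = circle_emb p i"
    by (simp add: circle_emb_def wrap_def)
qed

lemma cis_2pi_frac: "cis (2 * pi * frac t) = cis (2 * pi * t)"
  using fun_cong[OF circle_emb_wrap[of "\<lambda>_. t"], of 0] by (simp add: circle_emb_def wrap_def)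

text \<open>This expresses the fractional part through \<open>Arg2pi\<close>, which is continuous
  off the nonnegative real axis; continuity of the charts as functions of \<open>circle_emb\<close>
  rests on it.\<close>

lemma Arg2pi_cis: "Arg2pi (cis (2 * pi * t)) = 2 * pi * frac t"
proof -
  have "cis (2 * pi * t) = cis (2 * pi * frac t)"
    by (simp add: cis_2pi_frac)
  also have "\<dots> = exp (\<i> * of_real (2 * pi * frac t))"
    by (simp add: cis_conv_exp)
  also have "Arg2pi \<dots> = 2 * pi * frac t"
    by (subst Arg2pi_exp) (use frac_lt_1[of t] in \<open>auto simp: mult_strict_left_mono\<close>)
  finally show ?thesis .
qed

lemma frac_eq_Arg2pi: "frac t = Arg2pi (cis (2 * pi * t)) / (2 * pi)"
  by (simp add: Arg2pi_cis)

lemma torus_points_Euclidean: "x \<in> torus_points n \<Longrightarrow> x \<in> topspace (Euclidean_space n)"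
  by (simp add: topspace_Euclidean_space torus_points_def)

lemma wrap_torus_points: "p \<in> topspace (Euclidean_space n) \<Longrightarrow> wrap p \<in> torus_points n"
  by (auto simp: topspace_Euclidean_space torus_points_def wrap_def frac_lt_1)

lemma wrap_id: "x \<in> torus_points n \<Longrightarrow> wrap x = x"
  unfolding torus_points_def wrap_def fun_eq_iff mem_Collect_eq
  by (metis frac_eq frac_of_int not_le of_int_0)

lemma open_cube_Euclidean: "p \<in> open_cube n a \<Longrightarrow> p \<in> topspace (Euclidean_space n)"
  by (simp add: topspace_Euclidean_space open_cube_def)

lemma openin_open_cube: "openin (Euclidean_space n) (open_cube n a)"
proof -
  have "open {p::nat \<Rightarrow> real. a i < p i \<and> p i < a i + 1}" for i
    by (intro open_Collect_conj open_Collect_less continuous_intros continuous_on_product_coordinates)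
  then have "open (\<Inter>i\<in>{..<n}. {p::nat \<Rightarrow> real. a i < p i \<and> p i < a i + 1})"
    by (intro open_INT) auto
  moreover have "open_cube n a = (\<Inter>i\<in>{..<n}. {p. a i < p i \<and> p i < a i + 1}) \<inter> {x. \<forall>i\<ge>n. x i = 0}"
    by (auto simp: open_cube_def)
  ultimately show ?thesis
    by (auto simp: Euclidean_space_def euclidean_product_topology openin_subtopology)
qed

lemma wrap_open_cube: "p \<in> open_cube n a \<Longrightarrow> wrap p \<in> fst (torus_chart n a)"
  unfolding torus_chart_def fst_conv mem_Collect_eq
proof (intro conjI allI impI)
  assume p: "p \<in> open_cube n a"
  then show "wrap p \<in> torus_points n"
    by (intro wrap_torus_points open_cube_Euclidean)
  fix i assume "i < n"
  then have "0 < p i - a i" "p i - a i < 1" using p by (auto simp: open_cube_def)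
  then have "frac (p i - a i) = p i - a i" by (simp add: frac_eq)
  moreover have "frac (wrap p i - a i) = frac (p i - a i)"
    using frac_add_simps(1)[of "p i" "- a i"] by (simp add: wrap_def)
  ultimately show "frac (wrap p i - a i) \<noteq> 0" using \<open>0 < p i - a i\<close> by linarith
qed

lemma chart_wrap: "p \<in> open_cube n a \<Longrightarrow> snd (torus_chart n a) (wrap p) = p"
proof
  fix i assume p: "p \<in> open_cube n a"
  have "frac (p i - a i) = p i - a i" if "i < n"
    using that p by (subst frac_eq) (auto simp: open_cube_def less_imp_le algebra_simps)
  moreover have "frac (wrap p i - a i) = frac (p i - a i)"
    using frac_add_simps(1)[of "p i" "- a i"] by (simp add: wrap_def)
  ultimately show "snd (torus_chart n a) (wrap p) i = p i"
    using p by (auto simp: torus_chart_def open_cube_def)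
qed

lemma chart_in_open_cube: "x \<in> fst (torus_chart n a) \<Longrightarrow> snd (torus_chart n a) x \<in> open_cube n a"
  unfolding torus_chart_def open_cube_def
  by (auto simp: frac_lt_1)

lemma wrap_chart: "x \<in> fst (torus_chart n a) \<Longrightarrow> wrap (snd (torus_chart n a) x) = x"
proof
  fix i assume x: "x \<in> fst (torus_chart n a)"
  then have "frac (x i) = x i" using wrap_id[of x n] by (auto simp: torus_chart_def wrap_def dest: fun_cong)
  moreover have "x i = 0" if "\<not> i < n" using x that by (auto simp: torus_chart_def torus_points_def)
  moreover have "frac (a i + frac (x i - a i)) = frac (x i)" by simp
  ultimately show "wrap (snd (torus_chart n a) x) i = x i"
    by (auto simp: wrap_def torus_chart_def simp del: frac_add_simps)
qed

lemma chart_image: "snd (torus_chart n a) ` fst (torus_chart n a) = open_cube n a"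
  using chart_in_open_cube chart_wrap wrap_open_cube by (metis image_eqI subsetI subset_antisym image_subsetI)

lemma inj_on_chart: "inj_on (snd (torus_chart n a)) (fst (torus_chart n a))"
  by (metis inj_onI wrap_chart)

lemma in_chart_torus: "p \<in> open_cube n a \<Longrightarrow> in_chart (torus_chart n a) f p = f (wrap p)"
  unfolding in_chart_def by (metis chart_wrap inj_on_chart inv_into_f_f wrap_open_cube)

lemma fst_torus_chart_points: "x \<in> fst (torus_chart n a) \<Longrightarrow> x \<in> torus_points n"
  by (simp add: torus_chart_def)

section \<open>Topology of the torus and of its charts\<close>

lemma continuous_map_circle_emb:
  "continuous_map (mtop (torus n)) euclidean circle_emb"
  using continuous_map_pullback[OF continuous_map_id, of "torus_points n" circle_emb euclidean]
  by (simp add: torus_def)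

lemma continuous_on_circle_emb: "continuous_on S circle_emb"
  unfolding circle_emb_def
  by (intro continuous_on_coordinatewise_then_product continuous_intros
      continuous_on_subset[OF continuous_on_product_coordinates subset_UNIV])

lemma continuous_map_wrap: "continuous_map (Euclidean_space n) (mtop (torus n)) wrap"
  unfolding torus_def mfd.select_convs
proof (rule continuous_map_pullback')
  have "circle_emb \<circ> wrap = circle_emb" by (auto simp: circle_emb_wrap)
  then show "continuous_map (Euclidean_space n) euclidean (circle_emb \<circ> wrap)"
    by (simp add: continuous_map_Euclidean_space_iff continuous_on_circle_emb)
  show "topspace (Euclidean_space n) \<subseteq> wrap -` torus_points n"
    using wrap_torus_points by blast
qed

lemma openin_torus_chart: "openin (mtop (torus n)) (fst (torus_chart n a))"
proof -
  define W where "W = {z::nat \<Rightarrow> complex. \<forall>i<n. z i \<noteq> cis (2 * pi * a i)}"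
  have "W = (\<Inter>i\<in>{..<n}. {z. z i \<noteq> cis (2 * pi * a i)})" by (auto simp: W_def)
  moreover have "open {z::nat \<Rightarrow> complex. z i \<noteq> cis (2 * pi * a i)}" for i
    by (intro open_Collect_neq continuous_intros continuous_on_product_coordinates)
  ultimately have "open W" by (metis (no_types, lifting) finite_lessThan open_INT)
  moreover have "fst (torus_chart n a) = circle_emb -` W \<inter> torus_points n"
  proof -
    have "frac (t - s) = 0 \<longleftrightarrow> cis (2 * pi * t) = cis (2 * pi * s)" for t s :: real
      using cis_2pi_frac[of t] cis_2pi_frac[of s] Arg2pi_cis[of t] Arg2pi_cis[of s]
      by (metis frac_diff_eq frac_diff_zero mult_cancel_left pi_neq_zero zero_neq_numeral mult_eq_0_iff)
    then show ?thesis
      by (auto simp: torus_chart_def W_def circle_emb_def simp del: frac_eq_0_iff)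
  qed
  ultimately show ?thesis
    by (auto simp: torus_def openin_pullback_topology)
qed

text \<open>Equal images have equal arguments, hence equal fractional parts, and a point of the
  half-open cube is its own fractional part. The Hausdorff property is pulled back along this
  injection.\<close>

lemma circle_emb_inj_on: "inj_on circle_emb (torus_points n)"
proof (rule inj_onI)
  fix x y assume x: "x \<in> torus_points n" and y: "y \<in> torus_points n" and eq: "circle_emb x = circle_emb y"
  have "wrap x = wrap y"
  proof
    fix i
    have "Arg2pi (cis (2 * pi * x i)) = Arg2pi (cis (2 * pi * y i))"
      using eq by (simp add: circle_emb_def fun_eq_iff)
    then show "wrap x i = wrap y i" by (simp add: Arg2pi_cis wrap_def)
  qed
  then show "x = y" using x y by (simp add: wrap_id)
qed

lemma Hausdorff_space_torus: "Hausdorff_space (mtop (torus n))"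
  unfolding Hausdorff_space_def
proof (intro allI impI)
  fix x y assume xy: "x \<in> points (torus n) \<and> y \<in> points (torus n) \<and> x \<noteq> y"
  then have "circle_emb x \<noteq> circle_emb y"
    using circle_emb_inj_on[of n] by (auto simp: inj_on_def)
  from hausdorff[OF this] obtain U V
    where "open U" "open V" "circle_emb x \<in> U" "circle_emb y \<in> V" "U \<inter> V = {}"
    by (elim exE conjE)
  then show "\<exists>U V. openin (mtop (torus n)) U \<and> openin (mtop (torus n)) V \<and> x \<in> U \<and> y \<in> V \<and> disjnt U V"
    using xy
    by (intro exI[of _ "circle_emb -` U \<inter> torus_points n"] exI[of _ "circle_emb -` V \<inter> torus_points n"])
      (auto simp: torus_def openin_pullback_topology disjnt_def topspace_pullback_topology)
qed

lemma second_countable_torus: "second_countable (mtop (torus n))"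
proof -
  obtain \<B> :: "(nat \<Rightarrow> complex) set set" where \<B>: "countable \<B>" "\<And>C. C \<in> \<B> \<Longrightarrow> open C"
    "\<And>S. open S \<Longrightarrow> \<exists>U. U \<subseteq> \<B> \<and> S = \<Union>U"
    using univ_second_countable by metis
  define pre where "pre = (\<lambda>U. circle_emb -` U \<inter> torus_points n)"
  show ?thesis
    unfolding second_countable_def
  proof (intro exI[of _ "pre ` \<B>"] conjI ballI allI impI)
    show "countable (pre ` \<B>)" using \<B>(1) by simp
    show "openin (mtop (torus n)) V" if "V \<in> pre ` \<B>" for V
      using that \<B>(2) by (auto simp: torus_def pre_def openin_pullback_topology)
    fix U x assume "openin (mtop (torus n)) U \<and> x \<in> U"
    then obtain S where S: "open S" "U = pre S" "x \<in> pre S"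
      by (auto simp: torus_def openin_pullback_topology pre_def)
    with \<B>(3)[OF S(1)] obtain C where "C \<in> \<B>" "x \<in> pre C" "pre C \<subseteq> pre S"
      unfolding pre_def by blast
    then show "\<exists>V\<in>pre ` \<B>. x \<in> V \<and> V \<subseteq> U" using S(2) by blast
  qed
qed

lemma compact_space_torus: "compact_space (mtop (torus n))"
proof -
  \<comment> \<open>The closed unit cube, written as a product over all indices so that compactness
    of products applies; the torus is its image under \<open>wrap\<close>.\<close>
  define K where "K = (PiE UNIV (\<lambda>i. if i < n then {0..1} else {0}) :: (nat \<Rightarrow> real) set)"
  have sub: "K \<subseteq> {x. \<forall>i\<ge>n. x i = 0}" by (auto simp: K_def PiE_iff split: if_splits)
  have "compactin (powertop_real UNIV) K"
    unfolding K_def by (subst compactin_PiE) (auto simp: compactin_euclidean_iff)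
  then have "compactin (Euclidean_space n) K"
    using sub by (simp add: Euclidean_space_def compactin_subtopology)
  then have "compactin (mtop (torus n)) (wrap ` K)"
    by (rule image_compactin[OF _ continuous_map_wrap])
  moreover have "wrap ` K = torus_points n"
  proof
    show "wrap ` K \<subseteq> torus_points n"
      using sub wrap_torus_points by (auto simp: topspace_Euclidean_space)
    have "x \<in> K" if "x \<in> torus_points n" for x
      using that by (auto simp: K_def PiE_iff torus_points_def less_imp_le split: if_splits)
    then show "torus_points n \<subseteq> wrap ` K"
      by (metis imageI subsetI wrap_id)
  qed
  ultimately show ?thesis by (simp add: compact_space_def)
qed

lemma homeomorphic_torus_chart:
  "homeomorphic_map (subtopology (mtop (torus n)) (fst (torus_chart n a)))
     (subtopology (Euclidean_space n) (open_cube n a)) (snd (torus_chart n a))"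
proof (rule homeomorphic_maps_imp_map)
  let ?U = "fst (torus_chart n a)" and ?T = "mtop (torus n)"
  \<comment> \<open>Rotating each coordinate by the angle of the omitted point moves that point to
    the positive real axis, the cut of \<open>Arg2pi\<close>. On \<open>R\<close> the cut is
    avoided, so the chart is a continuous function of \<open>circle_emb\<close>.\<close>
  define R where "R = {z::nat \<Rightarrow> complex. \<forall>i<n. z i * cis (- (2 * pi * a i)) \<notin> \<real>\<^sub>\<ge>\<^sub>0}"
  have emb: "continuous_map (subtopology ?T ?U) (top_of_set R) circle_emb"
    unfolding continuous_map_in_subtopology
  proof (intro conjI funcsetI)
    show "continuous_map (subtopology ?T ?U) euclidean circle_emb"
      by (intro continuous_map_from_subtopology continuous_map_circle_emb)
    fix x assume "x \<in> topspace (subtopology ?T ?U)"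
    then have x: "frac (x i - a i) \<noteq> 0" if "i < n" for i using that by (simp add: torus_chart_def)
    show "circle_emb x \<in> R"
      unfolding R_def mem_Collect_eq
    proof (intro allI impI)
      fix i assume "i < n"
      then have "Arg2pi (cis (2 * pi * (x i - a i))) \<noteq> 0"
        using x[of i] by (simp only: Arg2pi_cis mult_eq_0_iff) simp
      then show "circle_emb x i * cis (- (2 * pi * a i)) \<notin> \<real>\<^sub>\<ge>\<^sub>0"
        by (simp add: circle_emb_def cis_mult right_diff_distrib Arg2pi_eq_0 complex_nonneg_Reals_iff
            complex_is_Real_iff) auto
    qed
  qed
  have coord: "continuous_map (subtopology ?T ?U) euclideanreal (\<lambda>x. a i + frac (x i - a i))" if "i < n" for i
  proof -
    have "continuous_on R (\<lambda>z. a i + Arg2pi (z i * cis (- (2 * pi * a i))) / (2 * pi))"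
    proof (intro continuous_intros)
      have "continuous_on (- \<real>\<^sub>\<ge>\<^sub>0) Arg2pi"
        by (simp add: continuous_at_Arg2pi continuous_at_imp_continuous_on)
      then show "continuous_on R (\<lambda>z. Arg2pi (z i * cis (- (2 * pi * a i))))"
        by (rule continuous_on_compose2)
          (use that in \<open>auto simp: R_def intro!: continuous_intros
            continuous_on_subset[OF continuous_on_product_coordinates subset_UNIV]\<close>)
    qed simp
    then have "continuous_map (subtopology ?T ?U) euclideanreal
        ((\<lambda>z. a i + Arg2pi (z i * cis (- (2 * pi * a i))) / (2 * pi)) \<circ> circle_emb)"
      by (intro continuous_map_compose[OF emb]) simp
    then show ?thesis
      by (rule continuous_map_eq)
        (simp add: circle_emb_def cis_mult frac_eq_Arg2pi right_diff_distrib)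
  qed
  show "homeomorphic_maps (subtopology ?T ?U) (subtopology (Euclidean_space n) (open_cube n a))
          (snd (torus_chart n a)) wrap"
    unfolding homeomorphic_maps_def
  proof (intro conjI ballI)
    show "continuous_map (subtopology ?T ?U) (subtopology (Euclidean_space n) (open_cube n a)) (snd (torus_chart n a))"
      unfolding continuous_map_in_subtopology
    proof
      show "continuous_map (subtopology ?T ?U) (Euclidean_space n) (snd (torus_chart n a))"
        using coord continuous_map_componentwise_Euclidean_space[of "subtopology ?T ?U" n
            "\<lambda>x i. a i + frac (x i - a i)"]
        by (simp add: torus_chart_def)
      show "snd (torus_chart n a) \<in> topspace (subtopology ?T ?U) \<rightarrow> open_cube n a"
        using chart_in_open_cube by auto
    qed
    show "continuous_map (subtopology (Euclidean_space n) (open_cube n a)) (subtopology ?T ?U) wrap"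
      unfolding continuous_map_in_subtopology
      using wrap_open_cube by (auto intro: continuous_map_from_subtopology continuous_map_wrap)
  qed (use wrap_chart chart_wrap in auto)
qed

section \<open>Smoothness of the transition maps and the manifold structure\<close>

lemma has_vector_derivative_frac:
  assumes "t \<notin> \<int>"
  shows "(frac has_vector_derivative 1) (at (t::real))"
proof -
  have "((\<lambda>t. t - of_int \<lfloor>t\<rfloor>) has_vector_derivative 1 - 0) (at t)"
  proof (intro derivative_intros)
    show "((\<lambda>t. real_of_int \<lfloor>t\<rfloor>) has_vector_derivative 0) (at t)"
      using floor_has_real_derivative[of t "\<lambda>t. t"] assms
      by (simp add: has_real_derivative_iff_has_vector_derivative)
  qed
  then show ?thesis by (simp add: frac_def[abs_def])
qed

text \<open>On the overlap the transition map is \<open>g\<close>, a shifted fractional part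
  evaluated away from the integers. Its partial derivatives are the constants 0 and 1, so
  \<open>g\<close> together with the constants is closed under differentiation.\<close>

lemma smooth_transition:
  assumes "i < n"
  shows "smooth_in_chart (torus n) (torus_chart n a) (fst (torus_chart n a) \<inter> fst (torus_chart n b))
    (\<lambda>x. snd (torus_chart n b) x i)"
proof -
  let ?E = "Euclidean_space n"
  define V where "V = snd (torus_chart n a) ` (fst (torus_chart n a) \<inter> fst (torus_chart n b))"
  define g where "g = (\<lambda>p::nat \<Rightarrow> real. b i + frac (p i - b i))"
  have V_eq: "V = open_cube n a \<inter> {p \<in> topspace ?E. wrap p \<in> fst (torus_chart n b)}"
    unfolding V_def
  proof (intro set_eqI iffI)
    fix p assume "p \<in> open_cube n a \<inter> {p \<in> topspace ?E. wrap p \<in> fst (torus_chart n b)}"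
    then show "p \<in> snd (torus_chart n a) ` (fst (torus_chart n a) \<inter> fst (torus_chart n b))"
      by (intro image_eqI[of _ _ "wrap p"]) (simp_all add: chart_wrap wrap_open_cube)
  qed (auto simp: chart_in_open_cube wrap_chart intro!: open_cube_Euclidean[OF chart_in_open_cube])
  have V: "openin ?E V"
    unfolding V_eq
    by (intro openin_Int openin_open_cube openin_continuous_map_preimage[OF continuous_map_wrap] openin_torus_chart)
  have Vi: "p i - b i \<notin> \<int>" if "p \<in> V" for p
  proof -
    have "frac (frac (p i) - b i) \<noteq> 0"
      using that assms by (auto simp: V_eq torus_chart_def wrap_def simp del: frac_eq_0_iff)
    then have "frac (p i - b i) \<noteq> 0"
      using frac_add_simps(1)[of "p i" "- b i"] by (simp del: frac_eq_0_iff)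
    then show ?thesis by simp
  qed
  have in_chart_eq: "in_chart (torus_chart n a) (\<lambda>x. snd (torus_chart n b) x i) p = g p" if "p \<in> V" for p
    using that assms frac_add_simps(1)[of "p i" "- b i"]
    by (simp add: V_eq in_chart_torus g_def) (simp add: torus_chart_def wrap_def)
  have g_deriv: "((\<lambda>t. g (p(j := t))) has_vector_derivative (if j = i then 1 else 0)) (at (p j))"
    if "p \<in> V" for p j
  proof (cases "j = i")
    case True
    have "((\<lambda>t. t - b i) has_vector_derivative 1) (at (p i))"
      by (auto intro!: derivative_eq_intros)
    then have "((frac \<circ> (\<lambda>t. t - b i)) has_vector_derivative 1 *\<^sub>R 1) (at (p i))"
      by (rule vector_diff_chain_at) (rule has_vector_derivative_frac[OF Vi[OF that]])
    then have "((\<lambda>t. b i + frac (t - b i)) has_vector_derivative 0 + 1) (at (p i))"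
      by (intro derivative_intros) (simp add: o_def)
    then show ?thesis using True by (simp add: g_def)
  qed (simp add: g_def)
  have "smooth_on n V g"
  proof (rule smooth_on_coinduct[OF V, where S="insert g (range (\<lambda>c _. c))"])
    fix h assume h: "h \<in> insert g (range (\<lambda>c _. c))"
    show "continuous_map (subtopology ?E V) euclidean h"
    proof (cases "h = g")
      case True
      have "continuous_on (- \<int>) (frac :: real \<Rightarrow> real)"
        by (intro continuous_at_imp_continuous_on ballI)
          (rule has_vector_derivative_continuous[OF has_vector_derivative_frac], simp)
      moreover have "continuous_on V (\<lambda>p. p i - b i)"
        by (intro continuous_intros continuous_on_subset[OF continuous_on_product_coordinates subset_UNIV])
      ultimately have "continuous_on V (\<lambda>p. frac (p i - b i))"
        by (rule continuous_on_compose2) (use Vi in auto)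
      then have "continuous_on V g"
        unfolding g_def by (intro continuous_on_add continuous_on_const)
      then show ?thesis
        using True by (auto simp: Euclidean_space_def euclidean_product_topology subtopology_subtopology
            intro: continuous_on_subset)
    qed (use h in auto)
    show "(\<lambda>t. h (p(j := t))) differentiable at (p j)" if "j < n" "p \<in> V" for j p
      using h differentiableI_vector[OF g_deriv[OF that(2)]] by auto
    fix j assume "j < n"
    have "partial j h p = (if h = g \<and> j = i then 1 else 0)" if "p \<in> V" for p
      using h partial_fun_upd_eq[OF g_deriv[OF that]]
        partial_fun_upd_eq[of "\<lambda>_. c" p j 0 for c, OF has_vector_derivative_const]
      by (cases "h = g") auto
    then show "\<exists>k\<in>insert g (range (\<lambda>c _. c)). \<forall>p\<in>V. partial j h p = k p" by auto
  qed simp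
  then have "smooth_on n V (in_chart (torus_chart n a) (\<lambda>x. snd (torus_chart n b) x i))"
    by (rule smooth_on_cong[OF V, rotated]) (simp add: in_chart_eq)
  then show ?thesis by (simp add: smooth_in_chart_def V_def)
qed

text \<open>In this chart \<open>x\<close> is the centre of the cube and has itself as coordinates;
  it serves as the standard chart for reading off components at \<open>x\<close>.\<close>

definition centred_chart :: "nat \<Rightarrow> (nat \<Rightarrow> real) \<Rightarrow> (nat \<Rightarrow> real) chart"
  where "centred_chart n x = torus_chart n (\<lambda>i. x i - 1/2)"

lemma mem_centred_chart: "x \<in> torus_points n \<Longrightarrow> x \<in> fst (centred_chart n x)"
  by (simp add: centred_chart_def torus_chart_def frac_unique_iff[THEN iffD2] frac_eq del: frac_eq_0_iff)

lemma compact_smooth_manifold_torus: "compact_smooth_manifold (torus n)"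
  unfolding compact_smooth_manifold_def smooth_manifold_def
proof (intro conjI ballI allI impI)
  show "(\<Union>c\<in>charts (torus n). fst c) = points (torus n)"
    unfolding charts_torus points_torus
    using mem_centred_chart[of _ n] fst_torus_chart_points[of _ n] unfolding centred_chart_def by blast
qed (auto simp: Hausdorff_space_torus second_countable_torus compact_space_torus charts_torus
    openin_torus_chart chart_image openin_open_cube homeomorphic_torus_chart smooth_transition)

section \<open>Functions and vectors on the torus\<close>

text \<open>Calculus on the torus is done on the periodic lift to R^n, which is defined everywhere
  and makes the choice of a chart disappear. \<open>torus_partial\<close> below differentiates the
  same lift.\<close>

definition torus_smooth :: "nat \<Rightarrow> ((nat \<Rightarrow> real) \<Rightarrow> 'b::real_normed_vector) \<Rightarrow> bool"
  where "torus_smooth n f \<longleftrightarrow> smooth_on n (topspace (Euclidean_space n)) (\<lambda>p. f (wrap p))"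

definition torus_partial :: "nat \<Rightarrow> ((nat \<Rightarrow> real) \<Rightarrow> 'b::real_normed_vector) \<Rightarrow> (nat \<Rightarrow> real) \<Rightarrow> 'b"
  where "torus_partial j f x = partial j (\<lambda>p. f (wrap p)) x"

text \<open>Along coordinate \<open>j\<close> the lifts through \<open>q\<close> and through
  \<open>p\<close> differ by the integer translation \<open>m\<close> of the parameter, which does
  not affect derivatives.\<close>

lemma torus_partial_periodic:
  assumes "\<And>i. q i - p i \<in> \<int>"
  shows "torus_partial j f q = torus_partial j f p"
proof -
  define m where "m = q j - p j"
  let ?F = "\<lambda>t. f (wrap (q(j := t)))" and ?G = "\<lambda>t. f (wrap (p(j := t)))"
  have m: "m \<in> \<int>" using assms by (simp add: m_def)
  have frac_eq': "frac (q i) = frac (p i)" for i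
    using frac_add_int_right[OF assms[of i], of "p i"] by simp
  have wrap_eq: "wrap (q(j := t)) = wrap (p(j := t - m))" for t
    using m frac_eq' frac_add_int_right[of "-m" t] by (auto simp: wrap_def)
  have F: "?F = (\<lambda>t. ?G (t - m))" by (simp add: wrap_eq)
  have G: "?G = (\<lambda>t. ?F (t + m))" by (simp add: wrap_eq)
  \<comment> \<open>Since \<open>vector_derivative\<close> chooses some derivative, agreement of the
    whole relation for every \<open>D\<close> gives equality even where the lift is not
    differentiable.\<close>
  have "(?F has_vector_derivative D) (at (q j)) \<longleftrightarrow> (?G has_vector_derivative D) (at (p j))" for D
  proof
    assume "(?F has_vector_derivative D) (at (q j))"
    then have "((?F \<circ> (\<lambda>t. t + m)) has_vector_derivative 1 *\<^sub>R D) (at (p j))"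
      by (intro vector_diff_chain_at) (auto intro!: derivative_eq_intros simp: m_def)
    then show "(?G has_vector_derivative D) (at (p j))" by (subst G) (simp add: o_def)
  next
    assume "(?G has_vector_derivative D) (at (p j))"
    then have "((?G \<circ> (\<lambda>t. t - m)) has_vector_derivative 1 *\<^sub>R D) (at (q j))"
      by (intro vector_diff_chain_at) (auto intro!: derivative_eq_intros simp: m_def)
    then show "(?F has_vector_derivative D) (at (q j))" by (subst F) (simp add: o_def)
  qed
  then show ?thesis
    unfolding torus_partial_def partial_def vector_derivative_def by simp
qed

text \<open>The chart coordinates of \<open>x\<close> differ from \<open>x\<close> by integers, and
  the derivative of the lift is periodic. In particular the result is the same in all charts around
  \<open>x\<close>.\<close>

lemma chart_partial_torus:
  assumes "x \<in> fst (torus_chart n a)" "j < n"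
  shows "chart_partial (torus_chart n a) j f x = torus_partial j f x"
proof -
  let ?q = "snd (torus_chart n a) x"
  have "chart_partial (torus_chart n a) j f x = torus_partial j f ?q"
    unfolding chart_partial_def torus_partial_def
    by (rule partial_cong[OF openin_open_cube chart_in_open_cube[OF assms(1)] assms(2)])
      (simp add: in_chart_torus)
  also have "\<dots> = torus_partial j f x"
  proof (rule torus_partial_periodic)
    fix i
    have "x i = 0" if "\<not> i < n" using fst_torus_chart_points[OF assms(1)] that by (simp add: torus_points_def)
    then show "?q i - x i \<in> \<int>" by (auto simp: torus_chart_def frac_def)
  qed
  finally show ?thesis .
qed

lemma chart_partial_torus_cong:
  assumes "x \<in> fst (torus_chart n a)" "j < n" "\<And>y. y \<in> fst (torus_chart n a) \<Longrightarrow> f y = g y"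
  shows "chart_partial (torus_chart n a) j f x = chart_partial (torus_chart n a) j g x"
  unfolding chart_partial_def
  by (rule partial_cong[OF openin_open_cube chart_in_open_cube[OF assms(1)] assms(2)])
    (simp add: in_chart_torus assms(3) wrap_open_cube)

text \<open>As derivatives do not depend on the chart, the coordinate of chart \<open>b\<close> may
  be differentiated in chart \<open>b\<close> itself, where it is a linear coordinate. So all
  Jacobians of the atlas are identity matrices.\<close>

lemma chart_partial_coordinate:
  assumes "x \<in> fst (torus_chart n a)" "x \<in> fst (torus_chart n b)" "i < n" "j < n"
  shows "chart_partial (torus_chart n a) j (\<lambda>y. snd (torus_chart n b) y i) x = (if i = j then 1 else 0)"
proof -
  let ?f = "\<lambda>y. snd (torus_chart n b) y i" and ?q = "snd (torus_chart n b) x"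
  have "chart_partial (torus_chart n a) j ?f x = chart_partial (torus_chart n b) j ?f x"
    using assms by (simp add: chart_partial_torus)
  also have "\<dots> = partial j (\<lambda>p. p i) ?q"
    unfolding chart_partial_def
    by (rule partial_cong[OF openin_open_cube chart_in_open_cube[OF assms(2)] assms(4)])
      (simp add: in_chart_torus chart_wrap)
  also have "\<dots> = (if i = j then 1 else 0)"
    by (rule partial_fun_upd_eq) (auto intro!: derivative_eq_intros)
  finally show ?thesis .
qed

lemma chart_partial_transition:
  assumes "c \<in> charts (torus n)" "e \<in> charts (torus n)" "x \<in> fst c" "x \<in> fst e" "i < n" "j < n"
  shows "chart_partial c j (\<lambda>y. snd e y i) x = (if i = j then 1 else 0)"
proof -
  obtain a b where "c = torus_chart n a" "e = torus_chart n b"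
    using assms(1,2) unfolding charts_torus by blast
  then show ?thesis using assms by (simp add: chart_partial_coordinate)
qed

lemma smooth_in_chart_torus_iff:
  "smooth_in_chart (torus n) (torus_chart n a) (fst (torus_chart n a)) f \<longleftrightarrow>
    smooth_on n (open_cube n a) (\<lambda>p. f (wrap p))"
  unfolding smooth_in_chart_def chart_image mdim_torus
  using smooth_on_cong[OF openin_open_cube, of n a "in_chart (torus_chart n a) f" "\<lambda>p. f (wrap p)"]
    smooth_on_cong[OF openin_open_cube, of n a "\<lambda>p. f (wrap p)" "in_chart (torus_chart n a) f"]
  by (auto simp: in_chart_torus)

lemma smooth_in_chart_torus_cong:
  assumes "\<And>y. y \<in> fst (torus_chart n a) \<Longrightarrow> f y = g y"
  shows "smooth_in_chart (torus n) (torus_chart n a) (fst (torus_chart n a)) f \<longleftrightarrow>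
    smooth_in_chart (torus n) (torus_chart n a) (fst (torus_chart n a)) g"
  unfolding smooth_in_chart_torus_iff
  using smooth_on_cong[OF openin_open_cube, of n a "\<lambda>p. f (wrap p)" "\<lambda>p. g (wrap p)"]
    smooth_on_cong[OF openin_open_cube, of n a "\<lambda>p. g (wrap p)" "\<lambda>p. f (wrap p)"] assms
  by (auto simp: wrap_open_cube)

text \<open>Every point of R^n is the centre of an open unit cube that is the image of a chart, so
  smoothness in all charts and local smoothness of the lift are the same.\<close>

lemma torus_smooth_iff:
  "torus_smooth n f \<longleftrightarrow>
    (\<forall>a. smooth_in_chart (torus n) (torus_chart n a) (fst (torus_chart n a)) f)"
  unfolding smooth_in_chart_torus_iff torus_smooth_def
proof
  show "\<forall>a. smooth_on n (open_cube n a) (\<lambda>p. f (wrap p))"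
    if "smooth_on n (topspace (Euclidean_space n)) (\<lambda>p. f (wrap p))"
    using smooth_on_subset[OF that] open_cube_Euclidean by blast
  assume *: "\<forall>a. smooth_on n (open_cube n a) (\<lambda>p. f (wrap p))"
  show "smooth_on n (topspace (Euclidean_space n)) (\<lambda>p. f (wrap p))"
  proof (rule smooth_on_local)
    fix p assume "p \<in> topspace (Euclidean_space n)"
    then have "p \<in> open_cube n (\<lambda>i. p i - 1/2)"
      by (auto simp: open_cube_def topspace_Euclidean_space)
    then show "\<exists>W. openin (Euclidean_space n) W \<and> p \<in> W \<and> smooth_on n W (\<lambda>p. f (wrap p))"
      using * openin_open_cube by blast
  qed
qed

lemma torus_smooth_deriv:
  assumes "torus_smooth n f" "j < n" "p \<in> topspace (Euclidean_space n)"
  shows "((\<lambda>t. f (wrap (p(j := t)))) has_vector_derivative torus_partial j f p) (at (p j))"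
proof -
  have "set [] \<subseteq> {..<n}" by simp
  then have "(\<lambda>t. foldr partial [] (\<lambda>p. f (wrap p)) (p(j := t))) differentiable at (p j)"
    using assms unfolding torus_smooth_def smooth_on_def by blast
  then show ?thesis
    by (simp add: torus_partial_def partial_def vector_derivative_works)
qed

lemma torus_smooth_continuous:
  assumes "torus_smooth n f"
  shows "continuous_on (topspace (Euclidean_space n)) (\<lambda>p. f (wrap p))"
    and "j < n \<Longrightarrow> continuous_on (topspace (Euclidean_space n)) (torus_partial j f)"
proof -
  have *: "continuous_on (topspace (Euclidean_space n)) (foldr partial js (\<lambda>p. f (wrap p)))"
    if "set js \<subseteq> {..<n}" for js
    using assms that unfolding torus_smooth_def smooth_on_def
    by (simp add: continuous_map_Euclidean_space_iff)
  show "continuous_on (topspace (Euclidean_space n)) (\<lambda>p. f (wrap p))"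
    using *[of "[]"] by simp
  show "continuous_on (topspace (Euclidean_space n)) (torus_partial j f)" if "j < n"
    using *[of "[j]"] that by (simp add: torus_partial_def[abs_def])
qed

lemma torus_smooth_const: "torus_smooth n (\<lambda>_. c)"
  unfolding torus_smooth_def by (rule smooth_on_const) (rule openin_topspace)

lemma torus_smooth_bounded_linear: "bounded_linear L \<Longrightarrow> torus_smooth n f \<Longrightarrow> torus_smooth n (\<lambda>x. L (f x))"
  unfolding torus_smooth_def by (rule smooth_on_bounded_linear[OF openin_topspace])

lemma torus_smooth_add: "torus_smooth n f \<Longrightarrow> torus_smooth n g \<Longrightarrow> torus_smooth n (\<lambda>x. f x + g x)"
  unfolding torus_smooth_def by (rule smooth_on_add[OF openin_topspace])

lemma torus_smooth_sum: "finite I \<Longrightarrow> (\<And>i. i \<in> I \<Longrightarrow> torus_smooth n (f i)) \<Longrightarrow> torus_smooth n (\<lambda>x. \<Sum>i\<in>I. f i x)"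
  by (induction I rule: finite_induct) (auto intro: torus_smooth_const torus_smooth_add)

lemma torus_smooth_cmult:
  fixes c :: complex
  shows "torus_smooth n f \<Longrightarrow> torus_smooth n (\<lambda>x. c * f x)"
  by (rule torus_smooth_bounded_linear[OF bounded_linear_mult_right])

lemma torus_smooth_of_real: "torus_smooth n f \<Longrightarrow> torus_smooth n (\<lambda>x. complex_of_real (f x))"
  by (rule torus_smooth_bounded_linear[OF bounded_linear_of_real])

lemma torus_partial_cong:
  assumes "x \<in> torus_points n" "l < n" "\<And>y. y \<in> torus_points n \<Longrightarrow> f y = g y"
  shows "torus_partial l f x = torus_partial l g x"
  unfolding torus_partial_def
  by (rule partial_cong[OF openin_topspace torus_points_Euclidean[OF assms(1)] assms(2)])
    (rule assms(3)[OF wrap_torus_points])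

text \<open>With identity Jacobians a tangent vector has the same components \<open>w\<close> in
  every chart around \<open>x\<close>. The entry type is left open in order to cover real and
  complexified vectors at once.\<close>

definition tvec :: "nat \<Rightarrow> (nat \<Rightarrow> real) \<Rightarrow> (nat \<Rightarrow> 'a::zero) \<Rightarrow> (nat \<Rightarrow> real) chart \<Rightarrow> nat \<Rightarrow> 'a"
  where "tvec n x w = (\<lambda>c i. if c \<in> charts (torus n) \<and> x \<in> fst c \<and> i < n then w i else 0)"

definition coords :: "nat \<Rightarrow> (nat \<Rightarrow> real) \<Rightarrow> ((nat \<Rightarrow> real) chart \<Rightarrow> nat \<Rightarrow> 'a) \<Rightarrow> nat \<Rightarrow> 'a"
  where "coords n x v = v (centred_chart n x)"

lemma coords_tvec: "x \<in> torus_points n \<Longrightarrow> coords n x (tvec n x w) = (\<lambda>i. if i < n then w i else 0)"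
  using mem_centred_chart[of x n] by (auto simp: coords_def tvec_def charts_torus centred_chart_def)

lemma tvec_eqI: "(\<And>i. i < n \<Longrightarrow> v i = w i) \<Longrightarrow> tvec n x v = tvec n x w"
  by (auto simp: tvec_def fun_eq_iff)

lemma tangent_space_torus:
  assumes "x \<in> torus_points n"
  shows "tangent_space (torus n) x = range (tvec n x)"
proof (intro equalityI subsetI)
  fix v assume v: "v \<in> tangent_space (torus n) x"
  have "v e i = coords n x v i" if "e \<in> charts (torus n)" "x \<in> fst e" "i < n" for e i
  proof -
    have c: "centred_chart n x \<in> charts (torus n)" "x \<in> fst (centred_chart n x)"
      using mem_centred_chart[OF assms] by (auto simp: charts_torus centred_chart_def)
    have "v e i = (\<Sum>j<n. coords n x v j * chart_partial (centred_chart n x) j (\<lambda>y. snd e y i) x)"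
      using v c that unfolding tangent_space_def coords_def by simp
    also have "\<dots> = (\<Sum>j<n. coords n x v j * (if i = j then 1 else 0))"
      using c that by (intro sum.cong) (simp_all add: chart_partial_transition)
    also have "\<dots> = coords n x v i"
      using that by (simp add: if_distrib[of "(*) _"] cong: if_cong)
    finally show ?thesis .
  qed
  moreover have "v e i = 0" if "\<not> (e \<in> charts (torus n) \<and> x \<in> fst e \<and> i < n)" for e i
  proof -
    have "\<forall>c i. c \<notin> charts (torus n) \<or> x \<notin> fst c \<or> i \<ge> mdim (torus n) \<longrightarrow> v c i = 0"
      using v unfolding tangent_space_def by blast
    moreover have "e \<notin> charts (torus n) \<or> x \<notin> fst e \<or> i \<ge> mdim (torus n)"
      using that by (simp add: not_less)
    ultimately show ?thesis by (elim allE impE)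
  qed
  ultimately have "v = tvec n x (coords n x v)"
    by (auto simp: tvec_def fun_eq_iff)
  then show "v \<in> range (tvec n x)" by blast
next
  fix v :: "(nat \<Rightarrow> real) tvec" assume "v \<in> range (tvec n x)"
  then obtain w where w: "v = tvec n x w" by blast
  show "v \<in> tangent_space (torus n) x"
    unfolding tangent_space_def w mem_Collect_eq
  proof (intro conjI ballI allI impI)
    fix c e i assume "c \<in> charts (torus n)" "e \<in> charts (torus n)" "x \<in> fst c \<and> x \<in> fst e" "i < mdim (torus n)"
    then show "tvec n x w e i = (\<Sum>j<mdim (torus n). tvec n x w c j * chart_partial c j (\<lambda>y. snd e y i) x)"
      by (simp add: chart_partial_transition tvec_def if_distrib[of "(*) _"] cong: if_cong)
  qed (auto simp: tvec_def)
qed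

lemma complex_vec_tvec: "complex_vec (tvec n x u) (tvec n x v) = tvec n x (\<lambda>i. Complex (u i) (v i))"
  by (auto simp: complex_vec_def tvec_def fun_eq_iff complex_eq_iff)

lemma re_vec_tvec: "re_vec (tvec n x w) = tvec n x (\<lambda>i. Re (w i))"
  and im_vec_tvec: "im_vec (tvec n x w) = tvec n x (\<lambda>i. Im (w i))"
  by (auto simp: re_vec_def im_vec_def tvec_def fun_eq_iff)

lemma vec_comb_tvec: "vec_comb s (tvec n x u) t (tvec n x v) = tvec n x (\<lambda>i. s * u i + t * v i)"
  by (auto simp: vec_comb_def tvec_def fun_eq_iff)

lemma ctangent_space_torus:
  assumes "x \<in> torus_points n"
  shows "ctangent_space (torus n) x = range (tvec n x)"
proof (intro equalityI subsetI)
  fix v assume "v \<in> ctangent_space (torus n) x"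
  then obtain u w where uw: "re_vec v = tvec n x u" "im_vec v = tvec n x w"
    by (auto simp: ctangent_space_def tangent_space_torus[OF assms])
  have "v = complex_vec (re_vec v) (im_vec v)"
    by (simp add: complex_vec_def re_vec_def im_vec_def)
  also have "\<dots> = tvec n x (\<lambda>i. Complex (u i) (w i))"
    by (simp only: uw complex_vec_tvec)
  finally show "v \<in> range (tvec n x)" by (rule range_eqI[of _ "tvec n x"])
qed (auto simp: ctangent_space_def tangent_space_torus[OF assms] re_vec_tvec im_vec_tvec)

lemma coord_vec_torus:
  assumes "x \<in> fst (torus_chart n a)" "j < n"
  shows "coord_vec (torus n) (torus_chart n a) j x = tvec n x (\<lambda>i. if i = j then 1 else 0)"
proof (intro ext)
  fix e i
  have "torus_chart n a \<in> charts (torus n)" by (simp add: charts_torus)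
  then show "coord_vec (torus n) (torus_chart n a) j x e i = tvec n x (\<lambda>i. if i = j then 1 else 0) e i"
    using assms chart_partial_transition[of "torus_chart n a" n e x i j]
    by (simp add: coord_vec_def tvec_def)
qed

lemma const_field_torus:
  assumes "x \<in> fst (torus_chart n a)"
  shows "const_field (torus n) (torus_chart n a) w x = tvec n x w"
proof (intro ext)
  fix e i
  have "const_field (torus n) (torus_chart n a) w x e i =
      (\<Sum>l<n. w l * of_real (tvec n x (\<lambda>i. if i = l then 1 else 0) e i))"
    using assms by (simp add: const_field_def coord_vec_torus)
  also have "\<dots> = tvec n x w e i"
    by (auto simp: tvec_def if_distrib[of of_real] if_distrib[of "(*) _"] cong: if_cong)
  finally show "const_field (torus n) (torus_chart n a) w x e i = tvec n x w e i" .
qed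

section \<open>One-forms on the torus\<close>

text \<open>The value 0 on lists other than a single tangent vector at \<open>x\<close> follows the
  convention of \<open>alt_forms\<close>, so that equality of covectors is equality of
  functions.\<close>

definition covec :: "nat \<Rightarrow> (nat \<Rightarrow> real) \<Rightarrow> (nat \<Rightarrow> complex) \<Rightarrow> (nat \<Rightarrow> real) covec"
  where "covec n x \<xi> vs = (if \<exists>w. vs = [tvec n x w] then \<Sum>j<n. \<xi> j * coords n x (hd vs) j else 0)"

lemma covec_tvec: "x \<in> torus_points n \<Longrightarrow> covec n x \<xi> [tvec n x w] = (\<Sum>j<n. \<xi> j * w j)"
  by (auto simp: covec_def coords_tvec)

lemma covec_eq_0: "\<nexists>w. vs = [tvec n x w] \<Longrightarrow> covec n x \<xi> vs = 0"
  by (simp add: covec_def)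

lemma covec_cong: "x \<in> torus_points n \<Longrightarrow> (\<And>j. j < n \<Longrightarrow> \<xi> j = \<eta> j) \<Longrightarrow> covec n x \<xi> = covec n x \<eta>"
  by (auto simp: covec_def fun_eq_iff)

lemma covec_unit: "x \<in> torus_points n \<Longrightarrow> j < n \<Longrightarrow>
    covec n x \<xi> [tvec n x (\<lambda>i. if i = j then 1 else 0)] = \<xi> j"
  by (simp add: covec_tvec if_distrib[of "(*) _"] cong: if_cong)

lemma covec_eq_iff:
  assumes "x \<in> torus_points n"
  shows "covec n x \<xi> = covec n x \<eta> \<longleftrightarrow> (\<forall>j<n. \<xi> j = \<eta> j)"
  using covec_unit[OF assms, of _ \<xi>] covec_unit[OF assms, of _ \<eta>] covec_cong[OF assms, of \<xi> \<eta>]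
  by (auto dest: fun_cong)

lemma length_one_iff: "length vs = Suc 0 \<longleftrightarrow> (\<exists>v. vs = [v])"
  by (auto simp: length_Suc_conv)

lemma length_two_iff: "length vs = 2 \<longleftrightarrow> (\<exists>v w. vs = [v, w])"
  by (auto simp: length_Suc_conv numeral_2_eq_2)

lemma alt_forms_torus:
  assumes x: "x \<in> torus_points n"
  shows "alt_forms (torus n) 1 x = range (covec n x)"
proof (intro equalityI subsetI)
  fix a assume a: "a \<in> alt_forms (torus n) 1 x"
  let ?e = "\<lambda>j. \<lambda>i. if i = j then 1 else (0::complex)"
  define \<xi> where "\<xi> j = a [tvec n x (?e j)]" for j
  have a0: "a vs = 0" if "\<nexists>w. vs = [tvec n x w]" for vs
  proof -
    have "\<not> (length vs = 1 \<and> set vs \<subseteq> ctangent_space (torus n) x)"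
      using that by (auto simp: length_one_iff ctangent_space_torus[OF x])
    then show ?thesis using a unfolding alt_forms_def by blast
  qed
  have lin: "a [tvec n x (\<lambda>i. s * u i + t * w i)] = s * a [tvec n x u] + t * a [tvec n x w]" for s t u w
  proof -
    have "\<forall>vs (m::nat) u w s t. length vs = 1 \<and> set vs \<subseteq> ctangent_space (torus n) x \<and> m < 1 \<and>
       u \<in> ctangent_space (torus n) x \<and> w \<in> ctangent_space (torus n) x \<longrightarrow>
       a (vs[m := vec_comb s u t w]) = s * a (vs[m := u]) + t * a (vs[m := w])"
      using a unfolding alt_forms_def by blast
    from this[rule_format, of "[tvec n x u]" 0 "tvec n x u" "tvec n x w" s t]
    show ?thesis by (simp add: ctangent_space_torus[OF x] vec_comb_tvec)
  qed
  \<comment> \<open>Linearity is available for two summands at a time, so the argument is built up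
    one coordinate after another. The base case is the zero vector, obtained as a combination with
    both coefficients 0.\<close>
  have "a [tvec n x (\<lambda>i. if i < m then w i else 0)] = (\<Sum>j<m. \<xi> j * w j)" if "m \<le> n" for m w
    using that
  proof (induction m)
    case 0
    show ?case using lin[of 0 "\<lambda>_. 0" 0 "\<lambda>_. 0"] by simp
  next
    case (Suc m)
    have "(\<lambda>i. if i < Suc m then w i else 0) = (\<lambda>i. 1 * (if i < m then w i else 0) + w m * ?e m i)"
      by (auto simp: fun_eq_iff less_Suc_eq)
    then have "a [tvec n x (\<lambda>i. if i < Suc m then w i else 0)] =
        1 * a [tvec n x (\<lambda>i. if i < m then w i else 0)] + w m * a [tvec n x (?e m)]"
      by (simp only: lin)
    then show ?case using Suc by (simp add: \<xi>_def)
  qed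
  moreover have "tvec n x (\<lambda>i. if i < n then w i else 0) = tvec n x w" for w :: "nat \<Rightarrow> complex"
    by (rule tvec_eqI) simp
  ultimately have "a [tvec n x w] = (\<Sum>j<n. \<xi> j * w j)" for w by (metis order_refl)
  then have "a vs = covec n x \<xi> vs" for vs
    using a0[of vs] covec_eq_0[of vs n x \<xi>] by (cases "\<exists>w. vs = [tvec n x w]") (auto simp: covec_tvec[OF x])
  then have "a = covec n x \<xi>" by blast
  then show "a \<in> range (covec n x)" by blast
next
  fix a assume "a \<in> range (covec n x)"
  then obtain \<xi> where a: "a = covec n x \<xi>" by blast
  show "a \<in> alt_forms (torus n) 1 x"
    unfolding alt_forms_def a mem_Collect_eq
  proof (intro conjI allI impI)
    fix vs assume "\<not> (length vs = 1 \<and> set vs \<subseteq> ctangent_space (torus n) x)"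
    then show "covec n x \<xi> vs = 0"
      by (intro covec_eq_0) (auto simp: ctangent_space_torus[OF x])
  next
    fix vs and m :: nat and u w s t
    assume *: "length vs = 1 \<and> set vs \<subseteq> ctangent_space (torus n) x \<and> m < 1 \<and>
       u \<in> ctangent_space (torus n) x \<and> w \<in> ctangent_space (torus n) x"
    then obtain u' w' where uw: "u = tvec n x u'" "w = tvec n x w'" by (auto simp: ctangent_space_torus[OF x])
    obtain v where "vs = [v]" "m = 0" using * by (auto simp: length_one_iff)
    then show "covec n x \<xi> (vs[m := vec_comb s u t w]) = s * covec n x \<xi> (vs[m := u]) + t * covec n x \<xi> (vs[m := w])"
      by (simp add: uw vec_comb_tvec covec_tvec[OF x] sum_distrib_left algebra_simps sum.distrib)
  qed auto
qed

definition one_form :: "nat \<Rightarrow> (nat \<Rightarrow> (nat \<Rightarrow> real) \<Rightarrow> complex) \<Rightarrow> (nat \<Rightarrow> real) form"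
  where "one_form n a x = (if x \<in> torus_points n then covec n x (\<lambda>j. a j x) else 0)"

lemma forms_torus:
  "forms (torus n) 1 = {one_form n a | a. \<forall>j<n. torus_smooth n (a j)}"
proof (intro equalityI subsetI)
  fix \<alpha> assume \<alpha>: "\<alpha> \<in> forms (torus n) 1"
  have "\<forall>x\<in>torus_points n. \<exists>\<xi>. \<alpha> x = covec n x \<xi>"
    using \<alpha> alt_forms_torus unfolding forms_def by auto
  then obtain \<xi> where \<xi>: "\<And>x. x \<in> torus_points n \<Longrightarrow> \<alpha> x = covec n x (\<xi> x)" by metis
  define a where "a j x = \<xi> x j" for j x
  have 1: "\<alpha> = one_form n a"
    using \<alpha> \<xi> unfolding forms_def one_form_def a_def by (auto simp: fun_eq_iff)
  have 2: "torus_smooth n (a j)" if "j < n" for j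
    unfolding torus_smooth_iff
  proof
    fix b
    have "smooth_in_chart (torus n) (torus_chart n b) (fst (torus_chart n b))
        (\<lambda>y. \<alpha> y (map (\<lambda>j. complex_vec (coord_vec (torus n) (torus_chart n b) j y) 0) [j]))"
    proof -
      have "\<forall>c\<in>charts (torus n). \<forall>js. length js = 1 \<and> set js \<subseteq> {..<mdim (torus n)} \<longrightarrow>
          smooth_in_chart (torus n) c (fst c) (\<lambda>y. \<alpha> y (map (\<lambda>j. complex_vec (coord_vec (torus n) c j y) 0) js))"
        using \<alpha> unfolding forms_def by blast
      from this[rule_format, of "torus_chart n b" "[j]"] show ?thesis
        using that by (simp add: charts_torus)
    qed
    moreover have "\<alpha> y (map (\<lambda>j. complex_vec (coord_vec (torus n) (torus_chart n b) j y) 0) [j]) = a j y"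
      if y: "y \<in> fst (torus_chart n b)" for y
    proof -
      have "complex_vec (coord_vec (torus n) (torus_chart n b) j y) 0 = tvec n y (\<lambda>i. if i = j then 1 else 0)"
        using coord_vec_torus[OF y \<open>j < n\<close>]
        by (auto simp: complex_vec_def tvec_def fun_eq_iff complex_eq_iff)
      then show ?thesis
        using \<xi>[OF fst_torus_chart_points[OF y]] covec_unit[OF fst_torus_chart_points[OF y] \<open>j < n\<close>]
        by (simp add: a_def)
    qed
    ultimately show "smooth_in_chart (torus n) (torus_chart n b) (fst (torus_chart n b)) (a j)"
      by (rule iffD1[OF smooth_in_chart_torus_cong, rotated])
  qed
  show "\<alpha> \<in> {one_form n a | a. \<forall>j<n. torus_smooth n (a j)}" using 1 2 by blast
next
  fix \<alpha> assume "\<alpha> \<in> {one_form n a | a. \<forall>j<n. torus_smooth n (a j)}"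
  then obtain a where a: "\<alpha> = one_form n a" "\<And>j. j < n \<Longrightarrow> torus_smooth n (a j)" by blast
  show "\<alpha> \<in> forms (torus n) 1"
    unfolding forms_def mem_Collect_eq
  proof (intro conjI ballI allI impI)
    fix c js assume c: "c \<in> charts (torus n)" and js: "length js = 1 \<and> set js \<subseteq> {..<mdim (torus n)}"
    obtain b where b: "c = torus_chart n b" using c unfolding charts_torus by blast
    obtain j where j: "js = [j]" "j < n" using js by (auto simp: length_one_iff)
    have "\<alpha> y (map (\<lambda>j. complex_vec (coord_vec (torus n) (torus_chart n b) j y) 0) js) = a j y"
      if y: "y \<in> fst (torus_chart n b)" for y
    proof -
      have "complex_vec (coord_vec (torus n) (torus_chart n b) j y) 0 = tvec n y (\<lambda>i. if i = j then 1 else 0)"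
        using coord_vec_torus[OF y \<open>j < n\<close>]
        by (auto simp: complex_vec_def tvec_def fun_eq_iff complex_eq_iff)
      then show ?thesis
        using covec_unit[OF fst_torus_chart_points[OF y] \<open>j < n\<close>]
        by (simp add: a(1) one_form_def fst_torus_chart_points[OF y] j)
    qed
    moreover have "smooth_in_chart (torus n) (torus_chart n b) (fst (torus_chart n b)) (a j)"
      using a(2)[OF j(2)] unfolding torus_smooth_iff ..
    ultimately show "smooth_in_chart (torus n) c (fst c) (\<lambda>y. \<alpha> y (map (\<lambda>j. complex_vec (coord_vec (torus n) c j y) 0) js))"
      unfolding b by (subst smooth_in_chart_torus_cong[where g="a j"])
  qed (simp_all add: a(1) one_form_def alt_forms_torus[simplified])
qed

text \<open>First-order differentiability is what the exterior derivative of a one-form uses, and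
  the product rule preserves it for the coefficients of \<open>J\<close> applied to a form.\<close>

definition torus_differentiable :: "nat \<Rightarrow> ((nat \<Rightarrow> real) \<Rightarrow> 'b::real_normed_vector) \<Rightarrow> bool"
  where "torus_differentiable n f \<longleftrightarrow> (\<forall>x\<in>torus_points n. \<forall>j<n.
    ((\<lambda>t. f (wrap (x(j := t)))) has_vector_derivative torus_partial j f x) (at (x j)))"

lemma torus_smooth_differentiable: "torus_smooth n f \<Longrightarrow> torus_differentiable n f"
  unfolding torus_differentiable_def using torus_smooth_deriv torus_points_Euclidean by blast

lemma torus_differentiableD:
  "torus_differentiable n f \<Longrightarrow> x \<in> torus_points n \<Longrightarrow> j < n \<Longrightarrow>
    ((\<lambda>t. f (wrap (x(j := t)))) has_vector_derivative torus_partial j f x) (at (x j))"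
  by (simp add: torus_differentiable_def)

lemma torus_partialI:
  "((\<lambda>t. f (wrap (x(j := t)))) has_vector_derivative D) (at (x j)) \<Longrightarrow> torus_partial j f x = D"
  unfolding torus_partial_def by (rule partial_fun_upd_eq)

lemma torus_differentiableI:
  assumes "\<And>x j. x \<in> torus_points n \<Longrightarrow> j < n \<Longrightarrow>
    ((\<lambda>t. f (wrap (x(j := t)))) has_vector_derivative D x j) (at (x j))"
  shows "torus_differentiable n f"
  unfolding torus_differentiable_def
proof (intro ballI allI impI)
  fix x j assume "x \<in> torus_points n" "j < n"
  note * = assms[OF this]
  show "((\<lambda>t. f (wrap (x(j := t)))) has_vector_derivative torus_partial j f x) (at (x j))"
    using * unfolding torus_partialI[OF *] .
qed

text \<open>The value on \<open>v\<close> and \<open>w\<close> of the two-form that is the sum of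
  \<open>D j k\<close> times the wedge of dx_j and dx_k; for \<open>D j k\<close> the derivative of
  the k-th coefficient along x_j, this is the exterior derivative.\<close>

definition curl :: "nat \<Rightarrow> (nat \<Rightarrow> nat \<Rightarrow> complex) \<Rightarrow> (nat \<Rightarrow> complex) \<Rightarrow> (nat \<Rightarrow> complex) \<Rightarrow> complex"
  where "curl n D v w = (\<Sum>j<n. \<Sum>k<n. (v j * w k - w j * v k) * D j k)"

lemma ext_d_one_form_eq_0:
  assumes "\<not> (x \<in> torus_points n \<and> (\<exists>v w. vs = [tvec n x v, tvec n x w]))"
  shows "ext_d (torus n) (one_form n a) x vs = 0"
proof (cases "x \<in> points (torus n) \<and> set vs \<subseteq> ctangent_space (torus n) x")
  case True
  then have x: "x \<in> torus_points n" by simp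
  have "length vs \<noteq> 2"
    using True assms by (auto simp: length_two_iff ctangent_space_torus[OF x])
  \<comment> \<open>When the number of arguments is not two, omitting one leaves a list whose length
    is not one, where a one-form is 0; each summand then differentiates the zero function.\<close>
  then have "one_form n a y (map f (take m vs @ drop (Suc m) vs)) = 0" if "m < length vs" for m y f
    using that by (auto simp: one_form_def covec_def length_Suc_conv dest!: arg_cong[of _ _ length])
  then show ?thesis
    by (simp add: ext_d_def Let_def chart_partial_def partial_def in_chart_def)
next
  case False
  then show ?thesis unfolding ext_d_def by (simp only: if_False)
qed

lemma ext_d_one_form:
  assumes a: "\<And>k. k < n \<Longrightarrow> torus_differentiable n (a k)" and x: "x \<in> torus_points n"
  shows "ext_d (torus n) (one_form n a) x [tvec n x v, tvec n x w] = curl n (\<lambda>j k. torus_partial j (a k) x) v w"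
proof -
  define c where "c = (SOME c. c \<in> charts (torus n) \<and> x \<in> fst c)"
  have "\<exists>c. c \<in> charts (torus n) \<and> x \<in> fst c"
    using mem_centred_chart[OF x] unfolding charts_torus centred_chart_def by blast
  then have "c \<in> charts (torus n) \<and> x \<in> fst c" unfolding c_def by (rule someI_ex)
  then have c: "c \<in> charts (torus n)" "x \<in> fst c" by simp_all
  then obtain b where b: "c = torus_chart n b" unfolding charts_torus by blast
  have tv: "tvec n x u c = (\<lambda>i. if i < n then u i else 0)" for u :: "nat \<Rightarrow> complex"
    using c by (simp add: tvec_def)
  \<comment> \<open>The extended field has the components \<open>u\<close> at every point of the
    chart domain, so only the coefficients \<open>a k\<close> are differentiated.\<close>
  have *: "chart_partial c j (\<lambda>y. one_form n a y [const_field (torus n) c (tvec n x u c) y]) x =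
      (\<Sum>k<n. torus_partial j (a k) x * u k)" if j: "j < n" for j u
  proof -
    have "chart_partial c j (\<lambda>y. one_form n a y [const_field (torus n) c (tvec n x u c) y]) x =
        chart_partial c j (\<lambda>y. \<Sum>k<n. a k y * u k) x"
      unfolding b
    proof (rule chart_partial_torus_cong[OF c(2)[unfolded b] j])
      fix y assume y: "y \<in> fst (torus_chart n b)"
      show "one_form n a y [const_field (torus n) (torus_chart n b) (tvec n x u (torus_chart n b)) y] = (\<Sum>k<n. a k y * u k)"
        using fst_torus_chart_points[OF y]
        by (simp add: const_field_torus[OF y] one_form_def covec_tvec tv[unfolded b])
    qed
    also have "\<dots> = torus_partial j (\<lambda>y. \<Sum>k<n. a k y * u k) x"
      unfolding b by (rule chart_partial_torus[OF c(2)[unfolded b] j])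
    also have "\<dots> = (\<Sum>k<n. torus_partial j (a k) x * u k)"
      by (intro torus_partialI has_vector_derivative_sum has_vector_derivative_mult_left torus_differentiableD[where n=n] a x j) simp
    finally show ?thesis .
  qed
  have "tvec n x v \<in> ctangent_space (torus n) x" "tvec n x w \<in> ctangent_space (torus n) x"
    by (simp_all add: ctangent_space_torus[OF x])
  then have "ext_d (torus n) (one_form n a) x [tvec n x v, tvec n x w] =
      (\<Sum>j<n. v j * (\<Sum>k<n. torus_partial j (a k) x * w k)) - (\<Sum>j<n. w j * (\<Sum>k<n. torus_partial j (a k) x * v k))"
    using x by (simp add: ext_d_def c_def[symmetric] numeral_2_eq_2 *[unfolded tv] tv)
  also have "\<dots> = curl n (\<lambda>j k. torus_partial j (a k) x) v w"
    by (simp add: curl_def sum_distrib_left sum_subtractf[symmetric] algebra_simps)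
  finally show ?thesis .
qed

section \<open>Closed one-forms in components\<close>

definition closed_comps :: "nat \<Rightarrow> (nat \<Rightarrow> (nat \<Rightarrow> real) \<Rightarrow> complex) \<Rightarrow> bool"
  where "closed_comps n a \<longleftrightarrow>
    (\<forall>x\<in>torus_points n. \<forall>j<n. \<forall>k<n. torus_partial j (a k) x = torus_partial k (a j) x)"

lemma curl_unit:
  assumes "j < n" "k < n"
  shows "curl n D (\<lambda>i. if i = j then 1 else 0) (\<lambda>i. if i = k then 1 else 0) = D j k - D k j"
proof -
  have "curl n D (\<lambda>i. if i = j then 1 else 0) (\<lambda>i. if i = k then 1 else 0) =
     (\<Sum>i<n. \<Sum>l<n. (if i = j then if l = k then D i l else 0 else 0)) - (\<Sum>i<n. \<Sum>l<n. (if i = k then if l = j then D i l else 0 else 0))"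
    unfolding curl_def sum_subtractf[symmetric] by (intro sum.cong refl) auto
  also have "\<dots> = D j k - D k j"
  proof -
    have "(\<Sum>i<n. \<Sum>l<n. (if i = j then if l = k then D i l else 0 else 0)) = D j k" if "j < n" "k < n" for j k
    proof -
      have "(\<Sum>i<n. \<Sum>l<n. (if i = j then if l = k then D i l else 0 else 0)) =
          (\<Sum>i<n. if i = j then D i k else 0)"
        using that by (intro sum.cong refl) auto
      then show ?thesis using that by simp
    qed
    then show ?thesis using assms by simp
  qed
  finally show ?thesis .
qed

lemma curl_symmetric:
  assumes "\<And>j k. j < n \<Longrightarrow> k < n \<Longrightarrow> D j k = D k j"
  shows "curl n D v w = 0"
proof -
  have "(\<Sum>j<n. \<Sum>k<n. w j * v k * D j k) = (\<Sum>j<n. \<Sum>k<n. w k * v j * D k j)"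
    by (rule sum.swap)
  also have "\<dots> = (\<Sum>j<n. \<Sum>k<n. v j * w k * D j k)"
    using assms by (intro sum.cong refl) auto
  finally show ?thesis by (simp add: curl_def left_diff_distrib sum_subtractf)
qed

lemma ext_d_one_form_zero_iff:
  assumes a: "\<And>k. k < n \<Longrightarrow> torus_differentiable n (a k)"
  shows "ext_d (torus n) (one_form n a) = 0 \<longleftrightarrow> closed_comps n a"
proof
  assume *: "ext_d (torus n) (one_form n a) = 0"
  show "closed_comps n a"
    unfolding closed_comps_def
  proof (intro ballI allI impI)
    fix x j k assume x: "x \<in> torus_points n" and jk: "j < n" "k < n"
    let ?e = "\<lambda>j. \<lambda>i. if i = j then 1 else (0::complex)"
    have "ext_d (torus n) (one_form n a) x [tvec n x (?e j), tvec n x (?e k)] =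
        curl n (\<lambda>j k. torus_partial j (a k) x) (?e j) (?e k)"
      by (rule ext_d_one_form) (use a x in auto)
    then show "torus_partial j (a k) x = torus_partial k (a j) x"
      unfolding * curl_unit[OF jk] by simp
  qed
next
  assume *: "closed_comps n a"
  have "ext_d (torus n) (one_form n a) x vs = 0" for x vs
  proof (cases "x \<in> torus_points n \<and> (\<exists>v w. vs = [tvec n x v, tvec n x w])")
    case True
    then obtain v w where x: "x \<in> torus_points n" and vs: "vs = [tvec n x v, tvec n x w]" by blast
    have "ext_d (torus n) (one_form n a) x vs = curl n (\<lambda>j k. torus_partial j (a k) x) v w"
      unfolding vs by (rule ext_d_one_form) (use a x in auto)
    also have "\<dots> = 0"
      by (rule curl_symmetric) (use * x in \<open>simp add: closed_comps_def\<close>)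
    finally show ?thesis .
  qed (rule ext_d_one_form_eq_0)
  then show "ext_d (torus n) (one_form n a) = 0" by (simp add: fun_eq_iff)
qed

section \<open>Almost complex structures given by a matrix of functions\<close>

text \<open>The matrix acts on the components in every chart separately; this is consistent because
  a tangent vector has the same components in all charts around \<open>x\<close>.\<close>

definition acs :: "nat \<Rightarrow> ((nat \<Rightarrow> real) \<Rightarrow> nat \<Rightarrow> nat \<Rightarrow> real) \<Rightarrow> (nat \<Rightarrow> real) endo"
  where "acs n A x v = (\<lambda>c i. if i < n then \<Sum>j<n. A x i j * v c j else 0)"

definition mat_vec :: "nat \<Rightarrow> (nat \<Rightarrow> nat \<Rightarrow> real) \<Rightarrow> (nat \<Rightarrow> complex) \<Rightarrow> nat \<Rightarrow> complex"
  where "mat_vec n B w i = (\<Sum>j<n. of_real (B i j) * w j)"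

text \<open>The components of the covector composed with \<open>B\<close>. For \<open>B\<close> the
  matrix of \<open>J\<close> this is the action of \<open>J\<close> on one-forms, whereas
  \<open>mat_vec\<close> is its action on vectors.\<close>

definition vec_mat :: "nat \<Rightarrow> (nat \<Rightarrow> complex) \<Rightarrow> (nat \<Rightarrow> nat \<Rightarrow> real) \<Rightarrow> nat \<Rightarrow> complex"
  where "vec_mat n \<xi> B k = (\<Sum>j<n. \<xi> j * of_real (B j k))"

lemma acs_tvec: "acs n A x (tvec n x w) = tvec n x (\<lambda>i. \<Sum>j<n. A x i j * w j)"
  by (auto simp: acs_def tvec_def fun_eq_iff intro!: sum.cong)

lemma J_complex_acs: "J_complex (acs n A) x (tvec n x w) = tvec n x (mat_vec n (A x) w)"
  by (simp add: J_complex_def re_vec_tvec im_vec_tvec acs_tvec complex_vec_tvec)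
    (intro tvec_eqI, simp add: mat_vec_def complex_eq_iff)

lemma proj_10_acs: "proj_10 (acs n A) x (tvec n x w) = tvec n x (\<lambda>i. (w i - \<i> * mat_vec n (A x) w i) / 2)"
  and proj_01_acs: "proj_01 (acs n A) x (tvec n x w) = tvec n x (\<lambda>i. (w i + \<i> * mat_vec n (A x) w i) / 2)"
  by (simp_all add: proj_10_def proj_01_def J_complex_acs vec_comb_tvec) (auto intro!: tvec_eqI simp: field_simps)

lemma vec_mat_mat_vec: "(\<Sum>k<n. vec_mat n \<xi> B k * w k) = (\<Sum>j<n. \<xi> j * mat_vec n B w j)"
  unfolding vec_mat_def mat_vec_def sum_distrib_left sum_distrib_right
  by (subst sum.swap) (simp add: ac_simps)

lemma subsets_card_lessThan_2: "{S. S \<subseteq> {..<2::nat} \<and> card S = Suc 0} = {{0}, {1}}"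
proof (intro equalityI subsetI)
  fix S :: "nat set" assume "S \<in> {S. S \<subseteq> {..<2} \<and> card S = Suc 0}"
  then obtain s where "S = {s}" "s < 2" by (auto simp: card_Suc_eq)
  then show "S \<in> {{0}, {1}}" by (auto simp: less_2_cases_iff)
qed auto

lemma subsets_card_full: "finite T \<Longrightarrow> {S. S \<subseteq> T \<and> card S = card T} = {T}"
  using card_subset_eq by auto

lemma subsets_card_0: "finite T \<Longrightarrow> {S. S \<subseteq> T \<and> card S = 0} = {{}}"
  using finite_subset by fastforce

lemma bidegree_part_1:
  assumes "v \<in> ctangent_space M x"
  shows "bidegree_part M J (Suc 0) 0 x a [v] = a [proj_10 J x v]"
    and "bidegree_part M J 0 (Suc 0) x a [v] = a [proj_01 J x v]"
  using assms subsets_card_full[of "{..<Suc 0}"] subsets_card_0[of "{..<Suc 0}"]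
  by (simp_all add: bidegree_part_def)

lemma bidegree_part_2:
  assumes "v \<in> ctangent_space M x" "w \<in> ctangent_space M x"
  shows "bidegree_part M J 2 0 x a [v, w] = a [proj_10 J x v, proj_10 J x w]"
    and "bidegree_part M J (Suc 0) (Suc 0) x a [v, w] =
      a [proj_10 J x v, proj_01 J x w] + a [proj_01 J x v, proj_10 J x w]"
    and "bidegree_part M J 0 2 x a [v, w] = a [proj_01 J x v, proj_01 J x w]"
  using assms subsets_card_full[of "{..<2::nat}"] subsets_card_0[of "{..<2::nat}"] subsets_card_lessThan_2
  by (simp_all add: bidegree_part_def numeral_2_eq_2[symmetric] upt_rec[of 0 2] upt_rec[of 1 2] upt_rec[of "Suc 0" 2])

lemma bidegree_part_0 [simp]: "bidegree_part M J p q x 0 vs = 0"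
  by (simp add: bidegree_part_def)

lemma bidegree_part_eq_0:
  "\<not> (length vs = p + q \<and> set vs \<subseteq> ctangent_space M x) \<Longrightarrow> bidegree_part M J p q x a vs = 0"
  by (auto simp: bidegree_part_def)

text \<open>The weights are i on type (1,0) and -i on type (0,1), and i times the first projection
  of a vector minus i times the second is exactly J of that vector.\<close>

lemma J_form_one_form:
  "J_form (torus n) (acs n A) 1 (one_form n a) = one_form n (\<lambda>k x. vec_mat n (\<lambda>j. a j x) (A x) k)"
proof (intro ext)
  fix x and vs :: "(nat \<Rightarrow> real) cvec list"
  show "J_form (torus n) (acs n A) 1 (one_form n a) x vs = one_form n (\<lambda>k x. vec_mat n (\<lambda>j. a j x) (A x) k) x vs"
  proof (cases "x \<in> torus_points n")
    case x: True
    show ?thesis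
    proof (cases "\<exists>w. vs = [tvec n x w]")
      case True
      then obtain w where w: "vs = [tvec n x w]" by blast
      have "tvec n x w \<in> ctangent_space (torus n) x" by (simp add: ctangent_space_torus[OF x])
      then have "J_form (torus n) (acs n A) 1 (one_form n a) x vs =
          \<i> * (\<Sum>j<n. a j x * ((w j - \<i> * mat_vec n (A x) w j) / 2)) +
          - \<i> * (\<Sum>j<n. a j x * ((w j + \<i> * mat_vec n (A x) w j) / 2))"
        by (simp add: J_form_def w bidegree_part_1 proj_10_acs proj_01_acs one_form_def x covec_tvec power_int_minus)
      also have "\<dots> = (\<Sum>j<n. a j x * mat_vec n (A x) w j)"
        unfolding sum_distrib_left sum.distrib[symmetric]
        by (intro sum.cong refl) (simp add: field_simps)
      also have "\<dots> = one_form n (\<lambda>k x. vec_mat n (\<lambda>j. a j x) (A x) k) x vs"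
        by (simp add: one_form_def x w covec_tvec vec_mat_mat_vec)
      finally show ?thesis .
    next
      case False
      then have "\<not> (length vs = p + (1 - p) \<and> set vs \<subseteq> ctangent_space (torus n) x)" if "p \<le> 1" for p
        using that by (auto simp: length_one_iff ctangent_space_torus[OF x])
      then have "bidegree_part (torus n) (acs n A) p (1 - p) x (one_form n a x) vs = 0" if "p \<le> 1" for p
        using that by (intro bidegree_part_eq_0)
      then have "J_form (torus n) (acs n A) 1 (one_form n a) x vs = 0"
        unfolding J_form_def by (intro sum.neutral) auto
      then show ?thesis using False by (simp add: one_form_def x covec_eq_0)
    qed
  qed (simp add: J_form_def one_form_def)
qed

section \<open>The action of J on two-forms and the closedness conditions\<close>

lemma curl_comb_left: "curl n D (\<lambda>i. s * u i + t * v i) w = s * curl n D u w + t * curl n D v w"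
  unfolding curl_def sum_distrib_left sum.distrib[symmetric]
  by (intro sum.cong refl) (simp add: algebra_simps)

lemma curl_comb_right: "curl n D w (\<lambda>i. s * u i + t * v i) = s * curl n D w u + t * curl n D w v"
  unfolding curl_def sum_distrib_left sum.distrib[symmetric]
  by (intro sum.cong refl) (simp add: algebra_simps)

lemma curl_cong:
  "(\<And>i. i < n \<Longrightarrow> v i = v' i) \<Longrightarrow> (\<And>i. i < n \<Longrightarrow> w i = w' i) \<Longrightarrow> curl n D v w = curl n D v' w'"
  unfolding curl_def by (intro sum.cong refl) simp

text \<open>The inverse of J weights the types (0,2), (1,1), (2,0) by -1, 1, -1. Since the (1,0)
  part of v minus its (0,1) part is -iJv, the weighted sum is minus the value on -iJv and -iJw,
  which is the value on Jv and Jw.\<close>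

lemma J_inv_form_2:
  assumes x: "x \<in> torus_points n"
    and \<beta>: "\<And>v w. \<beta> x [tvec n x v, tvec n x w] = curl n D v w"
  shows "J_inv_form (torus n) (acs n A) 2 \<beta> x [tvec n x v, tvec n x w] =
    curl n D (mat_vec n (A x) v) (mat_vec n (A x) w)"
proof -
  define jv jw where "jv = mat_vec n (A x) v" and "jw = mat_vec n (A x) w"
  have p10: "(\<lambda>i. (u i - \<i> * u' i) / 2) = (\<lambda>i. 1/2 * u i + (- \<i>/2) * u' i)"
    and p01: "(\<lambda>i. (u i + \<i> * u' i) / 2) = (\<lambda>i. 1/2 * u i + (\<i>/2) * u' i)" for u u' :: "nat \<Rightarrow> complex"
    by (auto simp: field_simps)
  have ct: "tvec n x u \<in> ctangent_space (torus n) x" for u by (simp add: ctangent_space_torus[OF x])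
  have two: "{..2::nat} = {0, Suc 0, 2}" by auto
  have "J_inv_form (torus n) (acs n A) 2 \<beta> x [tvec n x v, tvec n x w] =
      - bidegree_part (torus n) (acs n A) 0 2 x (\<beta> x) [tvec n x v, tvec n x w]
      + bidegree_part (torus n) (acs n A) (Suc 0) (Suc 0) x (\<beta> x) [tvec n x v, tvec n x w]
      - bidegree_part (torus n) (acs n A) 2 0 x (\<beta> x) [tvec n x v, tvec n x w]"
    by (simp add: J_inv_form_def two power_int_minus)
  also have "\<dots> = curl n D jv jw"
    unfolding bidegree_part_2[OF ct ct] proj_10_acs proj_01_acs \<beta> p10 p01 curl_comb_left curl_comb_right
      jv_def[symmetric] jw_def[symmetric]
    by (simp add: field_simps)
  finally show ?thesis by (simp add: jv_def jw_def)
qed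

locale torus_acs =
  fixes n :: nat and A :: "(nat \<Rightarrow> real) \<Rightarrow> nat \<Rightarrow> nat \<Rightarrow> real"
  assumes smooth: "i < n \<Longrightarrow> j < n \<Longrightarrow> torus_smooth n (\<lambda>x. A x i j)"
    and square: "x \<in> torus_points n \<Longrightarrow> i < n \<Longrightarrow> k < n \<Longrightarrow> (\<Sum>j<n. A x i j * A x j k) = (if i = k then -1 else 0)"
begin

lemma almost_complex_structure: "almost_complex_structure (torus n) (acs n A)"
  unfolding almost_complex_structure_def
proof (intro conjI ballI allI impI)
  fix x assume "x \<in> points (torus n)"
  then have x: "x \<in> torus_points n" by simp
  show "acs n A x v \<in> tangent_space (torus n) x" if "v \<in> tangent_space (torus n) x" for v
    using that by (auto simp: tangent_space_torus[OF x] acs_tvec)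
  show "acs n A x (vec_comb s u t v) = vec_comb s (acs n A x u) t (acs n A x v)" for u v s t
    by (auto simp: acs_def vec_comb_def fun_eq_iff sum_distrib_left sum.distrib algebra_simps)
  show "acs n A x (acs n A x v) = - v" if v: "v \<in> tangent_space (torus n) x" for v
  proof -
    obtain w where w: "v = tvec n x w" using v by (auto simp: tangent_space_torus[OF x])
    have "(\<Sum>j<n. A x i j * (\<Sum>k<n. A x j k * w k)) = - w i" if "i < n" for i
    proof -
      have "(\<Sum>j<n. A x i j * (\<Sum>k<n. A x j k * w k)) = (\<Sum>k<n. (\<Sum>j<n. A x i j * A x j k) * w k)"
        unfolding sum_distrib_left sum_distrib_right by (subst sum.swap) (simp add: ac_simps)
      also have "\<dots> = (\<Sum>k<n. (if i = k then - w k else 0))"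
        using square[OF x that] by (intro sum.cong refl) auto
      also have "\<dots> = - w i" using that by simp
      finally show ?thesis .
    qed
    then show ?thesis
      unfolding w acs_tvec by (auto simp: tvec_def fun_eq_iff)
  qed
next
  fix c i j assume c: "c \<in> charts (torus n)" and ij: "i < mdim (torus n)" "j < mdim (torus n)"
  obtain b where b: "c = torus_chart n b" using c unfolding charts_torus by blast
  have eq: "acs n A y (coord_vec (torus n) (torus_chart n b) j y) (torus_chart n b) i = A y i j"
    if y: "y \<in> fst (torus_chart n b)" for y
    using ij y by (simp add: coord_vec_torus acs_tvec)
      (simp add: tvec_def charts_torus if_distrib[of "(*) _"] cong: if_cong)
  have "smooth_in_chart (torus n) (torus_chart n b) (fst (torus_chart n b)) (\<lambda>y. A y i j)"
    using smooth[of i j] ij unfolding torus_smooth_iff by simp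
  then show "smooth_in_chart (torus n) c (fst c) (\<lambda>y. acs n A y (coord_vec (torus n) c j y) c i)"
    unfolding b using eq by (subst smooth_in_chart_torus_cong[where g="\<lambda>y. A y i j"])
qed

lemma mat_vec_mat_vec:
  assumes x: "x \<in> torus_points n" and i: "i < n"
  shows "mat_vec n (A x) (mat_vec n (A x) w) i = - w i"
proof -
  have "mat_vec n (A x) (mat_vec n (A x) w) i = (\<Sum>k<n. of_real (\<Sum>j<n. A x i j * A x j k) * w k)"
    unfolding mat_vec_def of_real_sum sum_distrib_left sum_distrib_right by (subst sum.swap) (simp add: ac_simps)
  also have "\<dots> = (\<Sum>k<n. (if i = k then - w k else 0))"
    using square[OF x i] by (intro sum.cong refl) auto
  also have "\<dots> = - w i" using i by simp
  finally show ?thesis .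
qed

lemma vec_mat_vec_mat:
  assumes x: "x \<in> torus_points n" and k: "k < n"
  shows "vec_mat n (vec_mat n \<xi> (A x)) (A x) k = - \<xi> k"
proof -
  have "vec_mat n (vec_mat n \<xi> (A x)) (A x) k = (\<Sum>i<n. \<xi> i * of_real (\<Sum>j<n. A x i j * A x j k))"
    unfolding vec_mat_def of_real_sum sum_distrib_left sum_distrib_right by (subst sum.swap) (simp add: ac_simps)
  also have "\<dots> = (\<Sum>i<n. (if i = k then - \<xi> i else 0))"
    using square[OF x _ k] by (intro sum.cong refl) auto
  also have "\<dots> = - \<xi> k" using k by simp
  finally show ?thesis .
qed

lemma differentiable_vec_mat:
  assumes "\<And>j. j < n \<Longrightarrow> torus_differentiable n (a j)" and k: "k < n"
  shows "torus_differentiable n (\<lambda>x. vec_mat n (\<lambda>j. a j x) (A x) k)"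
    and "x \<in> torus_points n \<Longrightarrow> l < n \<Longrightarrow> torus_partial l (\<lambda>x. vec_mat n (\<lambda>j. a j x) (A x) k) x =
      (\<Sum>j<n. a j x * of_real (torus_partial l (\<lambda>x. A x j k) x) + torus_partial l (a j) x * of_real (A x j k))"
proof -
  have *: "((\<lambda>t. vec_mat n (\<lambda>j. a j (wrap (x(l := t)))) (A (wrap (x(l := t)))) k) has_vector_derivative
      (\<Sum>j<n. a j x * of_real (torus_partial l (\<lambda>x. A x j k) x) + torus_partial l (a j) x * of_real (A x j k))) (at (x l))"
    if x: "x \<in> torus_points n" and l: "l < n" for x l
    unfolding vec_mat_def
  proof (rule has_vector_derivative_sum)
    fix j assume "j \<in> {..<n}"
    then have j: "j < n" by simp
    have "((\<lambda>t. complex_of_real (A (wrap (x(l := t))) j k)) has_vector_derivative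
        of_real (torus_partial l (\<lambda>x. A x j k) x)) (at (x l))"
      using torus_differentiableD[OF torus_smooth_differentiable[OF smooth[OF j k]] x l]
      by (rule bounded_linear.has_vector_derivative[OF bounded_linear_of_real])
    from has_vector_derivative_mult[OF torus_differentiableD[OF assms(1)[OF j] x l] this]
    show "((\<lambda>t. a j (wrap (x(l := t))) * complex_of_real (A (wrap (x(l := t))) j k)) has_vector_derivative
        a j x * of_real (torus_partial l (\<lambda>x. A x j k) x) + torus_partial l (a j) x * of_real (A x j k)) (at (x l))"
      by (simp add: wrap_id[OF x])
  qed
  show "torus_differentiable n (\<lambda>x. vec_mat n (\<lambda>j. a j x) (A x) k)"
    using * by (rule torus_differentiableI)
  show "torus_partial l (\<lambda>x. vec_mat n (\<lambda>j. a j x) (A x) k) x =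
      (\<Sum>j<n. a j x * of_real (torus_partial l (\<lambda>x. A x j k) x) + torus_partial l (a j) x * of_real (A x j k))"
    if "x \<in> torus_points n" "l < n"
    by (rule torus_partialI) (rule *[OF that])
qed

text \<open>By definition d^c of the form is the inverse of J applied to the exterior derivative of
  its image under J, and J is invertible on two-forms; what remains is that the image under J is
  closed.\<close>

lemma d_c_one_form_zero_iff:
  assumes a: "\<And>k. k < n \<Longrightarrow> torus_differentiable n (a k)"
  shows "d_c (torus n) (acs n A) 1 (one_form n a) = 0 \<longleftrightarrow>
    closed_comps n (\<lambda>k x. vec_mat n (\<lambda>j. a j x) (A x) k)"
proof -
  define b where "b = (\<lambda>k x. vec_mat n (\<lambda>j. a j x) (A x) k)"
  have b: "torus_differentiable n (b k)" if "k < n" for k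
    unfolding b_def using differentiable_vec_mat(1)[of a, OF a that] by simp
  have dc: "d_c (torus n) (acs n A) 1 (one_form n a) = J_inv_form (torus n) (acs n A) 2 (ext_d (torus n) (one_form n b))"
    by (simp only: d_c_def J_form_one_form b_def Suc_1)
  have "d_c (torus n) (acs n A) 1 (one_form n a) = 0 \<longleftrightarrow> ext_d (torus n) (one_form n b) = 0"
  proof
    assume *: "ext_d (torus n) (one_form n b) = 0"
    show "d_c (torus n) (acs n A) 1 (one_form n a) = 0"
      unfolding dc * by (intro ext) (simp add: J_inv_form_def)
  next
    assume 0: "d_c (torus n) (acs n A) 1 (one_form n a) = 0"
    have "ext_d (torus n) (one_form n b) x vs = 0" for x vs
    proof (cases "x \<in> torus_points n \<and> (\<exists>v w. vs = [tvec n x v, tvec n x w])")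
      case True
      then obtain v w where x: "x \<in> torus_points n" and vs: "vs = [tvec n x v, tvec n x w]" by blast
      let ?D = "\<lambda>j k. torus_partial j (b k) x"
      have d: "ext_d (torus n) (one_form n b) x [tvec n x v, tvec n x w] = curl n ?D v w" for v w
        by (rule ext_d_one_form) (use b x in auto)
      have "curl n ?D (mat_vec n (A x) v) (mat_vec n (A x) w) = 0" for v w
        using J_inv_form_2[of x n "ext_d (torus n) (one_form n b)" ?D A v w, OF x d] 0 unfolding dc by simp
      \<comment> \<open>Evaluating on Jv and Jw undoes J: both arguments turn into their negatives,
        and the two signs cancel.\<close>
      from this[of "mat_vec n (A x) v" "mat_vec n (A x) w"]
      have "curl n ?D (\<lambda>i. - v i) (\<lambda>i. - w i) = 0"
        using curl_cong[of n "mat_vec n (A x) (mat_vec n (A x) v)" "\<lambda>i. - v i"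
            "mat_vec n (A x) (mat_vec n (A x) w)" "\<lambda>i. - w i" ?D] mat_vec_mat_vec[OF x] by simp
      then show ?thesis unfolding vs d by (simp add: curl_def)
    qed (rule ext_d_one_form_eq_0)
    then show "ext_d (torus n) (one_form n b) = 0" by (simp add: fun_eq_iff)
  qed
  also have "\<dots> \<longleftrightarrow> closed_comps n b"
    by (rule ext_d_one_form_zero_iff) (rule b)
  finally show ?thesis unfolding b_def .
qed

lemma h1_space:
  "{\<alpha> \<in> forms (torus n) 1. ext_d (torus n) \<alpha> = 0 \<and> d_c (torus n) (acs n A) 1 \<alpha> = 0} =
    {one_form n a | a. (\<forall>k<n. torus_smooth n (a k)) \<and> closed_comps n a \<and>
      closed_comps n (\<lambda>k x. vec_mat n (\<lambda>j. a j x) (A x) k)}"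
  unfolding forms_torus
  using ext_d_one_form_zero_iff[of n] d_c_one_form_zero_iff torus_smooth_differentiable by blast

end

section \<open>The Nijenhuis tensor\<close>

context torus_acs
begin

definition type_10 :: "(nat \<Rightarrow> real) \<Rightarrow> (nat \<Rightarrow> complex) \<Rightarrow> bool"
  where "type_10 x \<xi> \<longleftrightarrow> (\<forall>k<n. vec_mat n \<xi> (A x) k = \<i> * \<xi> k)"

definition type_01 :: "(nat \<Rightarrow> real) \<Rightarrow> (nat \<Rightarrow> complex) \<Rightarrow> bool"
  where "type_01 x w \<longleftrightarrow> (\<forall>i<n. mat_vec n (A x) w i = - \<i> * w i)"

lemma bidegree_part_10_covec:
  assumes x: "x \<in> torus_points n"
  shows "bidegree_part (torus n) (acs n A) 1 0 x (covec n x \<xi>) = covec n x (\<lambda>k. (\<xi> k - \<i> * vec_mat n \<xi> (A x) k) / 2)"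
proof
  fix vs
  show "bidegree_part (torus n) (acs n A) 1 0 x (covec n x \<xi>) vs = covec n x (\<lambda>k. (\<xi> k - \<i> * vec_mat n \<xi> (A x) k) / 2) vs"
  proof (cases "\<exists>w. vs = [tvec n x w]")
    case True
    then obtain w where w: "vs = [tvec n x w]" by blast
    have "tvec n x w \<in> ctangent_space (torus n) x" by (simp add: ctangent_space_torus[OF x])
    then have "bidegree_part (torus n) (acs n A) 1 0 x (covec n x \<xi>) vs = (\<Sum>j<n. \<xi> j * ((w j - \<i> * mat_vec n (A x) w j) / 2))"
      by (simp add: w bidegree_part_1 proj_10_acs covec_tvec[OF x])
    also have "\<dots> = (\<Sum>j<n. \<xi> j * w j) / 2 - \<i> / 2 * (\<Sum>j<n. \<xi> j * mat_vec n (A x) w j)"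
      unfolding sum_distrib_left sum_divide_distrib sum_subtractf[symmetric] by (intro sum.cong refl) (simp add: field_simps)
    also have "\<dots> = (\<Sum>k<n. (\<xi> k - \<i> * vec_mat n \<xi> (A x) k) / 2 * w k)"
      unfolding vec_mat_mat_vec[symmetric] sum_distrib_left sum_divide_distrib sum_subtractf[symmetric]
      by (intro sum.cong refl) (simp add: field_simps)
    finally show ?thesis by (simp add: w covec_tvec[OF x])
  next
    case False
    then have "\<not> (length vs = 1 + 0 \<and> set vs \<subseteq> ctangent_space (torus n) x)"
      by (auto simp: length_one_iff ctangent_space_torus[OF x])
    then show ?thesis unfolding covec_eq_0[OF False] by (rule bidegree_part_eq_0)
  qed
qed

lemma alt_forms_10:
  assumes x: "x \<in> torus_points n"
  shows "alt_forms_pq (torus n) (acs n A) 1 0 x = {covec n x \<xi> | \<xi>. type_10 x \<xi>}"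
proof -
  have "(\<xi> k - \<i> * z) / 2 = \<xi> k \<longleftrightarrow> z = \<i> * \<xi> k" for \<xi> :: "nat \<Rightarrow> complex" and k z
    by (auto simp: complex_eq_iff field_simps)
  then have "bidegree_part (torus n) (acs n A) 1 0 x (covec n x \<xi>) = covec n x \<xi> \<longleftrightarrow> type_10 x \<xi>" for \<xi>
    unfolding bidegree_part_10_covec[OF x] covec_eq_iff[OF x] type_10_def by simp
  then show ?thesis
    unfolding alt_forms_pq_def using alt_forms_torus[OF x] by auto
qed

lemma forms_10:
  "forms_pq (torus n) (acs n A) 1 0 =
    {one_form n a | a. (\<forall>k<n. torus_smooth n (a k)) \<and> (\<forall>x\<in>torus_points n. type_10 x (\<lambda>k. a k x))}"
proof -
  have "one_form n a x \<in> alt_forms_pq (torus n) (acs n A) 1 0 x \<longleftrightarrow> type_10 x (\<lambda>k. a k x)"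
    if x: "x \<in> torus_points n" for a x
    unfolding alt_forms_10[OF x] one_form_def using x
    by (auto simp: covec_eq_iff[OF x] type_10_def vec_mat_def)
  then show ?thesis
    unfolding forms_pq_def by (simp add: forms_torus[simplified]) blast
qed

lemma type_10_proj:
  assumes x: "x \<in> torus_points n"
  shows "type_10 x (\<lambda>k. (\<xi> k - \<i> * vec_mat n \<xi> (A x) k) / 2)"
  unfolding type_10_def
proof (intro allI impI)
  fix k assume k: "k < n"
  have "vec_mat n (\<lambda>k. (\<xi> k - \<i> * vec_mat n \<xi> (A x) k) / 2) (A x) k =
      (vec_mat n \<xi> (A x) k - \<i> * vec_mat n (vec_mat n \<xi> (A x)) (A x) k) / 2"
    unfolding vec_mat_def[of n _ "A x" k] sum_distrib_left sum_divide_distrib sum_subtractf[symmetric]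
    by (intro sum.cong refl) (simp add: field_simps)
  then show "vec_mat n (\<lambda>k. (\<xi> k - \<i> * vec_mat n \<xi> (A x) k) / 2) (A x) k = \<i> * ((\<xi> k - \<i> * vec_mat n \<xi> (A x) k) / 2)"
    by (simp add: vec_mat_vec_mat[OF x k] field_simps)
qed

lemma type_01_proj:
  assumes x: "x \<in> torus_points n"
  shows "type_01 x (\<lambda>i. (w i + \<i> * mat_vec n (A x) w i) / 2)"
  unfolding type_01_def
proof (intro allI impI)
  fix i assume i: "i < n"
  have "mat_vec n (A x) (\<lambda>i. (w i + \<i> * mat_vec n (A x) w i) / 2) i =
      (mat_vec n (A x) w i + \<i> * mat_vec n (A x) (mat_vec n (A x) w) i) / 2"
    unfolding mat_vec_def[of n "A x" _ i] sum_distrib_left sum_divide_distrib sum.distrib[symmetric]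
    by (intro sum.cong refl) (simp add: field_simps)
  then show "mat_vec n (A x) (\<lambda>i. (w i + \<i> * mat_vec n (A x) w i) / 2) i = - \<i> * ((w i + \<i> * mat_vec n (A x) w i) / 2)"
    by (simp add: mat_vec_mat_vec[OF x i] field_simps)
qed

text \<open>Extend with constant components and project to type (1,0) at every point. The projection
  is smooth because \<open>A\<close> is, and it fixes the given covector at \<open>x\<close>. Thus
  the choice in \<open>mu_bar_at\<close> is made from a nonempty set.\<close>

lemma extend_10:
  assumes x: "x \<in> torus_points n" and \<xi>: "type_10 x \<xi>"
  shows "\<exists>\<alpha>. \<alpha> \<in> forms_pq (torus n) (acs n A) 1 0 \<and> \<alpha> x = covec n x \<xi>"
proof -
  define a where "a k y = (\<xi> k - \<i> * vec_mat n \<xi> (A y) k) / 2" for k y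
  have "torus_smooth n (\<lambda>y. 1/2 * \<xi> k + (- \<i>/2) * (\<Sum>j<n. \<xi> j * of_real (A y j k)))" if "k < n" for k
    by (intro torus_smooth_add torus_smooth_const torus_smooth_cmult torus_smooth_sum torus_smooth_of_real smooth)
      (use that in auto)
  moreover have "(\<lambda>y. 1/2 * \<xi> k + (- \<i>/2) * (\<Sum>j<n. \<xi> j * of_real (A y j k))) = a k" for k
    by (auto simp: a_def vec_mat_def field_simps)
  ultimately have "torus_smooth n (a k)" if "k < n" for k using that by metis
  then have "one_form n a \<in> forms_pq (torus n) (acs n A) 1 0"
    unfolding forms_10 a_def using type_10_proj by blast
  moreover have "one_form n a x = covec n x \<xi>"
    unfolding one_form_def using x \<xi> by (simp add: covec_eq_iff a_def type_10_def)
  ultimately show ?thesis by blast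
qed

text \<open>Writing D_z A for the derivative of the matrix along z, this is -(i/2) times the value
  of \<open>\<xi>\<close> on (D_z A)w - (D_w A)z. For a covector of type (1,0) and vectors of type
  (0,1) it is mu-bar, that is, the covector applied to the Nijenhuis tensor up to a constant
  factor.\<close>

definition torsion :: "(nat \<Rightarrow> real) \<Rightarrow> (nat \<Rightarrow> complex) \<Rightarrow> (nat \<Rightarrow> complex) \<Rightarrow> (nat \<Rightarrow> complex) \<Rightarrow> complex"
  where "torsion x \<xi> z w = - (\<i>/2) *
    ((\<Sum>l<n. z l * (\<Sum>j<n. \<xi> j * mat_vec n (\<lambda>j k. torus_partial l (\<lambda>y. A y j k) x) w j)) -
     (\<Sum>l<n. w l * (\<Sum>j<n. \<xi> j * mat_vec n (\<lambda>j k. torus_partial l (\<lambda>y. A y j k) x) z j)))"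

text \<open>Differentiating \<open>a A = \<i> a\<close> and pairing with a vector of type (0,1) expresses the derivatives of \<open>a\<close>
  in terms of the derivatives of \<open>A\<close>.\<close>

lemma partial_type_10:
  assumes a: "\<And>k. k < n \<Longrightarrow> torus_smooth n (a k)" and t: "\<And>y. y \<in> torus_points n \<Longrightarrow> type_10 y (\<lambda>k. a k y)"
    and x: "x \<in> torus_points n" and w: "type_01 x w" and l: "l < n"
  shows "(\<Sum>k<n. torus_partial l (a k) x * w k) =
    - (\<i>/2) * (\<Sum>j<n. a j x * mat_vec n (\<lambda>j k. torus_partial l (\<lambda>y. A y j k) x) w j)"
proof -
  let ?D = "\<lambda>j k. torus_partial l (\<lambda>y. A y j k) x"
  have d: "torus_differentiable n (a k)" if "k < n" for k
    by (rule torus_smooth_differentiable[OF a[OF that]])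
  have eq: "vec_mat n (\<lambda>j. a j x) ?D k + vec_mat n (\<lambda>j. torus_partial l (a j) x) (A x) k = \<i> * torus_partial l (a k) x"
    if k: "k < n" for k
  proof -
    have "torus_partial l (\<lambda>y. vec_mat n (\<lambda>j. a j y) (A y) k) x = torus_partial l (\<lambda>y. \<i> * a k y) x"
      by (rule torus_partial_cong[OF x l]) (use t k in \<open>simp add: type_10_def\<close>)
    also have "\<dots> = \<i> * torus_partial l (a k) x"
      by (intro torus_partialI has_vector_derivative_mult_right torus_differentiableD[OF d[OF k] x l])
    finally show ?thesis
      using differentiable_vec_mat(2)[of a k x l] d k x l by (simp add: vec_mat_def sum.distrib)
  qed
  have "(\<Sum>k<n. \<i> * torus_partial l (a k) x * w k) =
      (\<Sum>k<n. vec_mat n (\<lambda>j. a j x) ?D k * w k) + (\<Sum>k<n. vec_mat n (\<lambda>j. torus_partial l (a j) x) (A x) k * w k)"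
    unfolding sum.distrib[symmetric] distrib_right[symmetric] by (intro sum.cong refl) (simp add: eq)
  also have "\<dots> = (\<Sum>j<n. a j x * mat_vec n ?D w j) + (\<Sum>j<n. torus_partial l (a j) x * (- \<i> * w j))"
    unfolding vec_mat_mat_vec using w by (simp add: type_01_def)
  finally have *: "2 * \<i> * (\<Sum>k<n. torus_partial l (a k) x * w k) = (\<Sum>j<n. a j x * mat_vec n ?D w j)"
    by (simp add: sum_negf sum_distrib_left[symmetric] ac_simps)
  have "s = - (\<i>/2) * (2 * \<i> * s)" for s :: complex by simp
  from this[of "\<Sum>k<n. torus_partial l (a k) x * w k"] show ?thesis unfolding * .
qed

text \<open>This is the tensoriality of mu-bar: the derivatives of the coefficients are traded for
  those of \<open>A\<close>, and only the values of the form at \<open>x\<close> are left. So the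
  extension chosen in \<open>mu_bar_at\<close> does not matter.\<close>

lemma curl_type_10:
  assumes a: "\<And>k. k < n \<Longrightarrow> torus_smooth n (a k)" and t: "\<And>y. y \<in> torus_points n \<Longrightarrow> type_10 y (\<lambda>k. a k y)"
    and x: "x \<in> torus_points n" and z: "type_01 x z" and w: "type_01 x w"
  shows "curl n (\<lambda>j k. torus_partial j (a k) x) z w = torsion x (\<lambda>k. a k x) z w"
proof -
  have "curl n (\<lambda>j k. torus_partial j (a k) x) z w =
      (\<Sum>l<n. z l * (\<Sum>k<n. torus_partial l (a k) x * w k)) - (\<Sum>l<n. w l * (\<Sum>k<n. torus_partial l (a k) x * z k))"
    by (simp add: curl_def sum_distrib_left sum_subtractf[symmetric] algebra_simps)
  also have "\<dots> = torsion x (\<lambda>k. a k x) z w"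
    using partial_type_10[of a x _ , OF a t x w] partial_type_10[of a x _ , OF a t x z]
    by (simp add: torsion_def right_diff_distrib sum_distrib_left ac_simps)
  finally show ?thesis .
qed

lemma mu_bar_at_covec:
  assumes x: "x \<in> torus_points n" and \<xi>: "type_10 x \<xi>"
  shows "mu_bar_at (torus n) (acs n A) x (covec n x \<xi>) [tvec n x v, tvec n x w] =
      torsion x \<xi> (\<lambda>i. (v i + \<i> * mat_vec n (A x) v i) / 2) (\<lambda>i. (w i + \<i> * mat_vec n (A x) w i) / 2)"
    and "\<nexists>v w. vs = [tvec n x v, tvec n x w] \<Longrightarrow> mu_bar_at (torus n) (acs n A) x (covec n x \<xi>) vs = 0"
proof -
  define \<alpha> where "\<alpha> = (SOME \<alpha>. \<alpha> \<in> forms_pq (torus n) (acs n A) 1 0 \<and> \<alpha> x = covec n x \<xi>)"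
  have \<alpha>: "\<alpha> \<in> forms_pq (torus n) (acs n A) 1 0 \<and> \<alpha> x = covec n x \<xi>"
    using someI_ex[OF extend_10[OF x \<xi>]] unfolding \<alpha>_def .
  then obtain a where a: "\<alpha> = one_form n a" "\<And>k. k < n \<Longrightarrow> torus_smooth n (a k)"
      "\<And>y. y \<in> torus_points n \<Longrightarrow> type_10 y (\<lambda>k. a k y)"
    unfolding forms_10 by blast
  have ax: "a k x = \<xi> k" if "k < n" for k
    using \<alpha> x that by (simp add: a(1) one_form_def covec_eq_iff)
  have mu: "mu_bar_at (torus n) (acs n A) x (covec n x \<xi>) = bidegree_part (torus n) (acs n A) 0 2 x (ext_d (torus n) (one_form n a) x)"
    unfolding mu_bar_at_def mu_bar_def \<alpha>_def[symmetric] a(1) ..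
  have ct: "tvec n x u \<in> ctangent_space (torus n) x" for u by (simp add: ctangent_space_torus[OF x])
  show "mu_bar_at (torus n) (acs n A) x (covec n x \<xi>) [tvec n x v, tvec n x w] =
      torsion x \<xi> (\<lambda>i. (v i + \<i> * mat_vec n (A x) v i) / 2) (\<lambda>i. (w i + \<i> * mat_vec n (A x) w i) / 2)" (is "_ = torsion x \<xi> ?v ?w")
  proof -
    have "mu_bar_at (torus n) (acs n A) x (covec n x \<xi>) [tvec n x v, tvec n x w] =
        ext_d (torus n) (one_form n a) x [tvec n x ?v, tvec n x ?w]"
      unfolding mu bidegree_part_2[OF ct ct] proj_01_acs ..
    also have "\<dots> = curl n (\<lambda>j k. torus_partial j (a k) x) ?v ?w"
      by (rule ext_d_one_form) (use a(2) x in \<open>auto intro: torus_smooth_differentiable\<close>)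
    also have "\<dots> = torsion x (\<lambda>k. a k x) ?v ?w"
      by (rule curl_type_10[OF a(2,3) x type_01_proj[OF x] type_01_proj[OF x]])
    also have "\<dots> = torsion x \<xi> ?v ?w"
      by (simp add: torsion_def ax)
    finally show ?thesis .
  qed
  assume "\<nexists>v w. vs = [tvec n x v, tvec n x w]"
  then have "\<not> (length vs = 0 + 2 \<and> set vs \<subseteq> ctangent_space (torus n) x)"
    by (auto simp: length_Suc_conv ctangent_space_torus[OF x])
  then show "mu_bar_at (torus n) (acs n A) x (covec n x \<xi>) vs = 0"
    unfolding mu by (rule bidegree_part_eq_0)
qed

text \<open>The image of \<open>\<xi>\<close> under mu-bar is nonzero because of \<open>v\<close>
  and \<open>w\<close>, and by \<open>mult\<close> the image of every other covector of type (1,0)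
  is a multiple of it; hence it forms a basis of the image.\<close>

lemma nijenhuis_rank_eq_1:
  assumes x: "x \<in> torus_points n" and \<xi>: "type_10 x \<xi>"
    and vw: "type_01 x v" "type_01 x w" "torsion x \<xi> v w \<noteq> 0"
    and mult: "\<And>\<eta>. type_10 x \<eta> \<Longrightarrow> \<exists>c. \<forall>z w. type_01 x z \<longrightarrow> type_01 x w \<longrightarrow> torsion x \<eta> z w = c * torsion x \<xi> z w"
  shows "nijenhuis_rank (torus n) (acs n A) x = 1"
proof -
  interpret cov: vector_space covec_scale by (rule vector_space_covec_scale)
  let ?m = "mu_bar_at (torus n) (acs n A) x"
  define \<beta> where "\<beta> = ?m (covec n x \<xi>)"
  have id: "(u i + \<i> * mat_vec n (A x) u i) / 2 = u i" if "type_01 x u" "i < n" for u i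
    using that by (simp add: type_01_def)
  have cong: "torsion x \<eta> z w = torsion x \<eta> z' w'" if "\<And>i. i < n \<Longrightarrow> z i = z' i" "\<And>i. i < n \<Longrightarrow> w i = w' i" for \<eta> z w z' w'
    using that by (simp add: torsion_def mat_vec_def)
  \<comment> \<open>The projection to type (0,1) fixes \<open>v\<close> and \<open>w\<close>, so
    mu-bar takes the value of the torsion on them.\<close>
  have "\<beta> [tvec n x v, tvec n x w] = torsion x \<xi> v w"
    unfolding \<beta>_def mu_bar_at_covec(1)[OF x \<xi>] by (rule cong) (simp_all only: id[OF vw(1)] id[OF vw(2)])
  then have "\<beta> \<noteq> 0" using vw(3) by auto
  show ?thesis
    unfolding nijenhuis_rank_def alt_forms_10[OF x]
  proof (rule cov.dim_unique)
    show "{\<beta>} \<subseteq> ?m ` {covec n x \<xi> | \<xi>. type_10 x \<xi>}" using \<xi> by (auto simp: \<beta>_def)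
    show "?m ` {covec n x \<xi> | \<xi>. type_10 x \<xi>} \<subseteq> cov.span {\<beta>}"
    proof
      fix \<gamma> assume "\<gamma> \<in> ?m ` {covec n x \<xi> | \<xi>. type_10 x \<xi>}"
      then obtain \<eta> where \<eta>: "type_10 x \<eta>" "\<gamma> = ?m (covec n x \<eta>)" by blast
      obtain c where c: "\<And>z w. type_01 x z \<Longrightarrow> type_01 x w \<Longrightarrow> torsion x \<eta> z w = c * torsion x \<xi> z w"
        using mult[OF \<eta>(1)] by blast
      have "\<gamma> vs = c * \<beta> vs" for vs
      proof (cases "\<exists>v w. vs = [tvec n x v, tvec n x w]")
        case True
        then obtain v w where vs: "vs = [tvec n x v, tvec n x w]" by blast
        show ?thesis
          unfolding vs \<eta>(2) \<beta>_def mu_bar_at_covec(1)[OF x \<eta>(1)] mu_bar_at_covec(1)[OF x \<xi>]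
          by (rule c) (rule type_01_proj[OF x])+
      qed (simp add: \<eta>(2) \<beta>_def mu_bar_at_covec(2)[OF x \<eta>(1)] mu_bar_at_covec(2)[OF x \<xi>])
      then have "\<gamma> = covec_scale c \<beta>" by (auto simp: covec_scale_def)
      then show "\<gamma> \<in> cov.span {\<beta>}" by (simp add: cov.span_scale cov.span_base)
    qed
    show "cov.independent {\<beta>}" using \<open>\<beta> \<noteq> 0\<close> by simp
  qed simp
qed

end

section \<open>Matrices of trigonometric functions\<close>

text \<open>A family containing all matrix entries of both structures and closed under partial
  derivatives, which yields smoothness by coinduction.\<close>

definition trig :: "real \<Rightarrow> real \<Rightarrow> real \<Rightarrow> (nat \<Rightarrow> real) \<Rightarrow> real"
  where "trig a b c p = a + cos (2 * pi * p 0) * b + sin (2 * pi * p 0) * c"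

lemma trig_wrap: "trig a b c (wrap p) = trig a b c p"
proof -
  have "cos (2 * pi * frac (p 0)) = cos (2 * pi * p 0)" "sin (2 * pi * frac (p 0)) = sin (2 * pi * p 0)"
    using cis_2pi_frac[of "p 0"] by (auto simp: complex_eq_iff)
  then show ?thesis by (simp add: trig_def wrap_def)
qed

lemma has_partial_trig:
  "((\<lambda>t. trig a b c (p(j := t))) has_vector_derivative
    (if j = 0 then trig 0 (2 * pi * c) (- (2 * pi * b)) p else 0)) (at (p j))"
  unfolding has_real_derivative_iff_has_vector_derivative[symmetric] trig_def
  by (cases "j = 0") (auto intro!: derivative_eq_intros simp: algebra_simps)

lemma torus_smooth_trig: "torus_smooth n (trig a b c)"
  unfolding torus_smooth_def trig_wrap
proof (rule smooth_on_coinduct[where S="{trig a b c | a b c. True}"])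
  fix g assume "g \<in> {trig a b c | a b c. True}"
  then obtain a b c where g: "g = trig a b c" by blast
  have "continuous_on UNIV (trig a b c)"
    unfolding trig_def by (intro continuous_intros continuous_on_product_coordinates)
  then show "continuous_map (subtopology (Euclidean_space n) (topspace (Euclidean_space n))) euclidean g"
    unfolding g subtopology_topspace continuous_map_Euclidean_space_iff
    by (rule continuous_on_subset) simp
  show "(\<lambda>t. g (p(j := t))) differentiable at (p j)" for p j
    unfolding g by (rule differentiableI_vector) (rule has_partial_trig)
  fix j
  have P: "partial j g p = (if j = 0 then trig 0 (2 * pi * c) (- (2 * pi * b)) p else 0)" for p
    unfolding g by (rule partial_fun_upd_eq) (rule has_partial_trig)
  have "trig 0 0 0 p = 0" for p by (simp add: trig_def)
  then show "\<exists>h\<in>{trig a b c | a b c. True}. \<forall>p\<in>topspace (Euclidean_space n). partial j g p = h p"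
    unfolding P by (cases "j = 0") force+
qed auto

lemma torus_partial_trig:
  "torus_partial l (trig a b c) x = (if l = 0 then trig 0 (2 * pi * c) (- (2 * pi * b)) x else 0)"
  by (rule torus_partialI) (simp only: trig_wrap, rule has_partial_trig)

text \<open>The three lists of rows hold the constant terms, the cosine coefficients and the sine
  coefficients of the entries.\<close>

definition trig_mat :: "real list list \<Rightarrow> real list list \<Rightarrow> real list list \<Rightarrow> (nat \<Rightarrow> real) \<Rightarrow> nat \<Rightarrow> nat \<Rightarrow> real"
  where "trig_mat K L M x i j = trig (K ! i ! j) (L ! i ! j) (M ! i ! j) x"

lemma torus_smooth_trig_mat: "torus_smooth n (\<lambda>x. trig_mat K L M x i j)"
  unfolding trig_mat_def by (rule torus_smooth_trig)

lemma torus_partial_trig_mat: "torus_partial l (\<lambda>y. trig_mat K L M y j k) x =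
    (if l = 0 then 2 * pi * (cos (2 * pi * x 0) * M ! j ! k - sin (2 * pi * x 0) * L ! j ! k) else 0)"
  unfolding trig_mat_def torus_partial_trig by (simp add: trig_def algebra_simps)

lemma sum_4: "(\<Sum>j<4. f j) = f 0 + f 1 + f 2 + f (3::nat)"
  by (simp add: eval_nat_numeral)

lemma all_less_4: "(\<forall>k<4. P k) \<longleftrightarrow> P 0 \<and> P 1 \<and> P 2 \<and> P (3::nat)"
  by (auto simp: eval_nat_numeral less_Suc_eq)

context torus_acs
begin

text \<open>If \<open>\<alpha>\<close> and \<open>J\<alpha>\<close> are both closed, then \<open>\<alpha>\<close> annihilates the values of the Nijenhuis tensor; evaluated
  on two eigenvectors of \<open>J\<close> for the same eigenvalue, the symmetric matrix of derivatives of \<open>\<alpha>\<close> drops out.\<close>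

lemma torsion_closed:
  assumes a: "\<And>k. k < n \<Longrightarrow> torus_differentiable n (a k)" and closed: "closed_comps n a"
    and closed': "closed_comps n (\<lambda>k x. vec_mat n (\<lambda>j. a j x) (A x) k)"
    and x: "x \<in> torus_points n"
    and z: "\<And>i. i < n \<Longrightarrow> mat_vec n (A x) z i = e * z i" and w: "\<And>i. i < n \<Longrightarrow> mat_vec n (A x) w i = e * w i"
  shows "torsion x (\<lambda>k. a k x) z w = 0"
proof -
  let ?D = "\<lambda>l j k. torus_partial l (\<lambda>y. A y j k) x" and ?d = "\<lambda>l k. torus_partial l (a k) x"
  let ?P = "\<lambda>u v. \<Sum>l<n. u l * (\<Sum>k<n. torus_partial l (\<lambda>y. vec_mat n (\<lambda>j. a j y) (A y) k) x * v k)"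
  let ?Q = "\<lambda>u v. \<Sum>l<n. u l * (\<Sum>j<n. a j x * mat_vec n (?D l) v j)"
  let ?S = "\<lambda>u v. \<Sum>l<n. u l * (\<Sum>j<n. ?d l j * v j)"
  \<comment> \<open>The product rule splits the derivative of the image form into a term with the
    derivative of \<open>A\<close> and one with that of \<open>a\<close>; in the latter
    \<open>A\<close> meets its eigenvector and becomes the scalar \<open>e\<close>. Closedness makes
    \<open>?P\<close> and \<open>?S\<close> symmetric, hence also \<open>?Q\<close>. The eigenvalue
    is kept general since i and -i are both used.\<close>
  have P: "?P u v = ?Q u v + e * ?S u v" if v: "\<And>i. i < n \<Longrightarrow> mat_vec n (A x) v i = e * v i" for u v
  proof -
    have "(\<Sum>k<n. torus_partial l (\<lambda>y. vec_mat n (\<lambda>j. a j y) (A y) k) x * v k) =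
        (\<Sum>j<n. a j x * mat_vec n (?D l) v j) + e * (\<Sum>j<n. ?d l j * v j)" if l: "l < n" for l
    proof -
      have "(\<Sum>k<n. torus_partial l (\<lambda>y. vec_mat n (\<lambda>j. a j y) (A y) k) x * v k) =
         (\<Sum>k<n. vec_mat n (\<lambda>j. a j x) (?D l) k * v k) + (\<Sum>k<n. vec_mat n (?d l) (A x) k * v k)"
        unfolding sum.distrib[symmetric] using differentiable_vec_mat(2)[of a _ x l] a x l
        by (intro sum.cong refl) (simp add: vec_mat_def sum.distrib distrib_right)
      also have "(\<Sum>k<n. vec_mat n (?d l) (A x) k * v k) = (\<Sum>j<n. ?d l j * (e * v j))"
        unfolding vec_mat_mat_vec using v by simp
      finally show ?thesis unfolding vec_mat_mat_vec by (simp add: sum_distrib_left ac_simps)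
    qed
    then show ?thesis by (simp add: distrib_left sum.distrib sum_distrib_left ac_simps)
  qed
  have P_sym: "?P z w = ?P w z"
    unfolding sum_distrib_left
    by (subst sum.swap) (use closed' x in \<open>simp add: closed_comps_def ac_simps\<close>)
  have S_sym: "?S z w = ?S w z"
    unfolding sum_distrib_left
    by (subst sum.swap) (use closed x in \<open>simp add: closed_comps_def ac_simps\<close>)
  have "?Q z w = ?Q w z" using P[of w z, OF w] P[of z w, OF z] P_sym S_sym by simp
  then show ?thesis by (simp add: torsion_def)
qed

end

section \<open>Two almost complex structures on the four-torus\<close>

text \<open>The matrix of \<open>X\<^sub>1 \<mapsto> X\<^sub>2\<close>, \<open>X\<^sub>3 \<mapsto> X\<^sub>4\<close> in the coordinate frame.\<close>

definition A_rot :: "(nat \<Rightarrow> real) \<Rightarrow> nat \<Rightarrow> nat \<Rightarrow> real"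
  where "A_rot = trig_mat
    [[0,0,0,0], [0,0,0,0], [0,0,0,0], [0,0,0,0]]
    [[0,-1,0,0], [1,0,0,0], [0,0,0,-1], [0,0,1,0]]
    [[0,0,-1,0], [0,0,0,1], [1,0,0,0], [0,-1,0,0]]"

interpretation rot: torus_acs 4 A_rot
proof
  fix i j :: nat and x :: "nat \<Rightarrow> real"
  show "torus_smooth 4 (\<lambda>x. A_rot x i j)" unfolding A_rot_def by (rule torus_smooth_trig_mat)
next
  fix x :: "nat \<Rightarrow> real" and i k :: nat assume "i < 4" "k < 4"
  moreover have "\<forall>i<4. \<forall>k<4. (\<Sum>j<4. A_rot x i j * A_rot x j k) = (if i = k then -1 else 0)"
    using sin_cos_squared_add3[of "2 * pi * x 0"]
    by (simp add: all_less_4 sum_4 A_rot_def trig_mat_def trig_def algebra_simps)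
  ultimately show "(\<Sum>j<4. A_rot x i j * A_rot x j k) = (if i = k then -1 else 0)" by blast
qed

text \<open>On the directions 1 and 2 the block has trace 0 and determinant (5/4)^2 - (3/4)^2 (c^2 +
  s^2) = 1, so it squares to minus the identity; 5/4 and 3/4 are the hyperbolic cosine and sine of
  log 2. The other two directions carry the standard structure.\<close>

definition A_prod :: "(nat \<Rightarrow> real) \<Rightarrow> nat \<Rightarrow> nat \<Rightarrow> real"
  where "A_prod = trig_mat
    [[0,0,0,-1], [0,0,-5/4,0], [0,5/4,0,0], [1,0,0,0]]
    [[0,0,0,0], [0,0,-3/4,0], [0,-3/4,0,0], [0,0,0,0]]
    [[0,0,0,0], [0,3/4,0,0], [0,0,-3/4,0], [0,0,0,0]]"

interpretation prd: torus_acs 4 A_prod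
proof
  fix i j :: nat and x :: "nat \<Rightarrow> real"
  show "torus_smooth 4 (\<lambda>x. A_prod x i j)" unfolding A_prod_def by (rule torus_smooth_trig_mat)
next
  fix x :: "nat \<Rightarrow> real" and i k :: nat assume "i < 4" "k < 4"
  moreover define c s where "c = cos (2 * pi * x 0)" and "s = sin (2 * pi * x 0)"
  have tr: "trig a b d x = a + c * b + s * d" for a b d by (simp add: trig_def c_def s_def)
  have cs: "c * c + s * s = 1" by (simp add: c_def s_def)
  have "\<forall>i<4. \<forall>k<4. (\<Sum>j<4. A_prod x i j * A_prod x j k) = (if i = k then -1 else 0)"
    by (simp add: all_less_4 sum_4 A_prod_def trig_mat_def tr algebra_simps) (use cs in linarith)
  ultimately show "(\<Sum>j<4. A_prod x i j * A_prod x j k) = (if i = k then -1 else 0)" by blast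
qed

section \<open>Liouville's theorem on the torus\<close>

lemma torus_partial_wrap: "torus_partial j f (wrap p) = torus_partial j f p"
proof -
  have "p i - wrap p i \<in> \<int>" for i by (simp add: wrap_def frac_def)
  then show ?thesis by (rule torus_partial_periodic[symmetric])
qed

lemma torus_partial_zero_constant:
  assumes f: "torus_smooth n f" and j: "j < n" and p: "p \<in> topspace (Euclidean_space n)"
    and D: "\<And>x. x \<in> torus_points n \<Longrightarrow> torus_partial j f x = 0"
  shows "f (wrap (p(j := t))) = f (wrap p)"
proof -
  have "((\<lambda>t. f (wrap (p(j := t)))) has_vector_derivative 0) (at t)" for t
  proof -
    have q: "p(j := t) \<in> topspace (Euclidean_space n)"
      using p j by (auto simp: topspace_Euclidean_space)
    have "torus_partial j f (p(j := t)) = 0"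
      using D[OF wrap_torus_points[OF q]] by (simp add: torus_partial_wrap)
    then show ?thesis using torus_smooth_deriv[OF f j q] by simp
  qed
  then obtain C where "\<And>t. f (wrap (p(j := t))) = C"
    using has_vector_derivative_zero_constant[of UNIV "\<lambda>t. f (wrap (p(j := t)))"] by auto
  from this[of t] this[of "p j"] show ?thesis by simp
qed

definition plane_point :: "nat \<Rightarrow> nat \<Rightarrow> real \<Rightarrow> real \<Rightarrow> nat \<Rightarrow> real"
  where "plane_point j k u v = (\<lambda>i. if i = j then u else if i = k then v else 0)"

lemma plane_point_upd:
  "j \<noteq> k \<Longrightarrow> (plane_point j k u v)(j := t) = plane_point j k t v"
  "j \<noteq> k \<Longrightarrow> (plane_point j k u v)(k := t) = plane_point j k u t"
  by (auto simp: plane_point_def)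

lemma continuous_on_plane_point: "continuous_on S (\<lambda>z. plane_point j k (fst z) (snd z))"
proof (rule continuous_on_coordinatewise_then_product)
  show "continuous_on S (\<lambda>z. plane_point j k (fst z) (snd z) i)" for i
    unfolding plane_point_def by (cases "i = j"; cases "i = k") (auto intro: continuous_intros)
qed

text \<open>The relation between the derivatives is the Cauchy-Riemann equation in the plane of
  coordinates \<open>j\<close> and \<open>k\<close>, with the orientation determined by
  \<open>\<kappa>\<close>, which is 1 or -1. Periodicity bounds the lift on the whole plane.\<close>

lemma torus_liouville:
  fixes f :: "(nat \<Rightarrow> real) \<Rightarrow> complex"
  assumes f: "torus_smooth n f" and jk: "j < n" "k < n" "j \<noteq> k" and \<kappa>: "\<kappa> * \<kappa> = 1"
    and CR: "\<And>x. x \<in> torus_points n \<Longrightarrow> torus_partial k f x = of_real \<kappa> * \<i> * torus_partial j f x"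
  shows "\<exists>C. \<forall>u v. f (wrap (plane_point j k u v)) = C"
proof -
  let ?q = "plane_point j k" and ?E = "topspace (Euclidean_space n)"
  have q: "?q u v \<in> ?E" for u v using jk by (simp add: plane_point_def topspace_Euclidean_space)
  have CR': "torus_partial k f (?q u v) = of_real \<kappa> * \<i> * torus_partial j f (?q u v)" for u v
    using CR[OF wrap_torus_points[OF q]] by (simp add: torus_partial_wrap)
  define H where "H u v = f (wrap (?q u v))" for u v
  define Dj where "Dj u v = torus_partial j f (?q u v)" for u v
  define Dk where "Dk u v = torus_partial k f (?q u v)" for u v
  have Hj: "((\<lambda>u. H u v) has_vector_derivative Dj u v) (at u)" for u v
    using torus_smooth_deriv[OF f jk(1) q[of u v]]
    by (simp add: plane_point_upd[OF jk(3)] H_def Dj_def) (simp add: plane_point_def)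
  have Hk: "((\<lambda>v. H u v) has_vector_derivative Dk u v) (at v)" for u v
    using torus_smooth_deriv[OF f jk(2) q[of u v]] jk(3)
    by (simp add: plane_point_upd[OF jk(3)] H_def Dk_def) (simp add: plane_point_def)
  have cont: "continuous_on UNIV (\<lambda>z. g (?q (fst z) (snd z)))" if "continuous_on ?E g"
    for g :: "(nat \<Rightarrow> real) \<Rightarrow> complex"
    by (rule continuous_on_compose2[OF that continuous_on_plane_point]) (use q in auto)
  have contH: "continuous_on UNIV (\<lambda>z. H (fst z) (snd z))"
    unfolding H_def by (rule cont[OF torus_smooth_continuous(1)[OF f]])
  have contDk: "continuous_on UNIV (\<lambda>z. Dk (fst z) (snd z))"
    unfolding Dk_def by (rule cont[OF torus_smooth_continuous(2)[OF f jk(2)]])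
  \<comment> \<open>Smoothness supplies partial derivatives; continuity of the second one upgrades
    them to the total derivative required for complex differentiability.\<close>
  have H: "((\<lambda>(u, v). H u v) has_derivative (\<lambda>(s, t). s *\<^sub>R Dj u v + t *\<^sub>R Dk u v)) (at (u, v))" for u v
  proof -
    have "((\<lambda>(u, v). H u v) has_derivative (\<lambda>(s, t). s *\<^sub>R Dj u v + blinfun_apply (blinfun_scaleR_left (Dk u v)) t))
        (at (u, v) within UNIV \<times> UNIV)"
    proof (rule has_derivative_partialsI)
      show "((\<lambda>u. H u v) has_derivative (\<lambda>s. s *\<^sub>R Dj u v)) (at u within UNIV)"
        using Hj by (simp add: has_vector_derivative_def)
      show "((\<lambda>v. H u v) has_derivative blinfun_apply (blinfun_scaleR_left (Dk u v))) (at v within UNIV)" for u v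
        using Hk by (simp add: has_vector_derivative_def blinfun_scaleR_left.rep_eq)
      have "continuous (at (u, v)) (\<lambda>z. blinfun_scaleR_left (Dk (fst z) (snd z)))"
        using contDk by (intro bounded_linear.continuous[OF bounded_linear_blinfun_scaleR_left])
          (simp add: continuous_on_eq_continuous_at)
      then show "continuous (at (u, v) within UNIV \<times> UNIV) (\<lambda>(u, v). blinfun_scaleR_left (Dk u v))"
        by (simp add: case_prod_unfold)
    qed auto
    then show ?thesis by (simp add: blinfun_scaleR_left.rep_eq)
  qed
  \<comment> \<open>For \<open>\<kappa>\<close> = -1 the plane is reflected, which turns an
    antiholomorphic function into a holomorphic one.\<close>
  define G where "G z = H (Re z) (\<kappa> * Im z)" for z
  have "(G has_field_derivative Dj (Re z) (\<kappa> * Im z)) (at z)" for z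
  proof -
    have "((\<lambda>z. (Re z, \<kappa> * Im z)) has_derivative (\<lambda>h. (Re h, \<kappa> * Im h))) (at z)"
      by (auto intro!: derivative_eq_intros)
    from has_derivative_compose[OF this H[of "Re z" "\<kappa> * Im z"]]
    have "(G has_derivative (\<lambda>h. Re h *\<^sub>R Dj (Re z) (\<kappa> * Im z) + (\<kappa> * Im h) *\<^sub>R Dk (Re z) (\<kappa> * Im z))) (at z)"
      by (simp add: G_def[abs_def])
    moreover have "Re h *\<^sub>R Dj u v + (\<kappa> * Im h) *\<^sub>R Dk u v = Dj u v * h" for h u v
    proof -
      have "Dk u v = of_real \<kappa> * \<i> * Dj u v" unfolding Dk_def Dj_def by (rule CR')
      then have "Re h *\<^sub>R Dj u v + (\<kappa> * Im h) *\<^sub>R Dk u v =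
          (of_real (Re h) + of_real (\<kappa> * \<kappa>) * (\<i> * of_real (Im h))) * Dj u v"
        by (simp add: scaleR_conv_of_real algebra_simps)
      also have "\<dots> = Dj u v * h" unfolding \<kappa> by (simp add: complex_eq[symmetric] mult.commute)
      finally show ?thesis .
    qed
    ultimately show ?thesis by (simp add: has_field_derivative_def)
  qed
  then have "G holomorphic_on UNIV"
    by (auto simp: holomorphic_on_open)
  \<comment> \<open>By periodicity all values are already taken on the closed unit square, which is
    compact.\<close>
  moreover have "bounded (range G)"
  proof -
    have "compact ((\<lambda>z. H (fst z) (snd z)) ` ({0..1} \<times> {0..1}))"
      by (intro compact_continuous_image continuous_on_subset[OF contH] compact_Times) auto
    moreover have "range G \<subseteq> (\<lambda>z. H (fst z) (snd z)) ` ({0..1} \<times> {0..1})"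
    proof
      fix y assume "y \<in> range G"
      then obtain z where "y = H (Re z) (\<kappa> * Im z)" by (auto simp: G_def)
      moreover have "wrap (?q (frac u) (frac v)) = wrap (?q u v)" for u v
        by (auto simp: wrap_def plane_point_def)
      ultimately have "y = H (frac (Re z)) (frac (\<kappa> * Im z))" by (simp add: H_def)
      then show "y \<in> (\<lambda>z. H (fst z) (snd z)) ` ({0..1} \<times> {0..1})"
        by (intro image_eqI[of _ _ "(frac (Re z), frac (\<kappa> * Im z))"]) (auto simp: less_imp_le[OF frac_lt_1])
    qed
    ultimately show ?thesis using bounded_subset compact_imp_bounded by blast
  qed
  ultimately obtain C where C: "\<And>z. G z = C"
    using Liouville_theorem[of G] unfolding constant_on_def by auto
  have "H u v = C" for u v
  proof -
    have "H u v = G (Complex u (\<kappa> * v))" using \<kappa> by (simp add: G_def mult.assoc[symmetric])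
    then show ?thesis using C by simp
  qed
  then show ?thesis unfolding H_def by blast
qed

section \<open>Torsion and closed forms of the two structures\<close>

lemma vector_list_eqs: "[a, b, c, d] ! 0 = a" "[a, b, c, d] ! Suc 0 = b" "[a, b, c, d] ! 2 = c" "[a, b, c, d] ! 3 = d"
  by (simp_all add: eval_nat_numeral)

context
  fixes x :: "nat \<Rightarrow> real" and c s :: complex
  assumes x: "x \<in> torus_points 4" and c: "c = of_real (cos (2 * pi * x 0))" and s: "s = of_real (sin (2 * pi * x 0))"
begin

section \<open>Pointwise formulas in terms of cosine and sine\<close>

lemma cos_sin_sq: "c * c + s * s = 1"
  unfolding c s of_real_mult[symmetric] of_real_add[symmetric] by simp

lemma rot_vec_mat:
  "vec_mat 4 \<xi> (A_rot x) 0 = c * \<xi> 1 + s * \<xi> 2" "vec_mat 4 \<xi> (A_rot x) 1 = - c * \<xi> 0 - s * \<xi> 3"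
  "vec_mat 4 \<xi> (A_rot x) 2 = - s * \<xi> 0 + c * \<xi> 3" "vec_mat 4 \<xi> (A_rot x) 3 = s * \<xi> 1 - c * \<xi> 2"
  by (simp_all add: vec_mat_def sum_4 A_rot_def trig_mat_def trig_def c s vector_list_eqs)

lemma rot_mat_vec:
  "mat_vec 4 (A_rot x) z 0 = - c * z 1 - s * z 2" "mat_vec 4 (A_rot x) z 1 = c * z 0 + s * z 3"
  "mat_vec 4 (A_rot x) z 2 = s * z 0 - c * z 3" "mat_vec 4 (A_rot x) z 3 = - s * z 1 + c * z 2"
  by (simp_all add: mat_vec_def sum_4 A_rot_def trig_mat_def trig_def c s vector_list_eqs)

text \<open>Only derivatives along coordinate 0 survive, so a direction enters through its component
  0. The factor 2 pi from differentiation and the factor -(i/2) combine to -i pi.\<close>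

lemma rot_torsion: "rot.torsion x \<xi> z w = - \<i> * of_real pi *
   (z 0 * (\<xi> 0 * (s * w 1 - c * w 2) + \<xi> 1 * (c * w 3 - s * w 0) + \<xi> 2 * (c * w 0 + s * w 3) - \<xi> 3 * (c * w 1 + s * w 2))
  - w 0 * (\<xi> 0 * (s * z 1 - c * z 2) + \<xi> 1 * (c * z 3 - s * z 0) + \<xi> 2 * (c * z 0 + s * z 3) - \<xi> 3 * (c * z 1 + s * z 2)))"
  unfolding rot.torsion_def
  unfolding mat_vec_def sum_4 A_rot_def torus_partial_trig_mat vector_list_eqs c s
  by (simp add: algebra_simps)

lemma prod_vec_mat:
  "vec_mat 4 \<xi> (A_prod x) 0 = \<xi> 3" "vec_mat 4 \<xi> (A_prod x) 1 = 3/4 * s * \<xi> 1 + (5/4 - 3/4 * c) * \<xi> 2"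
  "vec_mat 4 \<xi> (A_prod x) 2 = - (5/4 + 3/4 * c) * \<xi> 1 - 3/4 * s * \<xi> 2" "vec_mat 4 \<xi> (A_prod x) 3 = - \<xi> 0"
  by (simp_all add: vec_mat_def sum_4 A_prod_def trig_mat_def trig_def c s vector_list_eqs algebra_simps)

lemma prod_mat_vec:
  "mat_vec 4 (A_prod x) z 0 = - z 3" "mat_vec 4 (A_prod x) z 1 = 3/4 * s * z 1 - (5/4 + 3/4 * c) * z 2"
  "mat_vec 4 (A_prod x) z 2 = (5/4 - 3/4 * c) * z 1 - 3/4 * s * z 2" "mat_vec 4 (A_prod x) z 3 = z 0"
  by (simp_all add: mat_vec_def sum_4 A_prod_def trig_mat_def trig_def c s vector_list_eqs algebra_simps)

lemma prod_torsion: "prd.torsion x \<xi> z w = - \<i> * of_real pi * (3/4) *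
   (z 0 * (\<xi> 1 * (c * w 1 + s * w 2) + \<xi> 2 * (s * w 1 - c * w 2))
  - w 0 * (\<xi> 1 * (c * z 1 + s * z 2) + \<xi> 2 * (s * z 1 - c * z 2)))"
  unfolding prd.torsion_def
  unfolding mat_vec_def sum_4 A_prod_def torus_partial_trig_mat vector_list_eqs c s
  by (simp add: algebra_simps)

lemma prod_torsion_scale:
  assumes "\<eta> 1 = k * \<xi> 1" "\<eta> 2 = k * \<xi> 2"
  shows "prd.torsion x \<eta> z w = k * prd.torsion x \<xi> z w"
  unfolding prod_torsion assms by (simp add: algebra_simps)

section \<open>The Nijenhuis tensors have rank one\<close>

lemma nijenhuis_rank_rot: "nijenhuis_rank (torus 4) (acs 4 A_rot) x = 1"
proof (rule rot.nijenhuis_rank_eq_1[OF x])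
  \<comment> \<open>As a vector the first list is X_1 + i X_2, and as a covector it is the same
    combination of the dual frame, since the frame is orthonormal; the second list is X_4 - i X_3.
    Both vectors are of type (0,1) and the covector is of type (1,0).\<close>
  let ?\<xi> = "\<lambda>k. [1, \<i> * c, \<i> * s, 0] ! k" and ?w = "\<lambda>k. [0, \<i> * s, - \<i> * c, 1] ! k"
  show "rot.type_10 x ?\<xi>" "rot.type_01 x ?\<xi>" "rot.type_01 x ?w"
    using cos_sin_sq
    by (simp_all add: rot.type_10_def rot.type_01_def all_less_4 rot_vec_mat[simplified] rot_mat_vec[simplified]
        vector_list_eqs algebra_simps flip: distrib_left)
  \<comment> \<open>The type conditions reduce the torsion to one fixed expression in
    \<open>z\<close> and \<open>w\<close> times the component \<open>\<xi> 0\<close>. This gives the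
    proportionality with factor \<open>\<eta> 0\<close>, and the value 2 pi on the chosen
    vectors.\<close>
  have tor: "rot.torsion x \<xi> z w = 2 * of_real pi * \<xi> 0 * (z 0 * w 3 - w 0 * z 3)"
    if "rot.type_10 x \<xi>" "rot.type_01 x z" "rot.type_01 x w" for \<xi> z w
  proof -
    have \<xi>: "c * \<xi> 1 + s * \<xi> 2 = \<i> * \<xi> 0"
      using that(1) unfolding rot.type_10_def all_less_4 rot_vec_mat by blast
    have u: "s * u 1 - c * u 2 = \<i> * u 3 \<and> c * u 1 + s * u 2 = \<i> * u 0" if "rot.type_01 x u" for u
    proof -
      have "- c * u 1 - s * u 2 = - \<i> * u 0" "- s * u 1 + c * u 2 = - \<i> * u 3"
        using that unfolding rot.type_01_def all_less_4 rot_mat_vec by blast+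
      then show ?thesis by algebra
    qed
    have "rot.torsion x \<xi> z w = - \<i> * of_real pi *
        (z 0 * (\<xi> 0 * (\<i> * w 3) + \<xi> 1 * (c * w 3 - s * w 0) + \<xi> 2 * (c * w 0 + s * w 3) - \<xi> 3 * (\<i> * w 0))
       - w 0 * (\<xi> 0 * (\<i> * z 3) + \<xi> 1 * (c * z 3 - s * z 0) + \<xi> 2 * (c * z 0 + s * z 3) - \<xi> 3 * (\<i> * z 0)))"
      unfolding rot_torsion using u[OF that(2)] u[OF that(3)] by simp
    also have "\<dots> = - \<i> * of_real pi * ((\<i> * \<xi> 0 + (c * \<xi> 1 + s * \<xi> 2)) * (z 0 * w 3 - w 0 * z 3))"
      by (simp add: algebra_simps)
    also have "\<dots> = 2 * of_real pi * \<xi> 0 * (z 0 * w 3 - w 0 * z 3)"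
      unfolding \<xi> by (simp add: algebra_simps)
    finally show ?thesis .
  qed
  have types: "rot.type_10 x ?\<xi>" "rot.type_01 x ?\<xi>" "rot.type_01 x ?w" by fact+
  show "rot.torsion x ?\<xi> ?\<xi> ?w \<noteq> 0"
    unfolding tor[OF types] vector_list_eqs by simp
  show "\<exists>k. \<forall>z w. rot.type_01 x z \<longrightarrow> rot.type_01 x w \<longrightarrow> rot.torsion x \<eta> z w = k * rot.torsion x ?\<xi> z w"
    if "rot.type_10 x \<eta>" for \<eta>
    using tor[OF that] tor[OF types(1)] by (intro exI[of _ "\<eta> 0"]) (simp add: vector_list_eqs)
qed

lemma five_three_cos_nonzero: "5/4 - 3/4 * c \<noteq> 0" "5/4 + 3/4 * c \<noteq> 0"
proof -
  have "5/4 - 3/4 * cos (2 * pi * x 0) > 0" "5/4 + 3/4 * cos (2 * pi * x 0) > 0"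
    using cos_le_one[of "2 * pi * x 0"] cos_ge_minus_one[of "2 * pi * x 0"] by linarith+
  moreover have "5/4 - 3/4 * c = of_real (5/4 - 3/4 * cos (2 * pi * x 0))" "5/4 + 3/4 * c = of_real (5/4 + 3/4 * cos (2 * pi * x 0))"
    by (simp_all add: c)
  ultimately show "5/4 - 3/4 * c \<noteq> 0" "5/4 + 3/4 * c \<noteq> 0"
    by (metis of_real_eq_0_iff less_irrefl)+
qed

lemma nijenhuis_rank_prod: "nijenhuis_rank (torus 4) (acs 4 A_prod) x = 1"
proof (rule prd.nijenhuis_rank_eq_1[OF x])
  \<comment> \<open>The covector and \<open>?w\<close> solve one row of the eigenvector equation of
    the block on directions 1 and 2, with denominators cleared; \<open>?v\<close> is the eigenvector
    in directions 0 and 3.\<close>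
  let ?\<xi> = "\<lambda>k. [0, 5/4 - 3/4 * c, \<i> - 3/4 * s, 0] ! k"
  let ?v = "\<lambda>k. [1, 0, 0, \<i>] ! k" and ?w = "\<lambda>k. [0, 5/4 + 3/4 * c, \<i> + 3/4 * s, 0] ! k"
  have cc: "c * (c * u) = u - s * (s * u)" for u
  proof -
    have "c * (c * u) + s * (s * u) = (c * c + s * s) * u" by (simp add: algebra_simps)
    then show ?thesis unfolding cos_sin_sq by (simp add: algebra_simps)
  qed
  show "prd.type_10 x ?\<xi>" "prd.type_01 x ?v" "prd.type_01 x ?w"
    by (simp_all add: prd.type_10_def prd.type_01_def all_less_4 prod_vec_mat[simplified] prod_mat_vec[simplified]
        vector_list_eqs) (simp_all add: field_simps cc)
  \<comment> \<open>Up to a nonzero factor this is the torsion on the chosen vectors. Its real and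
    imaginary parts are multiples of the cosine and of the sine, which have no common zero.\<close>
  have nz: "32 * c + 40 * \<i> * s \<noteq> 0"
    by (auto simp: c s complex_eq_iff dest!: sin_zero_abs_cos_one)
  let ?X = "(5/4 - 3/4 * c) * (c * (5/4 + 3/4 * c) + s * (\<i> + 3/4 * s)) + (\<i> - 3/4 * s) * (s * (5/4 + 3/4 * c) - c * (\<i> + 3/4 * s))"
  have "16 * ?X = 41 * c - 9 * (c * c + s * s) * c + 40 * \<i> * s"
    by (simp add: algebra_simps)
  then have "16 * ?X = 32 * c + 40 * \<i> * s" unfolding cos_sin_sq by simp
  then have X: "?X \<noteq> 0" using nz by (metis mult_zero_right)
  have "prd.torsion x ?\<xi> ?v ?w = - \<i> * of_real pi * (3/4) * ?X"
    unfolding prod_torsion by (simp add: vector_list_eqs)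
  then show "prd.torsion x ?\<xi> ?v ?w \<noteq> 0"
    using X by simp
  show "\<exists>k. \<forall>z w. prd.type_01 x z \<longrightarrow> prd.type_01 x w \<longrightarrow> prd.torsion x \<eta> z w = k * prd.torsion x ?\<xi> z w"
    if "prd.type_10 x \<eta>" for \<eta>
  proof (intro exI allI impI)
    \<comment> \<open>The components 1 and 2 of a covector of type (1,0) lie on the eigenline of the
      block, so they are proportional to those of \<open>?\<xi>\<close>; the torsion sees no other
      components of the covector.\<close>
    have "3/4 * s * \<eta> 1 + (5/4 - 3/4 * c) * \<eta> 2 = \<i> * \<eta> 1"
      using that unfolding prd.type_10_def all_less_4 prod_vec_mat by blast
    then have "(5/4 - 3/4 * c) * \<eta> 2 = \<eta> 1 * (\<i> - 3/4 * s)" by algebra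
    moreover have "\<eta> 2 = (5/4 - 3/4 * c) * \<eta> 2 / (5/4 - 3/4 * c)"
      using five_three_cos_nonzero by simp
    ultimately have 2: "\<eta> 2 = \<eta> 1 / (5/4 - 3/4 * c) * (\<i> - 3/4 * s)"
      by simp
    have 1: "\<eta> 1 = \<eta> 1 / (5/4 - 3/4 * c) * (5/4 - 3/4 * c)"
      using five_three_cos_nonzero by simp
    fix z w
    show "prd.torsion x \<eta> z w = \<eta> 1 / (5/4 - 3/4 * c) * prd.torsion x ?\<xi> z w"
      by (rule prod_torsion_scale) (use 1 2 in \<open>simp_all add: vector_list_eqs\<close>)
  qed
qed

text \<open>The two conclusions are the values of the form on X_1 and X_2, the vectors spanned by
  the Nijenhuis tensor, which a form in the space must annihilate. The form need not be of pure
  type, so both eigenvalues of J are exploited and the two equations are then added and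
  subtracted.\<close>

lemma rot_closed_algebraic:
  assumes a: "\<And>k. k < 4 \<Longrightarrow> torus_differentiable 4 (a k)" and closed: "closed_comps 4 a"
    and closed': "closed_comps 4 (\<lambda>k x. vec_mat 4 (\<lambda>j. a j x) (A_rot x) k)"
  shows "a 0 x = 0" "c * a 1 x + s * a 2 x = 0"
proof -
  \<comment> \<open>For \<open>e\<close> = i these are the vectors from the computation of the rank,
    for \<open>e\<close> = -i their conjugates; the eigenvalue of J is \<open>- e\<close>.\<close>
  have tor: "rot.torsion x (\<lambda>k. a k x) (\<lambda>k. [1, e * c, e * s, 0] ! k) (\<lambda>k. [0, e * s, - e * c, 1] ! k) = 0"
    if e: "e * e = -1" for e
  proof (rule rot.torsion_closed[OF a closed closed' x])
    have ee: "e * (e * u) = - u" for u using e by (simp add: mult.assoc[symmetric])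
    have cs: "e * (c * (c * u)) + e * (s * (s * u)) = e * u" for u
    proof -
      have "e * (c * (c * u)) + e * (s * (s * u)) = (c * c + s * s) * (e * u)" by (simp add: algebra_simps)
      then show ?thesis unfolding cos_sin_sq by simp
    qed
    have "\<forall>i<4. mat_vec 4 (A_rot x) (\<lambda>k. [1, e * c, e * s, 0] ! k) i = - e * [1, e * c, e * s, 0] ! i"
      using cs[of 1] by (simp add: all_less_4 rot_mat_vec[simplified] vector_list_eqs algebra_simps ee e)
    then show "mat_vec 4 (A_rot x) (\<lambda>k. [1, e * c, e * s, 0] ! k) i = - e * [1, e * c, e * s, 0] ! i" if "i < 4" for i
      using that by blast
    have "\<forall>i<4. mat_vec 4 (A_rot x) (\<lambda>k. [0, e * s, - e * c, 1] ! k) i = - e * [0, e * s, - e * c, 1] ! i"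
      using cs[of 1] by (simp add: all_less_4 rot_mat_vec[simplified] vector_list_eqs algebra_simps ee e)
    then show "mat_vec 4 (A_rot x) (\<lambda>k. [0, e * s, - e * c, 1] ! k) i = - e * [0, e * s, - e * c, 1] ! i" if "i < 4" for i
      using that by blast
  qed
  have "e * a 0 x + (c * a 1 x + s * a 2 x) = 0" if e: "e * e = -1" for e
  proof -
    have "0 = - \<i> * of_real pi * (a 0 x * (e * (c * c + s * s)) + (c * a 1 x + s * a 2 x))"
      using tor[OF e] unfolding rot_torsion vector_list_eqs by (simp add: algebra_simps vector_list_eqs)
    then show ?thesis unfolding cos_sin_sq by (simp add: mult.commute)
  qed
  from this[of \<i>] this[of "- \<i>"] have *: "\<i> * a 0 x + (c * a 1 x + s * a 2 x) = 0" "- \<i> * a 0 x + (c * a 1 x + s * a 2 x) = 0"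
    by simp_all
  then have "2 * \<i> * a 0 x = 0" by algebra
  then show "a 0 x = 0" by simp
  then show "c * a 1 x + s * a 2 x = 0" using * by simp
qed

lemma prod_closed_algebraic:
  assumes a: "\<And>k. k < 4 \<Longrightarrow> torus_differentiable 4 (a k)" and closed: "closed_comps 4 a"
    and closed': "closed_comps 4 (\<lambda>k x. vec_mat 4 (\<lambda>j. a j x) (A_prod x) k)"
  shows "a 1 x = 0" "a 2 x = 0"
proof -
  \<comment> \<open>The combinations through which the form enters \<open>prod_torsion\<close>. They
    arise from (a 1, a 2) by a reflection, which is its own inverse, so their vanishing makes a 1
    and a 2 vanish.\<close>
  define u where "u = c * a 1 x + s * a 2 x"
  define v where "v = s * a 1 x - c * a 2 x"
  have cc: "c * (c * u) = u - s * (s * u)" for u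
  proof -
    have "c * (c * u) + s * (s * u) = (c * c + s * s) * u" by (simp add: algebra_simps)
    then show ?thesis unfolding cos_sin_sq by (simp add: algebra_simps)
  qed
  have "(5/4 + 3/4 * c) * u + (e + 3/4 * s) * v = 0" if e: "e * e = -1" for e
  proof -
    have ee: "e * (e * u) = - u" for u using e by (simp add: mult.assoc[symmetric])
    have "prd.torsion x (\<lambda>k. a k x) (\<lambda>k. [1, 0, 0, e] ! k) (\<lambda>k. [0, 5/4 + 3/4 * c, e + 3/4 * s, 0] ! k) = 0"
    proof (rule prd.torsion_closed[OF a closed closed' x])
      have "\<forall>i<4. mat_vec 4 (A_prod x) (\<lambda>k. [1, 0, 0, e] ! k) i = - e * [1, 0, 0, e] ! i"
        by (simp add: all_less_4 prod_mat_vec[simplified] vector_list_eqs algebra_simps e)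
      then show "mat_vec 4 (A_prod x) (\<lambda>k. [1, 0, 0, e] ! k) i = - e * [1, 0, 0, e] ! i" if "i < 4" for i
        using that by blast
      have "\<forall>i<4. mat_vec 4 (A_prod x) (\<lambda>k. [0, 5/4 + 3/4 * c, e + 3/4 * s, 0] ! k) i = - e * [0, 5/4 + 3/4 * c, e + 3/4 * s, 0] ! i"
        by (simp add: all_less_4 prod_mat_vec[simplified] vector_list_eqs) (simp add: field_simps cc e ee)
      then show "mat_vec 4 (A_prod x) (\<lambda>k. [0, 5/4 + 3/4 * c, e + 3/4 * s, 0] ! k) i = - e * [0, 5/4 + 3/4 * c, e + 3/4 * s, 0] ! i"
        if "i < 4" for i using that by blast
    qed
    then have "- \<i> * of_real pi * (3/4) * ((5/4 + 3/4 * c) * u + (e + 3/4 * s) * v) = 0"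
      unfolding prod_torsion vector_list_eqs u_def v_def by (simp add: algebra_simps vector_list_eqs)
    then show ?thesis by simp
  qed
  from this[of \<i>] this[of "- \<i>"]
  have *: "(5/4 + 3/4 * c) * u + (\<i> + 3/4 * s) * v = 0" "(5/4 + 3/4 * c) * u + (- \<i> + 3/4 * s) * v = 0"
    by simp_all
  have "2 * \<i> * v = ((5/4 + 3/4 * c) * u + (\<i> + 3/4 * s) * v) - ((5/4 + 3/4 * c) * u + (- \<i> + 3/4 * s) * v)"
    by (simp add: algebra_simps)
  then have v: "v = 0" unfolding * by simp
  then have u: "u = 0" using * five_three_cos_nonzero by simp
  have "a 1 x = (c * c + s * s) * a 1 x" "a 2 x = (c * c + s * s) * a 2 x" unfolding cos_sin_sq by simp_all
  then have "a 1 x = c * u + s * v" "a 2 x = s * u - c * v" by (simp_all add: u_def v_def algebra_simps)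
  then show "a 1 x = 0" "a 2 x = 0" using u v by simp_all
qed

text \<open>The terms with 2 pi come from differentiating the rotating frame. In the first formula
  this term is 2 pi times the value on X_3, which is how the bracket of X_1 and X_2 enters.\<close>

lemma rot_partial_J:
  assumes a: "\<And>k. k < 4 \<Longrightarrow> torus_differentiable 4 (a k)"
  shows "torus_partial 0 (\<lambda>x. vec_mat 4 (\<lambda>j. a j x) (A_rot x) 0) x =
      2 * of_real pi * (c * a 2 x - s * a 1 x) + (c * torus_partial 0 (a 1) x + s * torus_partial 0 (a 2) x)"
    and "torus_partial 0 (\<lambda>x. vec_mat 4 (\<lambda>j. a j x) (A_rot x) 1) x =
      2 * of_real pi * (s * a 0 x - c * a 3 x) - (c * torus_partial 0 (a 0) x + s * torus_partial 0 (a 3) x)"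
    and "torus_partial 0 (\<lambda>x. vec_mat 4 (\<lambda>j. a j x) (A_rot x) 2) x =
      - 2 * of_real pi * (c * a 0 x + s * a 3 x) + (c * torus_partial 0 (a 3) x - s * torus_partial 0 (a 0) x)"
  using rot.differentiable_vec_mat(2)[of a _ x 0] a x
  by (simp_all add: sum_4 A_rot_def torus_partial_trig_mat vector_list_eqs c s)
    (simp_all add: trig_mat_def trig_def vector_list_eqs algebra_simps)

end

lemma torus_partial_zero:
  assumes "x \<in> torus_points n" "l < n" "\<And>y. y \<in> torus_points n \<Longrightarrow> f y = 0"
  shows "torus_partial l f x = 0"
  using torus_partial_cong[OF assms(1,2), of f "\<lambda>_. 0"] assms(3) torus_partialI[of "\<lambda>_. 0" x l 0] by simp

lemma closed_compsD:
  "closed_comps n a \<Longrightarrow> x \<in> torus_points n \<Longrightarrow> j < n \<Longrightarrow> k < n \<Longrightarrow>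
    torus_partial j (a k) x = torus_partial k (a j) x"
  by (simp add: closed_comps_def)

text \<open>The form and its image under J both vanish on X_1, the coordinate direction 0.
  Closedness then removes the derivatives along this direction of all other components, and the
  rotation of the frame forces the values on X_3 and X_4 to be 0.\<close>

lemma rot_closed_zero:
  assumes a: "\<And>k. k < 4 \<Longrightarrow> torus_differentiable 4 (a k)" and closed: "closed_comps 4 a"
    and closed': "closed_comps 4 (\<lambda>k x. vec_mat 4 (\<lambda>j. a j x) (A_rot x) k)"
    and x: "x \<in> torus_points 4"
  shows "\<forall>k<4. a k x = 0"
proof -
  define c s where "c = complex_of_real (cos (2 * pi * x 0))" and "s = complex_of_real (sin (2 * pi * x 0))"
  define b where "b k x = vec_mat 4 (\<lambda>j. a j x) (A_rot x) k" for k x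
  have closed_b: "closed_comps 4 b" using closed' by (simp add: b_def[abs_def])
  have a0: "a 0 y = 0" if "y \<in> torus_points 4" for y
    using rot_closed_algebraic(1)[OF that refl refl a closed closed'] by simp
  have b0: "b 0 y = 0" if "y \<in> torus_points 4" for y
    unfolding b_def rot_vec_mat(1)[OF that refl refl]
    using rot_closed_algebraic(2)[OF that refl refl a closed closed'] by simp
  note rot_partial_J' = rot_partial_J[OF x c_def s_def, of a, OF a, folded b_def]
  have cs: "c * c + s * s = 1" by (rule cos_sin_sq[OF x c_def s_def])
  \<comment> \<open>The components \<open>a 0\<close> and \<open>b 0\<close> vanish on the whole
    torus, not just at \<open>x\<close>, so all their derivatives vanish; closedness transfers this
    to the derivatives along coordinate 0 of the other components.\<close>
  have D0a: "torus_partial l (a 0) x = 0" and D0b: "torus_partial l (b 0) x = 0" if "l < 4" for l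
    using torus_partial_zero[OF x that] a0 b0 by blast+
  have D: "torus_partial 0 (a 1) x = 0" "torus_partial 0 (a 2) x = 0"
    "torus_partial 0 (b 1) x = 0" "torus_partial 0 (b 2) x = 0"
    using closed_compsD[OF closed x, of 0] closed_compsD[OF closed_b x, of 0] D0a D0b by simp_all
  \<comment> \<open>This is the value on X_3; together with the value on X_2 below it determines a 1
    and a 2 by a rotation.\<close>
  have "2 * of_real pi * (c * a 2 x - s * a 1 x) = 0"
    using rot_partial_J'(1) D D0b[of 0] by simp
  then have v: "c * a 2 x - s * a 1 x = 0" by simp
  have u: "c * a 1 x + s * a 2 x = 0"
    using rot_closed_algebraic(2)[OF x c_def s_def a closed closed'] by simp
  have "a 1 x = (c * c + s * s) * a 1 x" "a 2 x = (c * c + s * s) * a 2 x" unfolding cs by simp_all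
  then have "a 1 x = c * (c * a 1 x + s * a 2 x) - s * (c * a 2 x - s * a 1 x)"
    "a 2 x = s * (c * a 1 x + s * a 2 x) + c * (c * a 2 x - s * a 1 x)" by (simp_all add: algebra_simps)
  then have a12: "a 1 x = 0" "a 2 x = 0" unfolding u v by simp_all
  \<comment> \<open>The components 1 and 2 of the image under J give two linear equations in a 3 and
    its derivative \<open>t\<close>; weighting them with c and -s eliminates
    \<open>t\<close>.\<close>
  define t where "t = torus_partial 0 (a 3) x"
  have 1: "2 * of_real pi * (c * a 3 x) + s * t = 0" and 2: "c * t - 2 * of_real pi * (s * a 3 x) = 0"
    using rot_partial_J'(2,3) D D0a[of 0] a0[OF x] by (simp_all add: t_def algebra_simps)
  have "c * (2 * of_real pi * (c * a 3 x) + s * t) - s * (c * t - 2 * of_real pi * (s * a 3 x)) = 2 * of_real pi * ((c * c + s * s) * a 3 x)"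
    by (simp add: algebra_simps)
  then have "a 3 x = 0" unfolding 1 2 cs by simp
  then show ?thesis using a0[OF x] a12 by (simp add: all_less_4)
qed

text \<open>Once a 1 and a 2 vanish, the image under J is a 3 dx_0 - a 0 dx_3. Closedness of both
  forms makes the coefficients independent of coordinates 1 and 2 and gives Cauchy-Riemann equations
  in coordinates 0 and 3.\<close>

lemma prod_closed_constant:
  assumes smooth: "\<And>k. k < 4 \<Longrightarrow> torus_smooth 4 (a k)" and closed: "closed_comps 4 a"
    and closed': "closed_comps 4 (\<lambda>k x. vec_mat 4 (\<lambda>j. a j x) (A_prod x) k)"
  shows "\<exists>C D. \<forall>x\<in>torus_points 4. a 0 x = C \<and> a 1 x = 0 \<and> a 2 x = 0 \<and> a 3 x = D"
proof -
  have a: "torus_differentiable 4 (a k)" if "k < 4" for k by (rule torus_smooth_differentiable[OF smooth[OF that]])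
  define b where "b k x = vec_mat 4 (\<lambda>j. a j x) (A_prod x) k" for k x
  have closed_b: "closed_comps 4 b" using closed' by (simp add: b_def[abs_def])
  have a12: "a 1 x = 0" "a 2 x = 0" if "x \<in> torus_points 4" for x
    using prod_closed_algebraic[OF that refl refl a closed closed'] by simp_all
  have D_a: "torus_partial l (a 0) x = 0" "torus_partial l (a 3) x = 0" if x: "x \<in> torus_points 4" and l: "l = 1 \<or> l = 2" for x l
  proof -
    have "torus_partial k (a l) x = 0" if "k < 4" for k
      using torus_partial_zero[OF x that, of "a l"] a12 l by auto
    then show "torus_partial l (a 0) x = 0" "torus_partial l (a 3) x = 0"
      using closed_compsD[OF closed x, of l] l by auto
  qed
  have CR1: "torus_partial 3 (a 0) x = torus_partial 0 (a 3) x" if x: "x \<in> torus_points 4" for x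
    using closed_compsD[OF closed x, of 3 0] by simp
  have CR2: "torus_partial 3 (a 3) x = - torus_partial 0 (a 0) x" if x: "x \<in> torus_points 4" for x
  proof -
    have "torus_partial 3 (a 3) x = torus_partial 3 (b 0) x"
      unfolding b_def by (rule torus_partial_cong[OF x]) (simp_all add: prod_vec_mat(1)[OF _ refl refl])
    also have "\<dots> = torus_partial 0 (b 3) x" by (rule closed_compsD[OF closed_b x]) simp_all
    also have "\<dots> = torus_partial 0 (\<lambda>y. - a 0 y) x"
      unfolding b_def by (rule torus_partial_cong[OF x]) (simp_all add: prod_vec_mat(4)[OF _ refl refl])
    also have "\<dots> = - torus_partial 0 (a 0) x"
      by (intro torus_partialI has_vector_derivative_minus torus_differentiableD[OF a x]) simp_all
    finally show ?thesis .
  qed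
  \<comment> \<open>The coefficients are complex valued, so the combinations for
    \<open>\<sigma>\<close> = 1 and \<open>\<sigma>\<close> = -1 are independent of each other; one
    is holomorphic and the other antiholomorphic, and together they recover a 0 and a 3.\<close>
  have "\<exists>C. \<forall>x\<in>torus_points 4. a 0 x + of_real \<sigma> * \<i> * a 3 x = C" if \<sigma>: "\<sigma> * \<sigma> = 1" for \<sigma> :: real
  proof -
    define f where "f x = a 0 x + of_real \<sigma> * \<i> * a 3 x" for x
    have f: "torus_smooth 4 f"
      unfolding f_def by (intro torus_smooth_add torus_smooth_cmult smooth) simp_all
    have Df: "torus_partial l f x = torus_partial l (a 0) x + of_real \<sigma> * \<i> * torus_partial l (a 3) x"
      if "x \<in> torus_points 4" "l < 4" for x l
      unfolding f_def
      by (intro torus_partialI has_vector_derivative_add has_vector_derivative_mult_right torus_differentiableD[OF a that(1)]) (use that in simp_all)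
    have "\<exists>C. \<forall>u v. f (wrap (plane_point 0 3 u v)) = C"
    proof (rule torus_liouville[OF f, where \<kappa>="- \<sigma>"])
      fix x assume x: "x \<in> torus_points 4"
      have "torus_partial 3 f x = torus_partial 0 (a 3) x - of_real \<sigma> * \<i> * torus_partial 0 (a 0) x"
        by (simp add: Df[OF x] CR1[OF x] CR2[OF x])
      also have "\<dots> = of_real (\<sigma> * \<sigma>) * torus_partial 0 (a 3) x - of_real \<sigma> * \<i> * torus_partial 0 (a 0) x"
        unfolding \<sigma> by simp
      also have "\<dots> = of_real (- \<sigma>) * \<i> * torus_partial 0 f x"
        by (simp add: Df[OF x] algebra_simps)
      finally show "torus_partial 3 f x = of_real (- \<sigma>) * \<i> * torus_partial 0 f x" .
    qed (use \<sigma> in simp_all)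
    then obtain C where C: "\<And>u v. f (wrap (plane_point 0 3 u v)) = C" by blast
    have "f x = C" if x: "x \<in> torus_points 4" for x
    proof -
      let ?p = "plane_point 0 3 (x 0) (x 3)"
      have p: "?p \<in> topspace (Euclidean_space 4)" "?p(1 := x 1) \<in> topspace (Euclidean_space 4)"
        by (simp_all add: topspace_Euclidean_space plane_point_def)
      \<comment> \<open>The point is reached from the plane of coordinates 0 and 3 by changing
        coordinates 1 and 2, along which \<open>f\<close> does not vary.\<close>
      have "x i = ((?p(1 := x 1))(2 := x 2)) i" for i
      proof (cases "i < 4")
        case True
        then have "i = 0 \<or> i = 1 \<or> i = 2 \<or> i = 3" by auto
        then show ?thesis by (auto simp: plane_point_def)
      qed (use x in \<open>auto simp: torus_points_def plane_point_def\<close>)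
      then have "x = (?p(1 := x 1))(2 := x 2)" by blast
      then have "f x = f (wrap ((?p(1 := x 1))(2 := x 2)))" using wrap_id[OF x] by simp
      also have "\<dots> = f (wrap (?p(1 := x 1)))"
        by (rule torus_partial_zero_constant[OF f _ p(2)]) (simp_all add: Df D_a)
      also have "\<dots> = f (wrap ?p)"
        by (rule torus_partial_zero_constant[OF f _ p(1)]) (simp_all add: Df D_a)
      finally show ?thesis using C by simp
    qed
    then show ?thesis unfolding f_def by blast
  qed
  from this[of 1] this[of "-1"] obtain C D where CD: "\<And>x. x \<in> torus_points 4 \<Longrightarrow> a 0 x + \<i> * a 3 x = C"
    "\<And>x. x \<in> torus_points 4 \<Longrightarrow> a 0 x - \<i> * a 3 x = D" by auto
  have "a 0 x = (C + D) / 2 \<and> a 3 x = (C - D) / (2 * \<i>)" if "x \<in> torus_points 4" for x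
    unfolding CD(1)[OF that, symmetric] CD(2)[OF that, symmetric] by simp
  then show ?thesis using a12 by blast
qed

section \<open>The invariants\<close>

lemma h1_d_dc_rot: "h1_d_dc (torus 4) (acs 4 A_rot) = 0"
proof -
  interpret vs: vector_space form_scale by (rule vector_space_form_scale)
  have "{\<alpha> \<in> forms (torus 4) 1. ext_d (torus 4) \<alpha> = 0 \<and> d_c (torus 4) (acs 4 A_rot) 1 \<alpha> = 0} \<subseteq> vs.span {}"
    unfolding rot.h1_space
  proof
    fix \<alpha> assume "\<alpha> \<in> {one_form 4 a | a. (\<forall>k<4. torus_smooth 4 (a k)) \<and> closed_comps 4 a \<and>
      closed_comps 4 (\<lambda>k x. vec_mat 4 (\<lambda>j. a j x) (A_rot x) k)}"
    then obtain a where a: "\<alpha> = one_form 4 a" "\<And>k. k < 4 \<Longrightarrow> torus_smooth 4 (a k)" "closed_comps 4 a"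
      "closed_comps 4 (\<lambda>k x. vec_mat 4 (\<lambda>j. a j x) (A_rot x) k)" by blast
    have "\<forall>k<4. a k x = 0" if "x \<in> torus_points 4" for x
      by (rule rot_closed_zero[OF _ a(3,4) that]) (rule torus_smooth_differentiable[OF a(2)])
    then have "\<alpha> = 0" by (auto simp: a(1) one_form_def covec_def fun_eq_iff)
    then show "\<alpha> \<in> vs.span {}" by simp
  qed
  then have "vs.dim {\<alpha> \<in> forms (torus 4) 1. ext_d (torus 4) \<alpha> = 0 \<and> d_c (torus 4) (acs 4 A_rot) 1 \<alpha> = 0} \<le> card ({} :: (nat \<Rightarrow> real) form set)"
    by (rule vs.dim_le_card) simp
  then show ?thesis by (simp add: h1_d_dc_def)
qed

text \<open>The form dx_0 and its image -dx_3 under J have constant coefficients and are closed, so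
  the space is nonzero.\<close>

lemma h1_d_dc_prod: "h1_d_dc (torus 4) (acs 4 A_prod) \<noteq> 0"
proof
  interpret vs: vector_space form_scale by (rule vector_space_form_scale)
  define S where "S = {\<alpha> \<in> forms (torus 4) 1. ext_d (torus 4) \<alpha> = 0 \<and> d_c (torus 4) (acs 4 A_prod) 1 \<alpha> = 0}"
  define \<theta> where "\<theta> j = one_form 4 (\<lambda>k x. if k = j then 1 else 0)" for j
  assume "h1_d_dc (torus 4) (acs 4 A_prod) = 0"
  then have dim: "vs.dim S = 0" by (simp add: h1_d_dc_def S_def)
  have S: "S = {one_form 4 a | a. (\<forall>k<4. torus_smooth 4 (a k)) \<and> closed_comps 4 a \<and>
      closed_comps 4 (\<lambda>k x. vec_mat 4 (\<lambda>j. a j x) (A_prod x) k)}"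
    unfolding S_def by (rule prd.h1_space)
  \<comment> \<open>The finite spanning set makes a basis finite, so that dimension 0 forces the
    zero space and cannot stem from the value 0 of \<open>card\<close> on an infinite basis.\<close>
  have span: "S \<subseteq> vs.span {\<theta> 0, \<theta> 3}"
  proof
    fix \<alpha> assume "\<alpha> \<in> S"
    then obtain a where a: "\<alpha> = one_form 4 a" "\<And>k. k < 4 \<Longrightarrow> torus_smooth 4 (a k)" "closed_comps 4 a"
      "closed_comps 4 (\<lambda>k x. vec_mat 4 (\<lambda>j. a j x) (A_prod x) k)" unfolding S by blast
    obtain C D where CD: "\<And>x. x \<in> torus_points 4 \<Longrightarrow> a 0 x = C \<and> a 1 x = 0 \<and> a 2 x = 0 \<and> a 3 x = D"
      using prod_closed_constant[OF a(2-4)] by blast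
    have "\<alpha> = form_scale C (\<theta> 0) + form_scale D (\<theta> 3)"
      using CD by (auto simp: a(1) \<theta>_def one_form_def covec_def fun_eq_iff form_scale_def sum_4)
    then show "\<alpha> \<in> vs.span {\<theta> 0, \<theta> 3}"
      by (simp add: vs.span_add vs.span_scale vs.span_base)
  qed
  obtain B where B: "B \<subseteq> S" "vs.independent B" "S \<subseteq> vs.span B" "card B = vs.dim S"
    using vs.basis_exists by blast
  have "finite B"
    using vs.independent_span_bound[of "{\<theta> 0, \<theta> 3}" B] B(1,2) span by auto
  then have "S \<subseteq> {0}" using B(3,4) dim by simp
  moreover have "\<theta> 0 \<in> S"
  proof -
    have "torus_partial l (\<lambda>x. C) x = 0" for l x and C :: complex
      by (rule torus_partialI) simp
    then have "closed_comps 4 (\<lambda>k x. if k = 0 then 1 else (0::complex))"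
      by (simp add: closed_comps_def)
    moreover have "vec_mat 4 (\<lambda>j. if j = 0 then 1 else 0) (A_prod x) k = (if k = 3 then -1 else 0)" if "k < 4" for x k
      using that by (auto simp: vec_mat_def sum_4 A_prod_def trig_mat_def trig_def vector_list_eqs eval_nat_numeral less_Suc_eq)
    then have "closed_comps 4 (\<lambda>k x. vec_mat 4 (\<lambda>j. if j = 0 then 1 else 0) (A_prod x) k)"
      using \<open>\<And>l x C. torus_partial l (\<lambda>x. C) x = 0\<close> by (simp add: closed_comps_def)
    ultimately show ?thesis
      unfolding S \<theta>_def using torus_smooth_const by blast
  qed
  ultimately have "\<theta> 0 = 0" by blast
  moreover have "(\<lambda>_. 0) \<in> torus_points 4" by (simp add: torus_points_def)
  ultimately have "covec 4 (\<lambda>_. 0) (\<lambda>k. if k = 0 then 1 else 0) = 0"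
    by (auto simp: \<theta>_def one_form_def dest!: fun_cong[of _ _ "\<lambda>_. 0"])
  with covec_unit[OF \<open>(\<lambda>_. 0) \<in> torus_points 4\<close>, of 0 "\<lambda>k. if k = 0 then 1 else 0"] show False
    by simp
qed

theorem proposition4p8:
  shows "\<exists>M :: (nat \<Rightarrow> real) mfd. compact_smooth_manifold M \<and>
    (\<exists>J1 J2. almost_complex_structure M J1 \<and> almost_complex_structure M J2 \<and>
       h1_d_dc M J1 \<noteq> h1_d_dc M J2) \<and>
    (\<exists>J1 J2. almost_complex_structure M J1 \<and> almost_complex_structure M J2 \<and>
       (\<forall>x\<in>points M. nijenhuis_rank M J1 x = nijenhuis_rank M J2 x) \<and>
       h1_d_dc M J1 \<noteq> h1_d_dc M J2)"
proof -
  have "h1_d_dc (torus 4) (acs 4 A_prod) \<noteq> h1_d_dc (torus 4) (acs 4 A_rot)"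
    using h1_d_dc_rot h1_d_dc_prod by simp
  moreover have "\<forall>x\<in>points (torus 4). nijenhuis_rank (torus 4) (acs 4 A_prod) x = nijenhuis_rank (torus 4) (acs 4 A_rot) x"
    by (simp add: nijenhuis_rank_prod[OF _ refl refl] nijenhuis_rank_rot[OF _ refl refl])
  ultimately show ?thesis
    using compact_smooth_manifold_torus prd.almost_complex_structure rot.almost_complex_structure by blast
qed

end
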